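(* Let $T|S$ be a $Q$-normal Galois extension of commutative rings with structure extension $1\to N\to G\xrightarrow{\pi_Q}Q\to1$ and structure homomorphism $\kappa_G\colon G\to\mathrm{Aut}^S(T)$. Let $k\in\mathrm H^3(Q,\mathrm U(S))$, let $A$ be a central $T$-algebra and $\sigma_G\colon G\to\mathrm{Out}(A)$ a $G$-normal structure on $A$ relative to $\kappa_G$, and suppose $\inf(k)=[\mathrm e_{(A,\sigma_G)}]\in\mathrm H^3(G,\mathrm U(T))$. Then there exist a group extension $\mathrm e\colon1\to\mathrm U(A)\xrightarrow{j}\Gamma\to N\to1$ and a homomorphism $\vartheta\colon\Gamma\to\mathrm{Aut}(A)$ such that $(\mathrm{id},\vartheta)\colon(\mathrm U(A),\Gamma,j)\to(\mathrm U(A),\mathrm{Aut}(A),\partial)$ is a morphism of crossed modules, and a $Q$-normal structure $\sigma_Q$ on the crossed product algebra $C=(A,N,\mathrm e,\vartheta)$, which is a central $S$-algebra, such that: the $Q$-normal algebra $(C,\sigma_Q)$ has Teichmüller class $k$; there is a homomorphism $\chi_G\colon G\to\mathrm{Out}(C,A)$ turning the obvious embedding $A\subseteq C$ into a strong $Q$-normal Deuring embedding with respect to $\sigma_Q$ and the structure extension; and the associated $G$-normal structure $\mathrm{res}\circ\chi_G\colon G\to\mathrm{Out}(A)$ coincides with $\sigma_G$.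
   Context: $S$ commutative unital, $Q$ group acting via $\kappa_Q$; $\mathrm U$ = units. $T|S$ Galois with group $N=\mathrm{Aut}(T|S)$; $G=\mathrm{Aut}^S(T)\times_{\mathrm{Aut}(S)}Q$ ($\mathrm{Aut}^S(T)$ automorphisms of $T$ preserving $S$) with projections $\pi_Q$, $\kappa_G$; $Q$-normality means $\pi_Q$ surjective. For a central algebra $B$ over its center $Z$: $\mathrm{Out}(B)$ automorphisms modulo inner; $\partial\colon\mathrm U(B)\to\mathrm{Aut}(B)$ conjugation; a normal structure is a homomorphism to $\mathrm{Out}(B)$ lifting the given action on $Z$; Teichmüller class: class in $\mathrm H^3$ of $0\to\mathrm U(Z)\to\mathrm U(B)\to\mathrm{Aut}(B)\times_{\mathrm{Out}(B)}(\text{group})\to(\text{group})\to1$ (standard identification of $\mathrm H^3$ with classes of crossed 2-fold extensions). Crossed module morphism condition: $\vartheta(j(u))$ is conjugation by $u$ and $j(\vartheta(x)u)=xj(u)x^{-1}$. Crossed product: $(A,N,\mathrm e,\vartheta)=A^t\Gamma/\langle y-j(y):y\in\mathrm U(A)\rangle$, $A^t\Gamma$ the twisted group ring for $\vartheta$. Strong $Q$-normal Deuring embedding of $A\subseteq C$ w.r.t. $\sigma_Q$: with $\mathrm{Aut}^A(C)$ the automorphisms of $C$ preserving $A$, $N^{\mathrm U(C)}(A)$ the normalizer of $A$ in $\mathrm U(C)$, $\mathrm{Out}(C,A)=\mathrm{Aut}^A(C)/\{\text{conjugations by }\mathrm U(A)\}$, $\mathrm{Out}^A(C)=\mathrm{Aut}^A(C)/\{\text{conjugations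 by }N^{\mathrm U(C)}(A)\}\subseteq\mathrm{Out}(C)$, and restriction maps $\mathrm{res}\colon\mathrm{Out}(C,A)\to\mathrm{Out}(A)$, $\mathrm{Out}(C,A)\to\mathrm{Aut}^S(T)$: a homomorphism $\chi_G\colon G\to\mathrm{Out}(C,A)$ mapping $N$ into $N^{\mathrm U(C)}(A)/\mathrm U(A)$ so that the induced map $N\to\mathrm{Aut}(T)$ (conjugation restricted to $T$) is the inclusion, with $G\to\mathrm{Out}(C,A)\to\mathrm{Out}^A(C)\subseteq\mathrm{Out}(C)$ equal to $\sigma_Q\circ\pi_Q$ and with $G\to\mathrm{Out}(C,A)\to\mathrm{Aut}^S(T)$ equal to $\kappa_G$. *)

theory Defs
  imports "HOL-Algebra.Algebra"
begin

definition ring_center :: "('a,'b) ring_scheme \<Rightarrow> 'a set" where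
  "ring_center R = {z \<in> carrier R. \<forall>x \<in> carrier R. z \<otimes>\<^bsub>R\<^esub> x = x \<otimes>\<^bsub>R\<^esub> z}"

definition ring_aut :: "('a,'b) ring_scheme \<Rightarrow> ('a \<Rightarrow> 'a) set" where
  "ring_aut R = {\<phi>. \<phi> \<in> ring_hom R R \<and> bij_betw \<phi> (carrier R) (carrier R)
                    \<and> \<phi> \<in> extensional (carrier R)}"

definition aut_group :: "('a,'b) ring_scheme \<Rightarrow> ('a \<Rightarrow> 'a) monoid" where
  "aut_group R = \<lparr>carrier = ring_aut R,
                   monoid.mult = (\<lambda>\<phi> \<psi>. compose (carrier R) \<phi> \<psi>),
                   one = restrict id (carrier R)\<rparr>"

definition conj_by :: "('a,'b) ring_scheme \<Rightarrow> 'a \<Rightarrow> ('a \<Rightarrow> 'a)" where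
  "conj_by R u = restrict (\<lambda>x. u \<otimes>\<^bsub>R\<^esub> x \<otimes>\<^bsub>R\<^esub> inv\<^bsub>R\<^esub> u) (carrier R)"

definition out_group :: "('a,'b) ring_scheme \<Rightarrow> ('a \<Rightarrow> 'a) set monoid" where
  "out_group R = aut_group R Mod (conj_by R ` Units R)"

definition rel_aut :: "('a,'b) ring_scheme \<Rightarrow> 'a set \<Rightarrow> ('a \<Rightarrow> 'a) set" where
  "rel_aut R B = {\<gamma> \<in> ring_aut R. \<gamma> ` B = B}"

definition out_rel_group :: "('a,'b) ring_scheme \<Rightarrow> 'a set \<Rightarrow> 'a set \<Rightarrow> ('a \<Rightarrow> 'a) set monoid" where
  "out_rel_group R B U = ((aut_group R)\<lparr>carrier := rel_aut R B\<rparr>) Mod (conj_by R ` U)"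

definition unit_normalizer :: "('a,'b) ring_scheme \<Rightarrow> 'a set \<Rightarrow> 'a set" where
  "unit_normalizer R B = {v \<in> Units R. conj_by R v ` B = B}"

definition galois_group :: "('a,'b) ring_scheme \<Rightarrow> 'a set \<Rightarrow> ('a \<Rightarrow> 'a) set" where
  "galois_group T S = {\<phi> \<in> ring_aut T. \<forall>s \<in> S. \<phi> s = s}"

text \<open>Galois extension of commutative rings with group \<open>N\<close>
  (Chase-Harrison-Rosenberg): \<open>N\<close> finite, \<open>T^N = S\<close>, and there are
  \<open>x_i, y_i\<close> with \<open>\<Sum> x_i \<sigma>(y_i) = \<delta>_{\<sigma>,1}\<close> for \<open>\<sigma> \<in> N\<close>.\<close>
definition galois_ext :: "('a,'b) ring_scheme \<Rightarrow> 'a set \<Rightarrow> ('a \<Rightarrow> 'a) set \<Rightarrow> bool" where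
  "galois_ext T S N \<longleftrightarrow> finite N \<and> S = {t \<in> carrier T. \<forall>\<sigma> \<in> N. \<sigma> t = t} \<and>
     (\<exists>(n::nat) x y. (\<forall>i<n. x i \<in> carrier T \<and> y i \<in> carrier T) \<and>
        (\<forall>\<sigma> \<in> N. (\<Oplus>\<^bsub>T\<^esub> i \<in> {..<n}. x i \<otimes>\<^bsub>T\<^esub> \<sigma> (y i))
                   = (if \<sigma> = restrict id (carrier T) then \<one>\<^bsub>T\<^esub> else \<zero>\<^bsub>T\<^esub>)))"

text \<open>\<open>G = Aut^S(T) \<times>_{Aut(S)} Q\<close>; \<open>\<pi>_Q = snd\<close>, \<open>\<kappa>_G = fst\<close>.\<close>
definition struct_group ::
  "('a,'b) ring_scheme \<Rightarrow> 'a set \<Rightarrow> ('q,'c) monoid_scheme \<Rightarrow> ('q \<Rightarrow> 'a \<Rightarrow> 'a)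
     \<Rightarrow> (('a \<Rightarrow> 'a) \<times> 'q) monoid" where
  "struct_group T S Q \<kappa> =
     \<lparr>carrier = {(\<phi>, q). \<phi> \<in> ring_aut T \<and> \<phi> ` S = S \<and> q \<in> carrier Q \<and> (\<forall>s \<in> S. \<phi> s = \<kappa> q s)},
      monoid.mult = (\<lambda>(\<phi>, q) (\<psi>, r). (compose (carrier T) \<phi> \<psi>, q \<otimes>\<^bsub>Q\<^esub> r)),
      one = (restrict id (carrier T), \<one>\<^bsub>Q\<^esub>)\<rparr>"

definition triples :: "('g,'c) monoid_scheme \<Rightarrow> ('g \<times> 'g \<times> 'g) set" where
  "triples G = carrier G \<times> carrier G \<times> carrier G"

definition coboundary2 ::
  "('a,'b) ring_scheme \<Rightarrow> ('g,'c) monoid_scheme \<Rightarrow> ('g \<Rightarrow> 'a \<Rightarrow> 'a) \<Rightarrow> ('g \<times> 'g \<Rightarrow> 'a)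
     \<Rightarrow> ('g \<times> 'g \<times> 'g \<Rightarrow> 'a)" where
  "coboundary2 R G act h = restrict (\<lambda>(a, b, c).
      act a (h (b, c)) \<otimes>\<^bsub>R\<^esub> inv\<^bsub>R\<^esub> (h (a \<otimes>\<^bsub>G\<^esub> b, c)) \<otimes>\<^bsub>R\<^esub> h (a, b \<otimes>\<^bsub>G\<^esub> c)
        \<otimes>\<^bsub>R\<^esub> inv\<^bsub>R\<^esub> (h (a, b))) (triples G)"

definition cocycle3 ::
  "('a,'b) ring_scheme \<Rightarrow> ('g,'c) monoid_scheme \<Rightarrow> 'a set \<Rightarrow> ('g \<Rightarrow> 'a \<Rightarrow> 'a)
     \<Rightarrow> ('g \<times> 'g \<times> 'g \<Rightarrow> 'a) \<Rightarrow> bool" where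
  "cocycle3 R G M act f \<longleftrightarrow> f \<in> triples G \<rightarrow>\<^sub>E M \<and>
     (\<forall>a \<in> carrier G. \<forall>b \<in> carrier G. \<forall>c \<in> carrier G. \<forall>d \<in> carrier G.
        act a (f (b, c, d)) \<otimes>\<^bsub>R\<^esub> f (a, b \<otimes>\<^bsub>G\<^esub> c, d) \<otimes>\<^bsub>R\<^esub> f (a, b, c)
          = f (a \<otimes>\<^bsub>G\<^esub> b, c, d) \<otimes>\<^bsub>R\<^esub> f (a, b, c \<otimes>\<^bsub>G\<^esub> d))"

definition cohom_class3 ::
  "('a,'b) ring_scheme \<Rightarrow> ('g,'c) monoid_scheme \<Rightarrow> 'a set \<Rightarrow> ('g \<Rightarrow> 'a \<Rightarrow> 'a)
     \<Rightarrow> ('g \<times> 'g \<times> 'g \<Rightarrow> 'a) \<Rightarrow> ('g \<times> 'g \<times> 'g \<Rightarrow> 'a) set" where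
  "cohom_class3 R G M act f =
     {restrict (\<lambda>x. f x \<otimes>\<^bsub>R\<^esub> coboundary2 R G act h x) (triples G) | h.
        h \<in> (carrier G \<times> carrier G) \<rightarrow>\<^sub>E M}"

definition H3 ::
  "('a,'b) ring_scheme \<Rightarrow> ('g,'c) monoid_scheme \<Rightarrow> 'a set \<Rightarrow> ('g \<Rightarrow> 'a \<Rightarrow> 'a)
     \<Rightarrow> ('g \<times> 'g \<times> 'g \<Rightarrow> 'a) set set" where
  "H3 R G M act = cohom_class3 R G M act ` {f. cocycle3 R G M act f}"

definition inflation3 ::
  "('a,'b) ring_scheme \<Rightarrow> ('g,'c) monoid_scheme \<Rightarrow> 'a set \<Rightarrow> ('g \<Rightarrow> 'a \<Rightarrow> 'a)
     \<Rightarrow> ('g \<Rightarrow> 'q) \<Rightarrow> ('q \<times> 'q \<times> 'q \<Rightarrow> 'a) set \<Rightarrow> ('g \<times> 'g \<times> 'g \<Rightarrow> 'a) set" where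
  "inflation3 R G M act \<pi> k =
     (\<Union>f \<in> k. cohom_class3 R G M act (restrict (\<lambda>(a, b, c). f (\<pi> a, \<pi> b, \<pi> c)) (triples G)))"

text \<open>For a normal structure \<open>\<sigma> : G \<rightarrow> Out(R)\<close> (values are cosets of \<open>Inn(R)\<close>),
  the class of the crossed 2-fold extension
  \<open>0 \<rightarrow> U(Z) \<rightarrow> U(R) \<rightarrow> Aut(R) \<times>_{Out(R)} G \<rightarrow> G \<rightarrow> 1\<close>
  under the standard identification with \<open>H^3\<close>: pick a set-theoretic section
  \<open>g \<mapsto> \<alpha>_g \<in> \<sigma>(g)\<close>, units \<open>u(a,b)\<close> with \<open>\<alpha>_a \<alpha>_b = \<partial>(u(a,b)) \<alpha>_{ab}\<close>, and the
  3-cocycle \<open>f\<close> defined by \<open>\<alpha>_a(u(b,c)) u(a,bc) = f(a,b,c) u(a,b) u(ab,c)\<close>.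
  The set of all cocycles so obtained (over all choices) is the class.\<close>
definition teich_class ::
  "('a,'b) ring_scheme \<Rightarrow> ('g,'c) monoid_scheme \<Rightarrow> ('g \<Rightarrow> ('a \<Rightarrow> 'a) set)
     \<Rightarrow> ('g \<times> 'g \<times> 'g \<Rightarrow> 'a) set" where
  "teich_class R G \<sigma> = {f. f \<in> triples G \<rightarrow>\<^sub>E carrier R \<and>
     (\<exists>\<alpha> u. (\<forall>g \<in> carrier G. \<alpha> g \<in> \<sigma> g) \<and>
        (\<forall>a \<in> carrier G. \<forall>b \<in> carrier G. u (a, b) \<in> Units R \<and>
            (\<forall>x \<in> carrier R. \<alpha> a (\<alpha> b x) = u (a, b) \<otimes>\<^bsub>R\<^esub> \<alpha> (a \<otimes>\<^bsub>G\<^esub> b) x \<otimes>\<^bsub>R\<^esub> inv\<^bsub>R\<^esub> (u (a, b)))) \<and>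
        (\<forall>a \<in> carrier G. \<forall>b \<in> carrier G. \<forall>c \<in> carrier G.
            \<alpha> a (u (b, c)) \<otimes>\<^bsub>R\<^esub> u (a, b \<otimes>\<^bsub>G\<^esub> c)
              = f (a, b, c) \<otimes>\<^bsub>R\<^esub> u (a, b) \<otimes>\<^bsub>R\<^esub> u (a \<otimes>\<^bsub>G\<^esub> b, c)))}"

text \<open>Twisted group ring \<open>A^t\<Gamma>\<close>: finitely supported \<open>\<Gamma> \<rightarrow> A\<close>, with
  \<open>(a x)(b y) = a \<theta>(x)(b) xy\<close>.\<close>
definition tgr :: "('a,'b) ring_scheme \<Rightarrow> ('x,'c) monoid_scheme \<Rightarrow> ('x \<Rightarrow> 'a \<Rightarrow> 'a) \<Rightarrow> ('x \<Rightarrow> 'a) ring" where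
  "tgr A \<Gamma> \<theta> =
     \<lparr>carrier = {f. (\<forall>x. x \<notin> carrier \<Gamma> \<longrightarrow> f x = \<zero>\<^bsub>A\<^esub>) \<and> (\<forall>x \<in> carrier \<Gamma>. f x \<in> carrier A)
                    \<and> finite {x. f x \<noteq> \<zero>\<^bsub>A\<^esub>}},
      monoid.mult = (\<lambda>f g z. if z \<in> carrier \<Gamma>
                      then (\<Oplus>\<^bsub>A\<^esub> x \<in> {x \<in> carrier \<Gamma>. f x \<noteq> \<zero>\<^bsub>A\<^esub>}.
                               f x \<otimes>\<^bsub>A\<^esub> \<theta> x (g (inv\<^bsub>\<Gamma>\<^esub> x \<otimes>\<^bsub>\<Gamma>\<^esub> z)))
                      else \<zero>\<^bsub>A\<^esub>),
      one = (\<lambda>z. if z = \<one>\<^bsub>\<Gamma>\<^esub> then \<one>\<^bsub>A\<^esub> else \<zero>\<^bsub>A\<^esub>),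
      ring.zero = (\<lambda>z. \<zero>\<^bsub>A\<^esub>),
      add = (\<lambda>f g z. f z \<oplus>\<^bsub>A\<^esub> g z)\<rparr>"

definition tsingle :: "('a,'b) ring_scheme \<Rightarrow> 'x \<Rightarrow> 'a \<Rightarrow> ('x \<Rightarrow> 'a)" where
  "tsingle A x a = (\<lambda>z. if z = x then a else \<zero>\<^bsub>A\<^esub>)"

definition cp_ideal ::
  "('a,'b) ring_scheme \<Rightarrow> ('x,'c) monoid_scheme \<Rightarrow> ('x \<Rightarrow> 'a \<Rightarrow> 'a) \<Rightarrow> ('a \<Rightarrow> 'x) \<Rightarrow> ('x \<Rightarrow> 'a) set" where
  "cp_ideal A \<Gamma> \<theta> j = genideal (tgr A \<Gamma> \<theta>)
      {tsingle A \<one>\<^bsub>\<Gamma>\<^esub> y \<ominus>\<^bsub>tgr A \<Gamma> \<theta>\<^esub> tsingle A (j y) \<one>\<^bsub>A\<^esub> | y. y \<in> Units A}"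

definition crossed_product ::
  "('a,'b) ring_scheme \<Rightarrow> ('x,'c) monoid_scheme \<Rightarrow> ('x \<Rightarrow> 'a \<Rightarrow> 'a) \<Rightarrow> ('a \<Rightarrow> 'x) \<Rightarrow> ('x \<Rightarrow> 'a) set ring" where
  "crossed_product A \<Gamma> \<theta> j = tgr A \<Gamma> \<theta> Quot cp_ideal A \<Gamma> \<theta> j"

definition cp_emb ::
  "('a,'b) ring_scheme \<Rightarrow> ('x,'c) monoid_scheme \<Rightarrow> ('x \<Rightarrow> 'a \<Rightarrow> 'a) \<Rightarrow> ('a \<Rightarrow> 'x) \<Rightarrow> 'a \<Rightarrow> ('x \<Rightarrow> 'a) set" where
  "cp_emb A \<Gamma> \<theta> j a = cp_ideal A \<Gamma> \<theta> j +>\<^bsub>tgr A \<Gamma> \<theta>\<^esub> tsingle A \<one>\<^bsub>\<Gamma>\<^esub> a"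

end

theory Submission
  imports Defs
begin

text \<open>
  Choose a normalized cocycle \<open>f\<close> in \<open>k\<close>. By hypothesis its inflation is the obstruction of a system of lifts
  \<open>\<alpha>_g\<close> of \<open>\<sigma>G\<close> and units \<open>u(a,b)\<close> of \<open>A\<close>. The product
  \<open>(x,a)(y,b) = (x \<alpha>_a(y) u(a,b), ab)\<close> on \<open>U(A) \<times> G\<close> then has associator \<open>f(\<pi>a, \<pi>b, \<pi>c)\<close>, so
  the elements over \<open>N\<close> form a group \<open>\<Gamma>\<close> lying in the nucleus; this is the required extension of \<open>N\<close> by
  \<open>U(A)\<close>. Conjugation by an element \<open>E\<close> of the quasigroup is an automorphism of \<open>\<Gamma>\<close> compatible with the
  action on \<open>A\<close>, hence induces an automorphism \<open>\<beta>_E\<close> of the crossed product \<open>C\<close>. Nuclearity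
  gives \<open>\<beta>_E \<beta>_F = \<beta>_(EF)\<close>, and \<open>\<beta>_\<gamma>\<close> is inner for \<open>\<gamma>\<close> in \<open>\<Gamma>\<close>. So \<open>\<beta>\<close> descends to
  \<open>\<sigma>Q : Q \<rightarrow> Out(C)\<close> and \<open>\<chi>G : G \<rightarrow> Out(C,A)\<close>, and the obstruction of \<open>\<sigma>Q\<close>
  is the associator of the quasigroup, which is \<open>f\<close>.
\<close>

section \<open>Automorphism groups of rings\<close>

text \<open>Two points carry the construction. The Teichmueller class is the set of all cocycles
  arising from all choices, so the hypothesis on inflation lets lifts and units be chosen with
  obstruction equal to the inflated cocycle itself, without a coboundary to carry along. And the
  inflated cocycle depends only on images in \<open>Q\<close>: with \<open>f\<close> normalized it
  is 1 as soon as one argument comes from \<open>N\<close>, which is why the failure of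
  associativity does not touch the elements over \<open>N\<close>. The quasigroup is in general no
  group and gives no extension of \<open>G\<close> by U(A) that could act on \<open>C\<close>. What
  acts is conjugation on the nucleus, and every rebracketing that this requires has a factor in
  \<Gamma>. The associator lies in U(S), so it is a central unit of \<open>C\<close>: invisible in
  Aut(C), it survives as the obstruction. The Galois condition enters in the computation of the
  center of \<open>C\<close>, for which coefficients are needed in a ring given only as a quotient
  by a generated ideal. Lifts and units are not normalized over the neutral element of
  \<open>G\<close>; this is the origin of the factors inverse to u(1,1).\<close>

lemma ring_autD:
  assumes "\<phi> \<in> ring_aut R"
  shows "\<phi> \<in> ring_hom R R" "bij_betw \<phi> (carrier R) (carrier R)" "\<phi> \<in> extensional (carrier R)"
    "\<And>x. x \<in> carrier R \<Longrightarrow> \<phi> x \<in> carrier R"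
    "\<And>x y. x \<in> carrier R \<Longrightarrow> y \<in> carrier R \<Longrightarrow> \<phi> (x \<otimes>\<^bsub>R\<^esub> y) = \<phi> x \<otimes>\<^bsub>R\<^esub> \<phi> y"
    "\<And>x y. x \<in> carrier R \<Longrightarrow> y \<in> carrier R \<Longrightarrow> \<phi> (x \<oplus>\<^bsub>R\<^esub> y) = \<phi> x \<oplus>\<^bsub>R\<^esub> \<phi> y"
    "\<phi> \<one>\<^bsub>R\<^esub> = \<one>\<^bsub>R\<^esub>"
  using assms by (auto simp: ring_aut_def ring_hom_def)

lemma ring_aut_inj:
  assumes "\<phi> \<in> ring_aut R" "x \<in> carrier R" "y \<in> carrier R" "\<phi> x = \<phi> y"
  shows "x = y"
  using ring_autD(2)[OF assms(1)] assms(2-4) by (auto simp: bij_betw_def inj_on_def)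

lemma ring_aut_surj:
  assumes "\<phi> \<in> ring_aut R" "y \<in> carrier R"
  obtains x where "x \<in> carrier R" "\<phi> x = y"
  using ring_autD(2)[OF assms(1)] assms(2) that unfolding bij_betw_def by (metis imageE)

lemma ring_aut_eqI:
  assumes "\<phi> \<in> ring_aut R" "\<psi> \<in> ring_aut R" "\<And>x. x \<in> carrier R \<Longrightarrow> \<phi> x = \<psi> x"
  shows "\<phi> = \<psi>"
  using assms by (intro extensionalityI[of _ "carrier R"]) (auto simp: ring_autD)

text \<open>The inverse \<open>\<psi>\<close> need only be a map of sets; compatibility with the
  operations is asked of \<open>\<phi>\<close> alone.\<close>

lemma ring_autI:
  assumes "\<phi> \<in> extensional (carrier R)"
    "\<And>x. x \<in> carrier R \<Longrightarrow> \<phi> x \<in> carrier R"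
    "\<And>x y. x \<in> carrier R \<Longrightarrow> y \<in> carrier R \<Longrightarrow> \<phi> (x \<otimes>\<^bsub>R\<^esub> y) = \<phi> x \<otimes>\<^bsub>R\<^esub> \<phi> y"
    "\<And>x y. x \<in> carrier R \<Longrightarrow> y \<in> carrier R \<Longrightarrow> \<phi> (x \<oplus>\<^bsub>R\<^esub> y) = \<phi> x \<oplus>\<^bsub>R\<^esub> \<phi> y"
    "\<phi> \<one>\<^bsub>R\<^esub> = \<one>\<^bsub>R\<^esub>"
    "\<And>x. x \<in> carrier R \<Longrightarrow> \<psi> x \<in> carrier R"
    "\<And>x. x \<in> carrier R \<Longrightarrow> \<psi> (\<phi> x) = x" "\<And>x. x \<in> carrier R \<Longrightarrow> \<phi> (\<psi> x) = x"
  shows "\<phi> \<in> ring_aut R"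
  unfolding ring_aut_def
  by (auto intro!: ring_hom_memI assms bij_betwI[where g = \<psi>])

lemma compose_ring_aut:
  assumes "\<phi> \<in> ring_aut R" "\<psi> \<in> ring_aut R" "ring R"
  shows "compose (carrier R) \<phi> \<psi> \<in> ring_aut R"
proof -
  interpret ring R by fact
  show ?thesis
    unfolding ring_aut_def using assms(1,2)
    by (auto intro!: ring_hom_memI bij_betw_compose[of _ _ "carrier R"]
        simp: compose_eq ring_autD)
qed

lemma aut_group_group:
  assumes "ring R"
  shows "group (aut_group R)"
proof -
  interpret ring R by fact
  have ext: "\<phi> \<in> carrier R \<rightarrow> carrier R" if "\<phi> \<in> ring_aut R" for \<phi>
    using ring_autD(4)[OF that] by auto
  show ?thesis
  proof (rule groupI)
    show "\<one>\<^bsub>aut_group R\<^esub> \<in> carrier (aut_group R)"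
      by (auto simp: aut_group_def intro!: ring_autI[where \<psi> = id])
    fix x assume x: "x \<in> carrier (aut_group R)"
    show "\<one>\<^bsub>aut_group R\<^esub> \<otimes>\<^bsub>aut_group R\<^esub> x = x"
      using x by (auto simp: aut_group_def compose_def fun_eq_iff restrict_def ring_autD
          extensional_arb[OF ring_autD(3)])
    have x': "x \<in> ring_aut R" using x by (simp add: aut_group_def)
    \<comment> \<open>The inverse function is cut down to the carrier because members of
      \<open>ring_aut\<close> are extensional.\<close>
    define y where "y = restrict (inv_into (carrier R) x) (carrier R)"
    have yc: "y a \<in> carrier R" if "a \<in> carrier R" for a
      using bij_betw_inv_into[OF ring_autD(2)[OF x']] that by (auto simp: y_def bij_betw_def)
    have xy: "x (y a) = a" if "a \<in> carrier R" for a
      using that bij_betw_inv_into_right[OF ring_autD(2)[OF x']] by (simp add: y_def)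
    have yx: "y (x a) = a" if "a \<in> carrier R" for a
      using that bij_betw_inv_into_left[OF ring_autD(2)[OF x']] ring_autD(4)[OF x'] by (simp add: y_def)
    have y: "y \<in> ring_aut R"
    proof (rule ring_autI[where \<psi> = x])
      show "y \<in> extensional (carrier R)" by (simp add: y_def)
      fix a b assume ab: "a \<in> carrier R" "b \<in> carrier R"
      show "y (a \<otimes>\<^bsub>R\<^esub> b) = y a \<otimes>\<^bsub>R\<^esub> y b"
        by (rule ring_aut_inj[OF x']) (use ab in \<open>simp_all add: yc xy ring_autD[OF x']\<close>)
      show "y (a \<oplus>\<^bsub>R\<^esub> b) = y a \<oplus>\<^bsub>R\<^esub> y b"
        by (rule ring_aut_inj[OF x']) (use ab in \<open>simp_all add: yc xy ring_autD[OF x']\<close>)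
    next
      show "y \<one>\<^bsub>R\<^esub> = \<one>\<^bsub>R\<^esub>" using yx[of "\<one>\<^bsub>R\<^esub>"] ring_autD(7)[OF x'] by simp
    qed (simp_all add: yc xy yx ring_autD[OF x'])
    show "\<exists>y\<in>carrier (aut_group R). y \<otimes>\<^bsub>aut_group R\<^esub> x = \<one>\<^bsub>aut_group R\<^esub>"
      by (rule bexI[of _ y]) (use y yx in \<open>auto simp: aut_group_def compose_def restrict_def\<close>)
  qed (auto simp: aut_group_def compose_ring_aut assms intro!: compose_assoc[symmetric] ext)
qed

lemma ring_aut_inverse:
  assumes "ring R" "\<alpha> \<in> ring_aut R"
  obtains \<alpha>' where "\<alpha>' \<in> ring_aut R" "\<And>a. a \<in> carrier R \<Longrightarrow> \<alpha>' (\<alpha> a) = a"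
    "\<And>a. a \<in> carrier R \<Longrightarrow> \<alpha> (\<alpha>' a) = a"
proof -
  interpret Aut: group "aut_group R" by (rule aut_group_group) fact
  have a: "\<alpha> \<in> carrier (aut_group R)" using assms by (simp add: aut_group_def)
  let ?b = "inv\<^bsub>aut_group R\<^esub> \<alpha>"
  have b: "?b \<in> ring_aut R" using Aut.inv_closed[OF a] by (simp add: aut_group_def)
  have l: "compose (carrier R) ?b \<alpha> = restrict id (carrier R)"
    and r: "compose (carrier R) \<alpha> ?b = restrict id (carrier R)"
    using Aut.l_inv[OF a] Aut.r_inv[OF a] by (simp_all add: aut_group_def)
  show ?thesis
  proof (rule that[OF b])
    fix x assume x: "x \<in> carrier R"
    show "?b (\<alpha> x) = x" using fun_cong[OF l, of x] x by (simp add: compose_eq)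
    show "\<alpha> (?b x) = x" using fun_cong[OF r, of x] x by (simp add: compose_eq)
  qed
qed

lemma ring_hom_unit:
  assumes "ring R" "ring R'" and h: "h \<in> ring_hom R R'" and u: "u \<in> Units R"
  shows "h u \<in> Units R'" "inv\<^bsub>R'\<^esub> (h u) = h (inv\<^bsub>R\<^esub> u)"
proof -
  interpret R: ring R by fact
  interpret R': ring R' by fact
  have c: "u \<in> carrier R" "inv\<^bsub>R\<^esub> u \<in> carrier R" using u by auto
  have 1: "h u \<otimes>\<^bsub>R'\<^esub> h (inv\<^bsub>R\<^esub> u) = \<one>\<^bsub>R'\<^esub>" "h (inv\<^bsub>R\<^esub> u) \<otimes>\<^bsub>R'\<^esub> h u = \<one>\<^bsub>R'\<^esub>"
    unfolding ring_hom_mult[OF h c, symmetric] ring_hom_mult[OF h c(2,1), symmetric]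
    using u ring_hom_one[OF h] by simp_all
  have c': "h u \<in> carrier R'" "h (inv\<^bsub>R\<^esub> u) \<in> carrier R'" using c ring_hom_closed[OF h] by auto
  show "h u \<in> Units R'"
    using 1 c' unfolding Units_def by blast
  show "inv\<^bsub>R'\<^esub> (h u) = h (inv\<^bsub>R\<^esub> u)"
    using R'.inv_unique'[OF c' 1] by simp
qed

lemma ring_aut_unit:
  assumes "ring R" "\<phi> \<in> ring_aut R" "u \<in> Units R"
  shows "\<phi> u \<in> Units R" "inv\<^bsub>R\<^esub> (\<phi> u) = \<phi> (inv\<^bsub>R\<^esub> u)"
  using ring_hom_unit[OF assms(1,1) ring_autD(1)[OF assms(2)] assms(3)] by simp_all

section \<open>Inner automorphisms and the quotients by them\<close>

lemma (in ring) conj_by_app: "x \<in> carrier R \<Longrightarrow> conj_by R u x = u \<otimes> x \<otimes> inv u"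
  by (simp add: conj_by_def)

lemma (in ring) conj_by_aut:
  assumes u: "u \<in> Units R"
  shows "conj_by R u \<in> ring_aut R"
proof (rule ring_autI[where \<psi> = "\<lambda>x. inv u \<otimes> x \<otimes> u"])
  have [simp]: "u \<in> carrier R" "inv u \<in> carrier R" using u by auto
  have c1: "inv u \<otimes> (u \<otimes> x) = x" "u \<otimes> (inv u \<otimes> x) = x" if "x \<in> carrier R" for x
    using that u by (simp_all flip: m_assoc)
  fix x y assume xy: "x \<in> carrier R" "y \<in> carrier R"
  show "conj_by R u (x \<otimes> y) = conj_by R u x \<otimes> conj_by R u y"
    using xy u by (simp add: conj_by_app m_assoc c1)
  show "conj_by R u (x \<oplus> y) = conj_by R u x \<oplus> conj_by R u y"
    using xy by (simp add: conj_by_app l_distr r_distr)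
  show "inv u \<otimes> conj_by R u x \<otimes> u = x" "conj_by R u (inv u \<otimes> x \<otimes> u) = x"
    using xy u by (simp_all add: conj_by_app m_assoc c1)
qed (use u in \<open>auto simp: conj_by_app conj_by_def Units_closed\<close>)

lemma (in monoid) inv_mult_units:
  assumes "u \<in> Units G" "v \<in> Units G"
  shows "inv (u \<otimes> v) = inv v \<otimes> inv u"
proof (rule inv_unique'[symmetric])
  have [simp]: "u \<in> carrier G" "v \<in> carrier G" using assms by auto
  have "u \<otimes> v \<otimes> (inv v \<otimes> inv u) = u \<otimes> (v \<otimes> inv v) \<otimes> inv u" using assms by (simp add: m_assoc del: Units_r_inv)
  then show "u \<otimes> v \<otimes> (inv v \<otimes> inv u) = \<one>" using assms by simp
  have "inv v \<otimes> inv u \<otimes> (u \<otimes> v) = inv v \<otimes> (inv u \<otimes> u) \<otimes> v" using assms by (simp add: m_assoc del: Units_l_inv)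
  then show "inv v \<otimes> inv u \<otimes> (u \<otimes> v) = \<one>" using assms by simp
qed (use assms in auto)

lemma (in ring) conj_by_mult:
  assumes "u \<in> Units R" "v \<in> Units R"
  shows "conj_by R (u \<otimes> v) = compose (carrier R) (conj_by R u) (conj_by R v)"
  using assms by (auto simp: conj_by_def compose_def fun_eq_iff inv_mult_units m_assoc Units_closed)

lemma (in ring) conj_by_one: "conj_by R \<one> = restrict id (carrier R)"
  by (auto simp: conj_by_def fun_eq_iff)

text \<open>The relation \<phi> \<partial>(u) = \<partial>(\<phi>(u)) \<phi> between automorphisms
  and conjugations, the source of the normality statements below.\<close>

lemma (in ring) aut_conj_by:
  assumes "\<phi> \<in> ring_aut R" "u \<in> Units R"
  shows "compose (carrier R) \<phi> (conj_by R u) = compose (carrier R) (conj_by R (\<phi> u)) \<phi>"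
  using assms ring_aut_unit[OF ring_axioms assms]
  by (auto simp: conj_by_def compose_def fun_eq_iff ring_autD Units_closed)

text \<open>Conjugating the inner automorphism of \<open>u\<close> by \<phi> gives that of
  \<open>\<phi> u\<close>, so stability of \<open>U\<close> under \<open>K\<close> is enough. The
  form with \<open>K\<close> and \<open>U\<close> serves twice: all automorphisms with all units
  give Out, and the automorphisms of \<open>C\<close> preserving \<open>A\<close> with conjugations
  by U(A) give Out(C,A).\<close>

lemma (in ring) conj_by_normal:
  assumes K: "subgroup K (aut_group R)" and U: "subgroup U (units_of R)"
    and UK: "conj_by R ` U \<subseteq> K" and stable: "\<And>\<phi> u. \<phi> \<in> K \<Longrightarrow> u \<in> U \<Longrightarrow> \<phi> u \<in> U"
  shows "normal (conj_by R ` U) ((aut_group R)\<lparr>carrier := K\<rparr>)"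
proof -
  interpret Aut: group "aut_group R" by (rule aut_group_group) (rule ring_axioms)
  interpret K: group "(aut_group R)\<lparr>carrier := K\<rparr>" by (rule Aut.subgroup_imp_group[OF K])
  have Uu: "u \<in> Units R" if "u \<in> U" for u
    using subgroup.subset[OF U] that by (auto simp: units_of_def)
  have aut: "\<phi> \<in> ring_aut R" if "\<phi> \<in> K" for \<phi>
    using subgroup.subset[OF K] that by (auto simp: aut_group_def)
  have mult: "conj_by R u \<otimes>\<^bsub>aut_group R\<^esub> conj_by R v = conj_by R (u \<otimes> v)" if "u \<in> U" "v \<in> U" for u v
    using conj_by_mult[OF Uu Uu] that by (simp add: aut_group_def)
  have Um: "u \<otimes> v \<in> U" if "u \<in> U" "v \<in> U" for u v
    using subgroup.m_closed[OF U that] by (simp add: units_of_def)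
  have U1: "\<one> \<in> U" using subgroup.one_closed[OF U] by (simp add: units_of_def)
  have Ui: "inv u \<in> U" if "u \<in> U" for u
    using subgroup.m_inv_closed[OF U that] Uu[OF that] by (simp add: units_of_inv)
  have one: "conj_by R \<one> = \<one>\<^bsub>aut_group R\<^esub>" by (simp add: conj_by_one aut_group_def)
  have sub: "subgroup (conj_by R ` U) ((aut_group R)\<lparr>carrier := K\<rparr>)"
  proof (rule K.subgroupI)
    fix a assume "a \<in> conj_by R ` U"
    then obtain u where u: "u \<in> U" "a = conj_by R u" by auto
    have "conj_by R (inv u) \<otimes>\<^bsub>aut_group R\<^esub> a = \<one>\<^bsub>aut_group R\<^esub>"
      using u Ui Uu mult[OF Ui[OF u(1)] u(1)] by (simp add: one)
    then have "inv\<^bsub>(aut_group R)\<lparr>carrier := K\<rparr>\<^esub> a = conj_by R (inv u)"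
      using u Ui UK by (intro K.inv_equality) auto
    then show "inv\<^bsub>(aut_group R)\<lparr>carrier := K\<rparr>\<^esub> a \<in> conj_by R ` U" using u Ui by auto
  qed (use UK U1 Um mult in auto)
  have "x \<otimes>\<^bsub>aut_group R\<^esub> h \<otimes>\<^bsub>aut_group R\<^esub> inv\<^bsub>(aut_group R)\<lparr>carrier := K\<rparr>\<^esub> x \<in> conj_by R ` U"
    if x: "x \<in> K" and h: "h \<in> conj_by R ` U" for x h
  proof -
    obtain u where u: "u \<in> U" "h = conj_by R u" using h by auto
    have e: "x \<otimes>\<^bsub>aut_group R\<^esub> h = conj_by R (x u) \<otimes>\<^bsub>aut_group R\<^esub> x"
      using aut_conj_by[OF aut[OF x] Uu[OF u(1)]] u by (simp add: aut_group_def)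
    have i: "inv\<^bsub>(aut_group R)\<lparr>carrier := K\<rparr>\<^esub> x \<in> K" using K.inv_closed x by simp
    have "x \<otimes>\<^bsub>aut_group R\<^esub> h \<otimes>\<^bsub>aut_group R\<^esub> inv\<^bsub>(aut_group R)\<lparr>carrier := K\<rparr>\<^esub> x = conj_by R (x u)"
      unfolding e using K.m_assoc[of "conj_by R (x u)" x "inv\<^bsub>(aut_group R)\<lparr>carrier := K\<rparr>\<^esub> x"]
        K.r_inv[of x] K.r_one[of "conj_by R (x u)"] x i stable[OF x u(1)] UK by (simp add: image_subset_iff)
    then show ?thesis using stable[OF x u(1)] by auto
  qed
  then show ?thesis using sub by (simp add: K.normal_inv_iff)
qed

lemma (in ring) inner_normal: "normal (conj_by R ` Units R) (aut_group R)"
proof -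
  interpret Aut: group "aut_group R" by (rule aut_group_group) (rule ring_axioms)
  have "normal (conj_by R ` Units R) ((aut_group R)\<lparr>carrier := carrier (aut_group R)\<rparr>)"
  proof (rule conj_by_normal)
    show "subgroup (Units R) (units_of R)"
      using group.subgroup_self[OF units_group] by (simp add: units_of_def)
  qed (use Aut.subgroup_self conj_by_aut ring_aut_unit[OF ring_axioms] in \<open>auto simp: aut_group_def\<close>)
  then show ?thesis by simp
qed

text \<open>Membership asks for an image equal to \<open>B\<close>, not merely contained in it, and
  this passes to inverses.\<close>

lemma (in ring) rel_aut_subgroup:
  assumes "B \<subseteq> carrier R"
  shows "subgroup (rel_aut R B) (aut_group R)"
proof -
  interpret Aut: group "aut_group R" by (rule aut_group_group) (rule ring_axioms)
  have im: "compose (carrier R) \<phi> \<psi> ` B = \<phi> ` \<psi> ` B" for \<phi> \<psi>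
    using assms by (force simp: compose_def)
  have idB: "restrict id (carrier R) ` B = B"
    using assms by force
  show ?thesis
  proof (rule Aut.subgroupI)
    show "rel_aut R B \<noteq> {}"
    proof -
      have "restrict id (carrier R) \<in> rel_aut R B"
        using Aut.one_closed idB unfolding rel_aut_def aut_group_def by simp
      then show ?thesis by blast
    qed
    fix a assume a: "a \<in> rel_aut R B"
    then have ac: "a \<in> carrier (aut_group R)" "a ` B = B" by (simp_all add: rel_aut_def aut_group_def)
    have "compose (carrier R) (inv\<^bsub>aut_group R\<^esub> a) a = restrict id (carrier R)"
      using Aut.l_inv[OF ac(1)] by (simp add: aut_group_def)
    then have "(inv\<^bsub>aut_group R\<^esub> a) ` B = B"
      using im[of "inv\<^bsub>aut_group R\<^esub> a" a] idB ac(2) by metis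
    then show "inv\<^bsub>aut_group R\<^esub> a \<in> rel_aut R B"
      using Aut.inv_closed[OF ac(1)] unfolding rel_aut_def by (simp add: aut_group_def)
    fix b assume b: "b \<in> rel_aut R B"
    have "compose (carrier R) a b ` B = B" using b ac(2) unfolding im by (simp add: rel_aut_def)
    then show "a \<otimes>\<^bsub>aut_group R\<^esub> b \<in> rel_aut R B"
      using a b unfolding rel_aut_def by (simp add: aut_group_def compose_ring_aut ring_axioms)
  qed (auto simp: rel_aut_def aut_group_def)
qed

text \<open>A change of representative of a right coset is a factor from \<open>H\<close> on the
  left. Independence of chosen lifts is always obtained in this form.\<close>

lemma rcoset_absorb:
  assumes n: "normal H K" and x: "x \<in> carrier K" and h: "h \<in> H"
  shows "H #>\<^bsub>K\<^esub> (h \<otimes>\<^bsub>K\<^esub> x) = H #>\<^bsub>K\<^esub> x"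
proof -
  interpret normal H K by fact
  have "h \<otimes>\<^bsub>K\<^esub> x \<in> H #>\<^bsub>K\<^esub> x" using h by (auto simp: r_coset_def)
  from repr_independence[OF this x subgroup_axioms] show ?thesis by simp
qed


section \<open>Twisted group rings\<close>

lemma (in ring) ring_aut_zero:
  assumes "\<phi> \<in> ring_aut R"
  shows "\<phi> \<zero> = \<zero>"
proof -
  have "\<phi> \<zero> \<oplus> \<phi> \<zero> = \<phi> \<zero>" using ring_autD(6)[OF assms, of \<zero> \<zero>] by simp
  then show ?thesis using ring_autD(4)[OF assms, of \<zero>] by (metis add.r_cancel_one' zero_closed)
qed

locale twisted = ring A + \<Gamma>: group \<Gamma>
  for A :: "('a,'b) ring_scheme" (structure) and \<Gamma> :: "('x,'c) monoid_scheme" +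
  fixes \<theta> :: "'x \<Rightarrow> 'a \<Rightarrow> 'a"
  assumes \<theta>_hom: "\<theta> \<in> hom \<Gamma> (aut_group A)"
begin

abbreviation W where "W \<equiv> tgr A \<Gamma> \<theta>"

lemma \<theta>_aut: "x \<in> carrier \<Gamma> \<Longrightarrow> \<theta> x \<in> ring_aut A"
  using \<theta>_hom by (auto simp: hom_def aut_group_def)

lemmas \<theta>_simps = ring_autD(4-7)[OF \<theta>_aut] ring_aut_zero[OF \<theta>_aut]

lemma \<theta>_comp:
  "x \<in> carrier \<Gamma> \<Longrightarrow> y \<in> carrier \<Gamma> \<Longrightarrow> a \<in> carrier A \<Longrightarrow> \<theta> (x \<otimes>\<^bsub>\<Gamma>\<^esub> y) a = \<theta> x (\<theta> y a)"
  using \<theta>_hom by (simp add: hom_def aut_group_def compose_eq)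

text \<open>Membership in \<open>hom\<close> gives multiplicativity only; the value at the neutral
  element is idempotent, and injectivity turns it into the identity.\<close>

lemma \<theta>_id:
  assumes "a \<in> carrier A"
  shows "\<theta> \<one>\<^bsub>\<Gamma>\<^esub> a = a"
proof (rule ring_aut_inj[OF \<theta>_aut[OF \<Gamma>.one_closed]])
  show "\<theta> \<one>\<^bsub>\<Gamma>\<^esub> (\<theta> \<one>\<^bsub>\<Gamma>\<^esub> a) = \<theta> \<one>\<^bsub>\<Gamma>\<^esub> a"
    using \<theta>_comp[OF \<Gamma>.one_closed \<Gamma>.one_closed assms] by (metis \<Gamma>.l_one \<Gamma>.one_closed)
qed (simp_all add: assms \<theta>_simps)

section \<open>Finitely supported functions: additive structure, product and induction\<close>

lemma W_carrierI:
  "(\<And>x. x \<notin> carrier \<Gamma> \<Longrightarrow> f x = \<zero>) \<Longrightarrow> (\<And>x. x \<in> carrier \<Gamma> \<Longrightarrow> f x \<in> carrier A)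
    \<Longrightarrow> finite {x. f x \<noteq> \<zero>} \<Longrightarrow> f \<in> carrier W"
  by (simp add: tgr_def)

lemma W_closed: "f \<in> carrier W \<Longrightarrow> f x \<in> carrier A"
  by (cases "x \<in> carrier \<Gamma>") (auto simp: tgr_def)

lemma W_outside: "f \<in> carrier W \<Longrightarrow> x \<notin> carrier \<Gamma> \<Longrightarrow> f x = \<zero>"
  by (auto simp: tgr_def)

lemma W_finite: "f \<in> carrier W \<Longrightarrow> finite {x. f x \<noteq> \<zero>}"
  by (auto simp: tgr_def)

lemma W_add: "(f \<oplus>\<^bsub>W\<^esub> g) z = f z \<oplus> g z"
  by (simp add: tgr_def)

lemma W_zero: "\<zero>\<^bsub>W\<^esub> = (\<lambda>z. \<zero>)"
  by (simp add: tgr_def)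

lemma W_one: "\<one>\<^bsub>W\<^esub> = tsingle A \<one>\<^bsub>\<Gamma>\<^esub> \<one>"
  by (simp add: tgr_def tsingle_def)

lemma W_add_closed:
  assumes "f \<in> carrier W" "g \<in> carrier W"
  shows "f \<oplus>\<^bsub>W\<^esub> g \<in> carrier W"
proof (rule W_carrierI)
  show "finite {x. (f \<oplus>\<^bsub>W\<^esub> g) x \<noteq> \<zero>}"
    by (rule finite_subset[OF _ finite_UnI[OF W_finite[OF assms(1)] W_finite[OF assms(2)]]])
      (auto simp: W_add)
qed (auto simp: W_add W_closed W_outside assms)

lemma single_closed: "x \<in> carrier \<Gamma> \<Longrightarrow> a \<in> carrier A \<Longrightarrow> tsingle A x a \<in> carrier W"
  by (rule W_carrierI) (auto simp: tsingle_def)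

lemma single_add:
  "x \<in> carrier \<Gamma> \<Longrightarrow> a \<in> carrier A \<Longrightarrow> b \<in> carrier A
    \<Longrightarrow> tsingle A x a \<oplus>\<^bsub>W\<^esub> tsingle A x b = tsingle A x (a \<oplus> b)"
  by (auto simp: W_add tsingle_def fun_eq_iff)

lemma W_abelian: "abelian_group W"
proof (rule abelian_groupI)
  fix f assume f: "f \<in> carrier W"
  have g: "(\<lambda>z. \<ominus> f z) \<in> carrier W"
  proof (rule W_carrierI)
    show "finite {x. \<ominus> f x \<noteq> \<zero>}"
      by (rule finite_subset[OF _ W_finite[OF f]]) (auto simp: W_closed[OF f])
  qed (auto simp: W_closed[OF f] W_outside[OF f])
  show "\<exists>g\<in>carrier W. g \<oplus>\<^bsub>W\<^esub> f = \<zero>\<^bsub>W\<^esub>"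
    by (rule bexI[OF _ g]) (auto simp: W_add W_zero fun_eq_iff l_neg W_closed[OF f])
next
  show "\<zero>\<^bsub>W\<^esub> \<in> carrier W" by (rule W_carrierI) (auto simp: W_zero)
qed (auto simp: W_add_closed W_add W_zero fun_eq_iff W_closed a_assoc intro: a_comm)

text \<open>The defining sum runs over the support of the left factor. Enlarging the index set to a
  finite superset lets products with different supports be compared term by term.\<close>

lemma W_mult_over:
  assumes f: "f \<in> carrier W" and g: "g \<in> carrier W" and F: "finite F" "F \<subseteq> carrier \<Gamma>"
    and sup: "\<And>x. f x \<noteq> \<zero> \<Longrightarrow> x \<in> F" and z: "z \<in> carrier \<Gamma>"
  shows "(f \<otimes>\<^bsub>W\<^esub> g) z = (\<Oplus>x\<in>F. f x \<otimes> \<theta> x (g (inv\<^bsub>\<Gamma>\<^esub> x \<otimes>\<^bsub>\<Gamma>\<^esub> z)))"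
proof -
  have "(\<Oplus>x\<in>{x \<in> carrier \<Gamma>. f x \<noteq> \<zero>}. f x \<otimes> \<theta> x (g (inv\<^bsub>\<Gamma>\<^esub> x \<otimes>\<^bsub>\<Gamma>\<^esub> z)))
      = (\<Oplus>x\<in>F. f x \<otimes> \<theta> x (g (inv\<^bsub>\<Gamma>\<^esub> x \<otimes>\<^bsub>\<Gamma>\<^esub> z)))"
    using F sup by (intro add.finprod_mono_neutral_cong_left)
      (auto simp: W_closed[OF f] W_closed[OF g] \<theta>_simps subset_iff)
  then show ?thesis using z by (simp add: tgr_def)
qed

lemma W_mult_outside: "z \<notin> carrier \<Gamma> \<Longrightarrow> (f \<otimes>\<^bsub>W\<^esub> g) z = \<zero>"
  by (simp add: tgr_def)

lemma W_mult_fun_closed: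
  assumes f: "f \<in> carrier W" and g: "g \<in> carrier W"
  shows "(f \<otimes>\<^bsub>W\<^esub> g) z \<in> carrier A"
  by (auto simp: tgr_def \<theta>_simps W_closed[OF f] W_closed[OF g] intro!: finsum_closed)

lemma single_mult:
  assumes g: "g \<in> carrier W" and x: "x \<in> carrier \<Gamma>" and a: "a \<in> carrier A" and z: "z \<in> carrier \<Gamma>"
  shows "(tsingle A x a \<otimes>\<^bsub>W\<^esub> g) z = a \<otimes> \<theta> x (g (inv\<^bsub>\<Gamma>\<^esub> x \<otimes>\<^bsub>\<Gamma>\<^esub> z))"
proof -
  have "(tsingle A x a \<otimes>\<^bsub>W\<^esub> g) z
      = (\<Oplus>y\<in>{x}. tsingle A x a y \<otimes> \<theta> y (g (inv\<^bsub>\<Gamma>\<^esub> y \<otimes>\<^bsub>\<Gamma>\<^esub> z)))"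
    by (rule W_mult_over[OF single_closed[OF x a] g _ _ _ z]) (auto simp: tsingle_def x split: if_splits)
  also have "\<dots> = tsingle A x a x \<otimes> \<theta> x (g (inv\<^bsub>\<Gamma>\<^esub> x \<otimes>\<^bsub>\<Gamma>\<^esub> z))"
    using add.finprod_singleton_swap[of x "{x}" "\<lambda>y. tsingle A x a y \<otimes> \<theta> y (g (inv\<^bsub>\<Gamma>\<^esub> y \<otimes>\<^bsub>\<Gamma>\<^esub> z))"] x a
    by (simp add: tsingle_def \<theta>_simps W_closed[OF g])
  finally show ?thesis by (simp add: tsingle_def)
qed

lemma single_single:
  assumes x: "x \<in> carrier \<Gamma>" and a: "a \<in> carrier A" and y: "y \<in> carrier \<Gamma>" and b: "b \<in> carrier A"
  shows "tsingle A x a \<otimes>\<^bsub>W\<^esub> tsingle A y b = tsingle A (x \<otimes>\<^bsub>\<Gamma>\<^esub> y) (a \<otimes> \<theta> x b)"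
proof
  fix z
  show "(tsingle A x a \<otimes>\<^bsub>W\<^esub> tsingle A y b) z = tsingle A (x \<otimes>\<^bsub>\<Gamma>\<^esub> y) (a \<otimes> \<theta> x b) z"
  proof (cases "z \<in> carrier \<Gamma>")
    case True
    have "inv\<^bsub>\<Gamma>\<^esub> x \<otimes>\<^bsub>\<Gamma>\<^esub> z = y \<longleftrightarrow> z = x \<otimes>\<^bsub>\<Gamma>\<^esub> y"
      using True x y by (metis \<Gamma>.inv_solve_left)
    then show ?thesis using single_mult[OF single_closed[OF y b] x a True] x a
      by (simp add: tsingle_def \<theta>_simps)
  next
    case False
    then show ?thesis using x y by (auto simp: W_mult_outside tsingle_def)
  qed
qed

text \<open>A finitely supported function is a finite sum of monomials, by induction over its
  support. Additive identities in the twisted group ring thereby reduce to monomials.\<close>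

lemma W_induct [consumes 1, case_names zero step]:
  assumes f: "f \<in> carrier W" and z: "P \<zero>\<^bsub>W\<^esub>"
    and step: "\<And>x a f. x \<in> carrier \<Gamma> \<Longrightarrow> a \<in> carrier A \<Longrightarrow> f \<in> carrier W \<Longrightarrow> P f
      \<Longrightarrow> P (tsingle A x a \<oplus>\<^bsub>W\<^esub> f)"
  shows "P f"
proof -
  have "P f" if "finite F" "f \<in> carrier W" "{x. f x \<noteq> \<zero>} = F" for F f
    using that
  proof (induction F arbitrary: f rule: finite_induct)
    case empty
    then have "f = \<zero>\<^bsub>W\<^esub>" by (auto simp: W_zero)
    then show ?case using z by simp
  next
    case (insert x F)
    have x: "x \<in> carrier \<Gamma>" using insert.prems W_outside by blast
    let ?g = "f(x := \<zero>)"
    have g: "?g \<in> carrier W"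
      by (rule W_carrierI)
        (use insert in \<open>auto simp: W_closed W_outside intro: finite_subset[OF _ W_finite[OF insert.prems(1)]]\<close>)
    have "{y. ?g y \<noteq> \<zero>} = F" using insert by auto
    then have "P ?g" using insert.IH g by blast
    then have "P (tsingle A x (f x) \<oplus>\<^bsub>W\<^esub> ?g)"
      using step[OF x _ g] W_closed[OF insert.prems(1)] by blast
    moreover have "tsingle A x (f x) \<oplus>\<^bsub>W\<^esub> ?g = f"
      using W_closed[OF insert.prems(1)] by (auto simp: W_add tsingle_def)
    ultimately show ?case by simp
  qed
  then show ?thesis using f W_finite by blast
qed

lemma W_mult_ladd:
  assumes f: "f \<in> carrier W" and f': "f' \<in> carrier W" and g: "g \<in> carrier W"
  shows "(f \<oplus>\<^bsub>W\<^esub> f') \<otimes>\<^bsub>W\<^esub> g = (f \<otimes>\<^bsub>W\<^esub> g) \<oplus>\<^bsub>W\<^esub> (f' \<otimes>\<^bsub>W\<^esub> g)"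
proof
  fix z
  let ?F = "{x. f x \<noteq> \<zero>} \<union> {x. f' x \<noteq> \<zero>}"
  have F: "finite ?F" "?F \<subseteq> carrier \<Gamma>"
    using W_finite f f' W_outside by blast+
  show "((f \<oplus>\<^bsub>W\<^esub> f') \<otimes>\<^bsub>W\<^esub> g) z = ((f \<otimes>\<^bsub>W\<^esub> g) \<oplus>\<^bsub>W\<^esub> (f' \<otimes>\<^bsub>W\<^esub> g)) z"
  proof (cases "z \<in> carrier \<Gamma>")
    case True
    have sup: "(f \<oplus>\<^bsub>W\<^esub> f') x \<noteq> \<zero> \<Longrightarrow> x \<in> ?F" for x by (auto simp: W_add)
    have "((f \<oplus>\<^bsub>W\<^esub> f') \<otimes>\<^bsub>W\<^esub> g) z
        = (\<Oplus>x\<in>?F. (f x \<otimes> \<theta> x (g (inv\<^bsub>\<Gamma>\<^esub> x \<otimes>\<^bsub>\<Gamma>\<^esub> z))) \<oplus> (f' x \<otimes> \<theta> x (g (inv\<^bsub>\<Gamma>\<^esub> x \<otimes>\<^bsub>\<Gamma>\<^esub> z))))"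
      by (subst W_mult_over[OF W_add_closed[OF f f'] g F sup True], assumption, rule finsum_cong') (use F in \<open>auto simp: W_add l_distr W_closed[OF f] W_closed[OF f'] W_closed[OF g] \<theta>_simps subset_iff\<close>)
    also have "\<dots> = (\<Oplus>x\<in>?F. (f x \<otimes> \<theta> x (g (inv\<^bsub>\<Gamma>\<^esub> x \<otimes>\<^bsub>\<Gamma>\<^esub> z)))) \<oplus> (\<Oplus>x\<in>?F. (f' x \<otimes> \<theta> x (g (inv\<^bsub>\<Gamma>\<^esub> x \<otimes>\<^bsub>\<Gamma>\<^esub> z))))"
      using F by (intro finsum_addf) (auto simp: W_closed[OF f] W_closed[OF f'] W_closed[OF g] \<theta>_simps subset_iff)
    finally show ?thesis
      using W_mult_over[OF f g F _ True] W_mult_over[OF f' g F _ True] by (simp add: W_add)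
  next
    case False
    then show ?thesis by (simp add: W_mult_outside W_add)
  qed
qed

lemma W_mult_radd:
  assumes f: "f \<in> carrier W" and g: "g \<in> carrier W" and g': "g' \<in> carrier W"
  shows "f \<otimes>\<^bsub>W\<^esub> (g \<oplus>\<^bsub>W\<^esub> g') = (f \<otimes>\<^bsub>W\<^esub> g) \<oplus>\<^bsub>W\<^esub> (f \<otimes>\<^bsub>W\<^esub> g')"
proof
  fix z
  let ?F = "{x. f x \<noteq> \<zero>}"
  have F: "finite ?F" "?F \<subseteq> carrier \<Gamma>"
    using W_finite[OF f] W_outside[OF f] by auto
  show "(f \<otimes>\<^bsub>W\<^esub> (g \<oplus>\<^bsub>W\<^esub> g')) z = ((f \<otimes>\<^bsub>W\<^esub> g) \<oplus>\<^bsub>W\<^esub> (f \<otimes>\<^bsub>W\<^esub> g')) z"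
  proof (cases "z \<in> carrier \<Gamma>")
    case True
    have "(f \<otimes>\<^bsub>W\<^esub> (g \<oplus>\<^bsub>W\<^esub> g')) z
        = (\<Oplus>x\<in>?F. (f x \<otimes> \<theta> x (g (inv\<^bsub>\<Gamma>\<^esub> x \<otimes>\<^bsub>\<Gamma>\<^esub> z))) \<oplus> (f x \<otimes> \<theta> x (g' (inv\<^bsub>\<Gamma>\<^esub> x \<otimes>\<^bsub>\<Gamma>\<^esub> z))))"
      by (subst W_mult_over[OF f W_add_closed[OF g g'] F _ True], simp, rule finsum_cong') (use F in \<open>auto simp: W_add r_distr W_closed[OF f] W_closed[OF g'] W_closed[OF g] \<theta>_simps subset_iff\<close>)
    also have "\<dots> = (\<Oplus>x\<in>?F. (f x \<otimes> \<theta> x (g (inv\<^bsub>\<Gamma>\<^esub> x \<otimes>\<^bsub>\<Gamma>\<^esub> z)))) \<oplus> (\<Oplus>x\<in>?F. (f x \<otimes> \<theta> x (g' (inv\<^bsub>\<Gamma>\<^esub> x \<otimes>\<^bsub>\<Gamma>\<^esub> z))))"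
      using F by (intro finsum_addf) (auto simp: W_closed[OF f] W_closed[OF g'] W_closed[OF g] \<theta>_simps subset_iff)
    finally show ?thesis
      using W_mult_over[OF f g F _ True] W_mult_over[OF f g' F _ True] by (simp add: W_add)
  next
    case False
    then show ?thesis by (simp add: W_mult_outside W_add)
  qed
qed

lemma W_zero_mult:
  assumes "g \<in> carrier W"
  shows "\<zero>\<^bsub>W\<^esub> \<otimes>\<^bsub>W\<^esub> g = \<zero>\<^bsub>W\<^esub>"
  by (rule ext) (simp add: tgr_def)

text \<open>Multiplication by a monomial at \<open>x\<close> moves the support of \<open>g\<close>
  into its translate by \<open>x\<close>.\<close>

lemma single_mult_closed:
  assumes g: "g \<in> carrier W" and x: "x \<in> carrier \<Gamma>" and a: "a \<in> carrier A"
  shows "tsingle A x a \<otimes>\<^bsub>W\<^esub> g \<in> carrier W"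
proof (rule W_carrierI)
  show "finite {z. (tsingle A x a \<otimes>\<^bsub>W\<^esub> g) z \<noteq> \<zero>}"
  proof (rule finite_subset[OF _ finite_imageI[OF W_finite[OF g], of "\<lambda>y. x \<otimes>\<^bsub>\<Gamma>\<^esub> y"]], rule subsetI)
    fix z assume "z \<in> {z. (tsingle A x a \<otimes>\<^bsub>W\<^esub> g) z \<noteq> \<zero>}"
    then have nz: "(tsingle A x a \<otimes>\<^bsub>W\<^esub> g) z \<noteq> \<zero>" by simp
    then have z: "z \<in> carrier \<Gamma>" using W_mult_outside by blast
    then have "g (inv\<^bsub>\<Gamma>\<^esub> x \<otimes>\<^bsub>\<Gamma>\<^esub> z) \<noteq> \<zero>"
      using nz single_mult[OF g x a z] x a by (auto simp: \<theta>_simps)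
    moreover have "z = x \<otimes>\<^bsub>\<Gamma>\<^esub> (inv\<^bsub>\<Gamma>\<^esub> x \<otimes>\<^bsub>\<Gamma>\<^esub> z)" using x z by (simp flip: \<Gamma>.m_assoc)
    ultimately show "z \<in> (\<lambda>y. x \<otimes>\<^bsub>\<Gamma>\<^esub> y) ` {x. g x \<noteq> \<zero>}" by blast
  qed
qed (auto simp: W_mult_outside W_mult_fun_closed single_closed g x a)

lemma W_mult_closed:
  assumes "f \<in> carrier W" "g \<in> carrier W"
  shows "f \<otimes>\<^bsub>W\<^esub> g \<in> carrier W"
  using assms(1)
proof (induction f rule: W_induct)
  case zero
  then show ?case using W_zero_mult[OF assms(2)] abelian_group.axioms[OF W_abelian]
    by (simp add: abelian_monoid.zero_closed)
next
  case (step x a f)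
  then show ?case by (simp add: W_mult_ladd single_closed assms single_mult_closed W_add_closed)
qed

text \<open>Additivity in \<open>f\<close> and in \<open>g\<close> reduces the claim to two
  monomials on the left. Both sides are then explicit at each point for arbitrary \<open>h\<close>,
  so no third induction occurs.\<close>

lemma W_assoc:
  assumes f: "f \<in> carrier W" and g: "g \<in> carrier W" and h: "h \<in> carrier W"
  shows "f \<otimes>\<^bsub>W\<^esub> g \<otimes>\<^bsub>W\<^esub> h = f \<otimes>\<^bsub>W\<^esub> (g \<otimes>\<^bsub>W\<^esub> h)"
proof -
  interpret Wg: abelian_group W by (rule W_abelian)
  have sss: "tsingle A x a \<otimes>\<^bsub>W\<^esub> tsingle A y b \<otimes>\<^bsub>W\<^esub> h = tsingle A x a \<otimes>\<^bsub>W\<^esub> (tsingle A y b \<otimes>\<^bsub>W\<^esub> h)"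
    if x: "x \<in> carrier \<Gamma>" and a: "a \<in> carrier A" and y: "y \<in> carrier \<Gamma>" and b: "b \<in> carrier A" for x a y b
  proof
    fix z
    show "(tsingle A x a \<otimes>\<^bsub>W\<^esub> tsingle A y b \<otimes>\<^bsub>W\<^esub> h) z = (tsingle A x a \<otimes>\<^bsub>W\<^esub> (tsingle A y b \<otimes>\<^bsub>W\<^esub> h)) z"
    proof (cases "z \<in> carrier \<Gamma>")
      case True
      then show ?thesis
        by (simp add: single_single that single_mult[OF h] single_mult[OF single_mult_closed[OF h y b] x a]
            \<theta>_simps \<theta>_comp \<Gamma>.inv_mult_group m_assoc \<Gamma>.m_assoc W_closed[OF h])
    qed (simp add: W_mult_outside)
  qed
  have sg: "tsingle A x a \<otimes>\<^bsub>W\<^esub> g \<otimes>\<^bsub>W\<^esub> h = tsingle A x a \<otimes>\<^bsub>W\<^esub> (g \<otimes>\<^bsub>W\<^esub> h)"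
    if x: "x \<in> carrier \<Gamma>" and a: "a \<in> carrier A" for x a
    using g
  proof (induction g rule: W_induct)
    case zero
    have "tsingle A x a \<otimes>\<^bsub>W\<^esub> \<zero>\<^bsub>W\<^esub> \<oplus>\<^bsub>W\<^esub> tsingle A x a \<otimes>\<^bsub>W\<^esub> \<zero>\<^bsub>W\<^esub> = tsingle A x a \<otimes>\<^bsub>W\<^esub> \<zero>\<^bsub>W\<^esub>"
      using W_mult_radd[OF single_closed[OF x a], of "\<zero>\<^bsub>W\<^esub>" "\<zero>\<^bsub>W\<^esub>"] by simp
    then have "tsingle A x a \<otimes>\<^bsub>W\<^esub> \<zero>\<^bsub>W\<^esub> = \<zero>\<^bsub>W\<^esub>"
      using single_mult_closed[OF _ x a, of "\<zero>\<^bsub>W\<^esub>"] by (metis Wg.add.r_cancel_one' Wg.zero_closed)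
    then show ?case by (simp add: W_zero_mult h)
  next
    case (step y b g)
    then show ?case
      by (simp add: W_mult_ladd W_mult_radd W_mult_closed single_closed x a h sss)
  qed
  show ?thesis
    using f
  proof (induction f rule: W_induct)
    case zero
    then show ?case by (simp add: W_zero_mult g h W_mult_closed)
  next
    case (step x a f)
    then show ?case by (simp add: W_mult_ladd W_mult_closed single_closed g h sg)
  qed
qed

lemma W_ring: "ring W"
proof (rule ringI)
  have 1: "\<one>\<^bsub>W\<^esub> \<otimes>\<^bsub>W\<^esub> f = f" if f: "f \<in> carrier W" for f
  proof
    fix z show "(\<one>\<^bsub>W\<^esub> \<otimes>\<^bsub>W\<^esub> f) z = f z"
    proof (cases "z \<in> carrier \<Gamma>")
      case True
      then show ?thesis unfolding W_one by (simp add: single_mult[OF f] \<theta>_id W_closed[OF f])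
    qed (simp add: W_mult_outside W_outside[OF f])
  qed
  have 2: "f \<otimes>\<^bsub>W\<^esub> \<one>\<^bsub>W\<^esub> = f" if f: "f \<in> carrier W" for f
    using f
  proof (induction f rule: W_induct)
    case zero
    show ?case unfolding W_one by (rule W_zero_mult) (simp add: single_closed)
  next
    case (step x a f)
    have o: "\<one>\<^bsub>W\<^esub> \<in> carrier W" by (simp add: W_one single_closed)
    have "tsingle A x a \<otimes>\<^bsub>W\<^esub> \<one>\<^bsub>W\<^esub> = tsingle A x a"
      using step(1,2) by (simp add: W_one single_single \<theta>_simps)
    then show ?case using step W_mult_ladd[OF single_closed step(3) o] by simp
  qed
  show "monoid W"
  proof (rule monoidI)
    show "\<one>\<^bsub>W\<^esub> \<in> carrier W" unfolding W_one by (rule single_closed) auto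
  qed (rule W_mult_closed W_assoc 1 2; assumption)+
qed (rule W_abelian W_mult_ladd W_mult_radd; assumption)+

end

section \<open>Crossed products\<close>

sublocale twisted \<subseteq> W: ring W
  by (rule W_ring)

text \<open>The extension enters through the embedding \<open>j\<close> of its kernel; the quotient
  group is the cokernel of \<open>j\<close> and is named later. \<open>\<theta>_j\<close> and
  \<open>j_\<theta>\<close> are the two conditions for a morphism of crossed modules.\<close>

locale crossed = twisted A \<Gamma> \<theta>
  for A :: "('a,'b) ring_scheme" (structure) and \<Gamma> :: "('x,'c) monoid_scheme" and \<theta> +
  fixes j :: "'a \<Rightarrow> 'x"
  assumes j_hom: "j \<in> hom (units_of A) \<Gamma>" and j_inj: "inj_on j (Units A)"
    and \<theta>_j: "\<And>u. u \<in> Units A \<Longrightarrow> \<theta> (j u) = conj_by A u"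
    and j_\<theta>: "\<And>x u. x \<in> carrier \<Gamma> \<Longrightarrow> u \<in> Units A \<Longrightarrow> j (\<theta> x u) = x \<otimes>\<^bsub>\<Gamma>\<^esub> j u \<otimes>\<^bsub>\<Gamma>\<^esub> inv\<^bsub>\<Gamma>\<^esub> x"
begin

abbreviation I where "I \<equiv> cp_ideal A \<Gamma> \<theta> j"
abbreviation C where "C \<equiv> crossed_product A \<Gamma> \<theta> j"
abbreviation q where "q f \<equiv> I +>\<^bsub>W\<^esub> f"
abbreviation emb where "emb \<equiv> cp_emb A \<Gamma> \<theta> j"

definition v where "v \<gamma> = q (tsingle A \<gamma> \<one>)"

lemma j_closed: "u \<in> Units A \<Longrightarrow> j u \<in> carrier \<Gamma>"
  using j_hom by (auto simp: hom_def units_of_def)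

lemma j_mult: "u \<in> Units A \<Longrightarrow> w \<in> Units A \<Longrightarrow> j (u \<otimes> w) = j u \<otimes>\<^bsub>\<Gamma>\<^esub> j w"
  using j_hom by (auto simp: hom_def units_of_def)

lemma j_one: "j \<one> = \<one>\<^bsub>\<Gamma>\<^esub>"
  using j_mult[of \<one> \<one>] j_closed[of \<one>] by (simp add: \<Gamma>.r_cancel_one')

lemma \<theta>_unit: "x \<in> carrier \<Gamma> \<Longrightarrow> u \<in> Units A \<Longrightarrow> \<theta> x u \<in> Units A"
  using ring_aut_unit(1)[OF ring_axioms \<theta>_aut] .

text \<open>The crossed module condition in the form used for collecting terms: left and right
  cosets of j(U(A)) agree, at the price of applying \<open>\<theta> x\<close> to the unit.\<close>

lemma move_j:
  "x \<in> carrier \<Gamma> \<Longrightarrow> u \<in> Units A \<Longrightarrow> x \<otimes>\<^bsub>\<Gamma>\<^esub> j u = j (\<theta> x u) \<otimes>\<^bsub>\<Gamma>\<^esub> x"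
  by (simp add: j_\<theta> j_closed \<Gamma>.m_assoc)

text \<open>Reading \<open>f\<close> as a formal sum in \<open>C\<close>, \<open>lam \<gamma> f\<close> is the coefficient of \<open>\<gamma>\<close> after all
  terms of the coset \<open>j(U(A)) \<gamma>\<close> have been collected at \<open>\<gamma>\<close>. These functionals cut out the defining ideal, which makes
  the crossed product computable without building a second model of it.\<close>

definition lam where
  "lam \<gamma> f = (\<Oplus>x\<in>{x \<in> Units A. f (j x \<otimes>\<^bsub>\<Gamma>\<^esub> \<gamma>) \<noteq> \<zero>}. f (j x \<otimes>\<^bsub>\<Gamma>\<^esub> \<gamma>) \<otimes> x)"

text \<open>Injectivity of \<open>j\<close> keeps the collected sum finite, since distinct units
  reach distinct points of the coset.\<close>

lemma lam_support_finite:
  assumes f: "f \<in> carrier W" and \<gamma>: "\<gamma> \<in> carrier \<Gamma>"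
  shows "finite {x \<in> Units A. f (j x \<otimes>\<^bsub>\<Gamma>\<^esub> \<gamma>) \<noteq> \<zero>}" (is "finite ?F")
proof (rule inj_on_finite[OF _ _ W_finite[OF f]])
  show "inj_on (\<lambda>x. j x \<otimes>\<^bsub>\<Gamma>\<^esub> \<gamma>) ?F"
    using \<gamma> by (auto intro!: inj_onI dest: inj_onD[OF j_inj] simp: j_closed)
qed auto

lemma lam_over:
  assumes f: "f \<in> carrier W" and F: "finite F" "F \<subseteq> Units A"
    and sup: "\<And>x. x \<in> Units A \<Longrightarrow> f (j x \<otimes>\<^bsub>\<Gamma>\<^esub> \<gamma>) \<noteq> \<zero> \<Longrightarrow> x \<in> F"
  shows "lam \<gamma> f = (\<Oplus>x\<in>F. f (j x \<otimes>\<^bsub>\<Gamma>\<^esub> \<gamma>) \<otimes> x)"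
  unfolding lam_def using F sup
  by (intro add.finprod_mono_neutral_cong_left)
    (auto simp: W_closed[OF f] subset_iff Units_closed)

lemma lam_closed: "f \<in> carrier W \<Longrightarrow> lam \<gamma> f \<in> carrier A"
  unfolding lam_def by (rule finsum_closed) (auto simp: W_closed Units_closed)

lemma lam_add:
  assumes f: "f \<in> carrier W" and g: "g \<in> carrier W" and \<gamma>: "\<gamma> \<in> carrier \<Gamma>"
  shows "lam \<gamma> (f \<oplus>\<^bsub>W\<^esub> g) = lam \<gamma> f \<oplus> lam \<gamma> g"
proof -
  let ?F = "{x \<in> Units A. f (j x \<otimes>\<^bsub>\<Gamma>\<^esub> \<gamma>) \<noteq> \<zero>} \<union> {x \<in> Units A. g (j x \<otimes>\<^bsub>\<Gamma>\<^esub> \<gamma>) \<noteq> \<zero>}"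
  have F: "finite ?F" "?F \<subseteq> Units A" using lam_support_finite f g \<gamma> by auto
  have "lam \<gamma> (f \<oplus>\<^bsub>W\<^esub> g) = (\<Oplus>x\<in>?F. (f \<oplus>\<^bsub>W\<^esub> g) (j x \<otimes>\<^bsub>\<Gamma>\<^esub> \<gamma>) \<otimes> x)"
    by (rule lam_over[OF W_add_closed[OF f g] F]) (auto simp: W_add)
  also have "\<dots> = (\<Oplus>x\<in>?F. f (j x \<otimes>\<^bsub>\<Gamma>\<^esub> \<gamma>) \<otimes> x \<oplus> g (j x \<otimes>\<^bsub>\<Gamma>\<^esub> \<gamma>) \<otimes> x)"
    by (rule finsum_cong') (auto simp: W_add l_distr W_closed[OF f] W_closed[OF g] Units_closed)
  also have "\<dots> = (\<Oplus>x\<in>?F. f (j x \<otimes>\<^bsub>\<Gamma>\<^esub> \<gamma>) \<otimes> x) \<oplus> (\<Oplus>x\<in>?F. g (j x \<otimes>\<^bsub>\<Gamma>\<^esub> \<gamma>) \<otimes> x)"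
    by (rule finsum_addf) (auto simp: W_closed[OF f] W_closed[OF g] Units_closed)
  also have "\<dots> = lam \<gamma> f \<oplus> lam \<gamma> g"
    using lam_over[OF f F] lam_over[OF g F] by simp
  finally show ?thesis .
qed

lemma lam_zero: "lam \<gamma> \<zero>\<^bsub>W\<^esub> = \<zero>"
  unfolding lam_def by (simp add: W_zero)

lemma lam_minus:
  assumes f: "f \<in> carrier W" and g: "g \<in> carrier W" and \<gamma>: "\<gamma> \<in> carrier \<Gamma>"
  shows "lam \<gamma> (f \<ominus>\<^bsub>W\<^esub> g) = lam \<gamma> f \<ominus> lam \<gamma> g"
proof -
  have "f = (f \<ominus>\<^bsub>W\<^esub> g) \<oplus>\<^bsub>W\<^esub> g" using f g by (simp add: W.minus_eq W.a_assoc W.l_neg)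
  then have "lam \<gamma> f = lam \<gamma> (f \<ominus>\<^bsub>W\<^esub> g) \<oplus> lam \<gamma> g"
    using lam_add[OF W.minus_closed[OF f g] g \<gamma>] by simp
  then show ?thesis using lam_closed[OF f] lam_closed[OF g] lam_closed[OF W.minus_closed[OF f g]]
    by (simp add: minus_eq a_assoc r_neg)
qed

text \<open>In \<open>C\<close> the monomial a j(x)\<gamma> equals ax\<gamma>, whence the
  coefficient ax at \<gamma>.\<close>

lemma lam_single:
  assumes "\<gamma> \<in> carrier \<Gamma>" "a \<in> carrier A" "x \<in> Units A"
  shows "lam \<gamma> (tsingle A (j x \<otimes>\<^bsub>\<Gamma>\<^esub> \<gamma>) a) = a \<otimes> x"
proof -
  have "lam \<gamma> (tsingle A (j x \<otimes>\<^bsub>\<Gamma>\<^esub> \<gamma>) a) = (\<Oplus>y\<in>{x}. tsingle A (j x \<otimes>\<^bsub>\<Gamma>\<^esub> \<gamma>) a (j y \<otimes>\<^bsub>\<Gamma>\<^esub> \<gamma>) \<otimes> y)"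
    using assms by (intro lam_over single_closed)
      (auto simp: j_closed tsingle_def split: if_splits dest: inj_onD[OF j_inj])
  also have "\<dots> = a \<otimes> x" using assms by (simp add: tsingle_def Units_closed)
  finally show ?thesis .
qed

lemma lam_single_other:
  assumes "\<And>x. x \<in> Units A \<Longrightarrow> \<delta> \<noteq> j x \<otimes>\<^bsub>\<Gamma>\<^esub> \<gamma>"
  shows "lam \<gamma> (tsingle A \<delta> a) = \<zero>"
proof -
  have "{x \<in> Units A. tsingle A \<delta> a (j x \<otimes>\<^bsub>\<Gamma>\<^esub> \<gamma>) \<noteq> \<zero>} = {}"
    using assms by (auto simp: tsingle_def)
  then show ?thesis unfolding lam_def by (simp only: finsum_empty)
qed

text \<open>A term at j(y)\<delta>^-1\<rho> is moved by \<delta> to one at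
  j(\<theta>_\<delta>(y))\<rho>. So the coefficient of the product at \<rho> stems from the
  coefficient of \<open>f\<close> at \<delta>^-1\<rho>.\<close>

lemma lam_left:
  assumes f: "f \<in> carrier W" and \<delta>: "\<delta> \<in> carrier \<Gamma>" and a: "a \<in> carrier A" and \<rho>: "\<rho> \<in> carrier \<Gamma>"
  shows "lam \<rho> (tsingle A \<delta> a \<otimes>\<^bsub>W\<^esub> f) = a \<otimes> \<theta> \<delta> (lam (inv\<^bsub>\<Gamma>\<^esub> \<delta> \<otimes>\<^bsub>\<Gamma>\<^esub> \<rho>) f)"
  using f
proof (induction f rule: W_induct)
  case zero
  then show ?case using \<delta> a by (simp add: single_closed lam_zero \<theta>_simps)
next
  case (step \<gamma> b f)
  let ?\<rho>' = "inv\<^bsub>\<Gamma>\<^esub> \<delta> \<otimes>\<^bsub>\<Gamma>\<^esub> \<rho>"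
  have \<rho>': "?\<rho>' \<in> carrier \<Gamma>" using \<delta> \<rho> by simp
  have s: "lam \<rho> (tsingle A (\<delta> \<otimes>\<^bsub>\<Gamma>\<^esub> \<gamma>) (a \<otimes> \<theta> \<delta> b)) = a \<otimes> \<theta> \<delta> (lam ?\<rho>' (tsingle A \<gamma> b))"
  proof (cases "\<exists>y\<in>Units A. \<gamma> = j y \<otimes>\<^bsub>\<Gamma>\<^esub> ?\<rho>'")
    case True
    then obtain y where y: "y \<in> Units A" "\<gamma> = j y \<otimes>\<^bsub>\<Gamma>\<^esub> ?\<rho>'" by auto
    have "\<delta> \<otimes>\<^bsub>\<Gamma>\<^esub> \<gamma> = (\<delta> \<otimes>\<^bsub>\<Gamma>\<^esub> j y) \<otimes>\<^bsub>\<Gamma>\<^esub> ?\<rho>'" using y \<delta> \<rho> j_closed by (simp add: \<Gamma>.m_assoc)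
    also have "\<dots> = j (\<theta> \<delta> y) \<otimes>\<^bsub>\<Gamma>\<^esub> \<rho>"
      unfolding move_j[OF \<delta> y(1)] using \<delta> \<rho> j_closed[OF \<theta>_unit[OF \<delta> y(1)]]
      by (simp add: \<Gamma>.m_assoc) (simp flip: \<Gamma>.m_assoc)
    finally have "lam \<rho> (tsingle A (\<delta> \<otimes>\<^bsub>\<Gamma>\<^esub> \<gamma>) (a \<otimes> \<theta> \<delta> b)) = a \<otimes> \<theta> \<delta> b \<otimes> \<theta> \<delta> y"
      using lam_single[OF \<rho> _ \<theta>_unit[OF \<delta> y(1)]] a step(2) \<delta> by (simp add: \<theta>_simps)
    moreover have "lam ?\<rho>' (tsingle A \<gamma> b) = b \<otimes> y"
      using lam_single[OF \<rho>' step(2) y(1)] y(2) by simp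
    ultimately show ?thesis using a \<delta> step(2) y(1) by (simp add: \<theta>_simps Units_closed m_assoc)
  next
    case False
    \<comment> \<open>Outside the coset both sides vanish: writing \<delta>\<gamma> over \<rho>
      would give, after moving back by \<delta>^-1, an expression of \<gamma> over
      \<delta>^-1\<rho>.\<close>
    have "\<delta> \<otimes>\<^bsub>\<Gamma>\<^esub> \<gamma> \<noteq> j x \<otimes>\<^bsub>\<Gamma>\<^esub> \<rho>" if x: "x \<in> Units A" for x
    proof
      assume e: "\<delta> \<otimes>\<^bsub>\<Gamma>\<^esub> \<gamma> = j x \<otimes>\<^bsub>\<Gamma>\<^esub> \<rho>"
      have i: "inv\<^bsub>\<Gamma>\<^esub> \<delta> \<in> carrier \<Gamma>" using \<delta> by simp
      have "\<gamma> = inv\<^bsub>\<Gamma>\<^esub> \<delta> \<otimes>\<^bsub>\<Gamma>\<^esub> (\<delta> \<otimes>\<^bsub>\<Gamma>\<^esub> \<gamma>)" using \<delta> step(1) by (simp flip: \<Gamma>.m_assoc)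
      also have "\<dots> = (inv\<^bsub>\<Gamma>\<^esub> \<delta> \<otimes>\<^bsub>\<Gamma>\<^esub> j x) \<otimes>\<^bsub>\<Gamma>\<^esub> \<rho>"
        unfolding e using i \<rho> j_closed[OF x] by (simp add: \<Gamma>.m_assoc)
      also have "\<dots> = j (\<theta> (inv\<^bsub>\<Gamma>\<^esub> \<delta>) x) \<otimes>\<^bsub>\<Gamma>\<^esub> ?\<rho>'"
        unfolding move_j[OF i x] using i \<rho> j_closed[OF \<theta>_unit[OF i x]] by (simp add: \<Gamma>.m_assoc)
      finally show False using False \<theta>_unit[OF i x] by blast
    qed
    then show ?thesis
      using lam_single_other[of "\<delta> \<otimes>\<^bsub>\<Gamma>\<^esub> \<gamma>" \<rho>] lam_single_other[of \<gamma> ?\<rho>'] False a \<delta>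
      by (auto simp: \<theta>_simps)
  qed
  have "lam \<rho> (tsingle A \<delta> a \<otimes>\<^bsub>W\<^esub> (tsingle A \<gamma> b \<oplus>\<^bsub>W\<^esub> f))
      = lam \<rho> (tsingle A (\<delta> \<otimes>\<^bsub>\<Gamma>\<^esub> \<gamma>) (a \<otimes> \<theta> \<delta> b)) \<oplus> lam \<rho> (tsingle A \<delta> a \<otimes>\<^bsub>W\<^esub> f)"
    using step \<delta> a \<rho>
    by (simp add: W.r_distr single_closed single_single lam_add \<theta>_simps)
  also have "\<dots> = a \<otimes> \<theta> \<delta> (lam ?\<rho>' (tsingle A \<gamma> b \<oplus>\<^bsub>W\<^esub> f))"
    unfolding s step.IH lam_add[OF single_closed[OF step(1,2)] step(3) \<rho>']
    using \<delta> a lam_closed[OF step(3)] lam_closed[OF single_closed[OF step(1,2)]]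
    by (simp add: \<theta>_simps r_distr)
  finally show ?case .
qed

text \<open>With \<rho>' = \<rho>\<delta>^-1, a term at j(y)\<rho>' acts on \<open>b\<close> by
  \<theta>(\<rho>') followed by conjugation by y. The trailing inverse of y cancels against the y
  that is collected.\<close>

lemma lam_right:
  assumes f: "f \<in> carrier W" and \<delta>: "\<delta> \<in> carrier \<Gamma>" and b: "b \<in> carrier A" and \<rho>: "\<rho> \<in> carrier \<Gamma>"
  shows "lam \<rho> (f \<otimes>\<^bsub>W\<^esub> tsingle A \<delta> b)
    = lam (\<rho> \<otimes>\<^bsub>\<Gamma>\<^esub> inv\<^bsub>\<Gamma>\<^esub> \<delta>) f \<otimes> \<theta> (\<rho> \<otimes>\<^bsub>\<Gamma>\<^esub> inv\<^bsub>\<Gamma>\<^esub> \<delta>) b"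
  using f
proof (induction f rule: W_induct)
  case zero
  then show ?case using \<delta> b \<rho> by (simp add: single_closed lam_zero \<theta>_simps)
next
  case (step \<gamma> a f)
  let ?\<rho>' = "\<rho> \<otimes>\<^bsub>\<Gamma>\<^esub> inv\<^bsub>\<Gamma>\<^esub> \<delta>"
  have \<rho>': "?\<rho>' \<in> carrier \<Gamma>" using \<delta> \<rho> by simp
  have s: "lam \<rho> (tsingle A (\<gamma> \<otimes>\<^bsub>\<Gamma>\<^esub> \<delta>) (a \<otimes> \<theta> \<gamma> b)) = lam ?\<rho>' (tsingle A \<gamma> a) \<otimes> \<theta> ?\<rho>' b"
  proof (cases "\<exists>y\<in>Units A. \<gamma> = j y \<otimes>\<^bsub>\<Gamma>\<^esub> ?\<rho>'")
    case True
    then obtain y where y: "y \<in> Units A" "\<gamma> = j y \<otimes>\<^bsub>\<Gamma>\<^esub> ?\<rho>'" by auto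
    have "\<gamma> \<otimes>\<^bsub>\<Gamma>\<^esub> \<delta> = j y \<otimes>\<^bsub>\<Gamma>\<^esub> \<rho>" using y \<delta> \<rho> j_closed by (simp add: \<Gamma>.m_assoc)
    then have "lam \<rho> (tsingle A (\<gamma> \<otimes>\<^bsub>\<Gamma>\<^esub> \<delta>) (a \<otimes> \<theta> \<gamma> b)) = a \<otimes> \<theta> \<gamma> b \<otimes> y"
      using lam_single[OF \<rho> _ y(1)] step(1,2) b by (simp add: \<theta>_simps)
    moreover have "\<theta> \<gamma> b = y \<otimes> \<theta> ?\<rho>' b \<otimes> inv y"
      unfolding y(2) using \<theta>_comp[OF j_closed[OF y(1)] \<rho>' b] \<rho>' b y(1)
      by (simp add: \<theta>_j conj_by_app \<theta>_simps)
    moreover have "a \<otimes> (y \<otimes> \<theta> ?\<rho>' b \<otimes> inv y) \<otimes> y = (a \<otimes> y) \<otimes> \<theta> ?\<rho>' b"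
      using step(2) y(1) b \<rho>' by (simp add: m_assoc \<theta>_simps Units_closed)
    moreover have "a \<otimes> y = lam ?\<rho>' (tsingle A \<gamma> a)"
      using lam_single[OF \<rho>' step(2) y(1)] y(2) by simp
    ultimately show ?thesis by simp
  next
    case False
    have "\<gamma> \<otimes>\<^bsub>\<Gamma>\<^esub> \<delta> \<noteq> j x \<otimes>\<^bsub>\<Gamma>\<^esub> \<rho>" if x: "x \<in> Units A" for x
    proof
      assume e: "\<gamma> \<otimes>\<^bsub>\<Gamma>\<^esub> \<delta> = j x \<otimes>\<^bsub>\<Gamma>\<^esub> \<rho>"
      have "\<gamma> = (\<gamma> \<otimes>\<^bsub>\<Gamma>\<^esub> \<delta>) \<otimes>\<^bsub>\<Gamma>\<^esub> inv\<^bsub>\<Gamma>\<^esub> \<delta>" using \<delta> step(1) by (simp add: \<Gamma>.m_assoc)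
      also have "\<dots> = j x \<otimes>\<^bsub>\<Gamma>\<^esub> ?\<rho>'"
        unfolding e using \<delta> \<rho> j_closed[OF x] by (simp add: \<Gamma>.m_assoc)
      finally show False using False x by blast
    qed
    then show ?thesis
      using lam_single_other[of "\<gamma> \<otimes>\<^bsub>\<Gamma>\<^esub> \<delta>" \<rho>] lam_single_other[of \<gamma> ?\<rho>'] False b \<rho>'
      by (auto simp: \<theta>_simps)
  qed
  have "lam \<rho> ((tsingle A \<gamma> a \<oplus>\<^bsub>W\<^esub> f) \<otimes>\<^bsub>W\<^esub> tsingle A \<delta> b)
      = lam \<rho> (tsingle A (\<gamma> \<otimes>\<^bsub>\<Gamma>\<^esub> \<delta>) (a \<otimes> \<theta> \<gamma> b)) \<oplus> lam \<rho> (f \<otimes>\<^bsub>W\<^esub> tsingle A \<delta> b)"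
    using step \<delta> b \<rho>
    by (simp add: W.l_distr single_closed single_single lam_add \<theta>_simps)
  also have "\<dots> = lam ?\<rho>' (tsingle A \<gamma> a \<oplus>\<^bsub>W\<^esub> f) \<otimes> \<theta> ?\<rho>' b"
    unfolding s step.IH lam_add[OF single_closed[OF step(1,2)] step(3) \<rho>']
    using \<rho>' b lam_closed[OF step(3)] lam_closed[OF single_closed[OF step(1,2)]]
    by (simp add: \<theta>_simps l_distr)
  finally show ?case .
qed

text \<open>By \<open>lam_left\<close> and \<open>lam_right\<close>, multiplication by a monomial
  permutes the functionals up to factors and automorphisms. So the common kernel is a two-sided
  ideal, while the kernel of a single functional need not be.\<close>

lemma lam_kernel_ideal: "ideal {f \<in> carrier W. \<forall>\<gamma>\<in>carrier \<Gamma>. lam \<gamma> f = \<zero>} W" (is "ideal ?K W")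
proof (rule idealI[OF W_ring])
  show "subgroup ?K (add_monoid W)"
  proof (rule W.add.subgroupI)
    have "\<zero>\<^bsub>W\<^esub> \<in> ?K" by (simp add: lam_zero)
    then show "?K \<noteq> {}" by blast
    fix f assume f: "f \<in> ?K"
    have "\<ominus>\<^bsub>W\<^esub> f = \<zero>\<^bsub>W\<^esub> \<ominus>\<^bsub>W\<^esub> f" using f by (simp add: W.minus_eq)
    then show "\<ominus>\<^bsub>W\<^esub> f \<in> ?K" using f by (simp add: lam_minus lam_zero)
  qed (auto simp: lam_add)
  fix f h assume f: "f \<in> ?K" and h: "h \<in> carrier W"
  have fW: "f \<in> carrier W" using f by simp
  show "h \<otimes>\<^bsub>W\<^esub> f \<in> ?K"
    using h
  proof (induction h rule: W_induct)
    case zero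
    then show ?case using fW by (simp add: lam_zero)
  next
    case (step x a h)
    then show ?case using f fW by (simp add: W.l_distr single_closed lam_add lam_left \<theta>_simps)
  qed
  show "f \<otimes>\<^bsub>W\<^esub> h \<in> ?K"
    using h
  proof (induction h rule: W_induct)
    case zero
    then show ?case using fW by (simp add: lam_zero)
  next
    case (step x a h)
    then show ?case using f fW by (simp add: W.r_distr single_closed lam_add lam_right \<theta>_simps)
  qed
qed

section \<open>The defining ideal and the generators of the quotient\<close>

lemma gen_closed:
  "y \<in> Units A \<Longrightarrow> tsingle A \<one>\<^bsub>\<Gamma>\<^esub> y \<ominus>\<^bsub>W\<^esub> tsingle A (j y) \<one> \<in> carrier W"
  by (simp add: single_closed j_closed Units_closed)

lemma I_ideal: "ideal I W"
  unfolding cp_ideal_def using gen_closed by (intro W.genideal_ideal) auto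

sublocale I: ideal I W
  by (rule I_ideal)

lemma gen_in_I: "y \<in> Units A \<Longrightarrow> tsingle A \<one>\<^bsub>\<Gamma>\<^esub> y \<ominus>\<^bsub>W\<^esub> tsingle A (j y) \<one> \<in> I"
proof -
  let ?S = "{tsingle A \<one>\<^bsub>\<Gamma>\<^esub> y \<ominus>\<^bsub>W\<^esub> tsingle A (j y) \<one> | y. y \<in> Units A}"
  have "?S \<subseteq> I" unfolding cp_ideal_def using gen_closed by (intro W.genideal_self) auto
  then show "y \<in> Units A \<Longrightarrow> tsingle A \<one>\<^bsub>\<Gamma>\<^esub> y \<ominus>\<^bsub>W\<^esub> tsingle A (j y) \<one> \<in> I" by blast
qed

text \<open>By minimality of the generated ideal only generators need checking, and there the two
  monomials have equal coefficients: if j(x)\<gamma> = 1, then j(y) = j(yx)\<gamma>, and each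
  contributes yx.\<close>

lemma lam_I:
  assumes f: "f \<in> I" and \<rho>: "\<rho> \<in> carrier \<Gamma>"
  shows "lam \<rho> f = \<zero>"
proof -
  have "I \<subseteq> {f \<in> carrier W. \<forall>\<gamma>\<in>carrier \<Gamma>. lam \<gamma> f = \<zero>}"
    unfolding cp_ideal_def
  proof (rule W.genideal_minimal[OF lam_kernel_ideal], safe)
    fix y assume y: "y \<in> Units A"
    show "tsingle A \<one>\<^bsub>\<Gamma>\<^esub> y \<ominus>\<^bsub>W\<^esub> tsingle A (j y) \<one> \<in> carrier W" by (rule gen_closed[OF y])
    fix \<gamma> assume \<gamma>: "\<gamma> \<in> carrier \<Gamma>"
    have "lam \<gamma> (tsingle A \<one>\<^bsub>\<Gamma>\<^esub> y) = lam \<gamma> (tsingle A (j y) \<one>)"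
    proof (cases "\<exists>x\<in>Units A. \<one>\<^bsub>\<Gamma>\<^esub> = j x \<otimes>\<^bsub>\<Gamma>\<^esub> \<gamma>")
      case True
      then obtain x where x: "x \<in> Units A" "j x \<otimes>\<^bsub>\<Gamma>\<^esub> \<gamma> = \<one>\<^bsub>\<Gamma>\<^esub>" by metis
      have "j (y \<otimes> x) \<otimes>\<^bsub>\<Gamma>\<^esub> \<gamma> = j y"
        using x \<gamma> y by (simp add: \<Gamma>.m_assoc j_mult j_closed)
      then have "lam \<gamma> (tsingle A (j y) \<one>) = y \<otimes> x"
        using lam_single[OF \<gamma> one_closed, of "y \<otimes> x"] x(1) y by (simp add: Units_closed)
      then show ?thesis using lam_single[OF \<gamma> Units_closed[OF y] x(1)] x(2) by simp
    next
      case False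
      have "j y \<noteq> j x \<otimes>\<^bsub>\<Gamma>\<^esub> \<gamma>" if x: "x \<in> Units A" for x
      proof
        assume e: "j y = j x \<otimes>\<^bsub>\<Gamma>\<^esub> \<gamma>"
        have "j (inv y \<otimes> x) \<otimes>\<^bsub>\<Gamma>\<^esub> \<gamma> = j (inv y) \<otimes>\<^bsub>\<Gamma>\<^esub> j y"
          unfolding e using j_mult[of "inv y" x] x y \<gamma> by (simp add: \<Gamma>.m_assoc j_closed)
        also have "\<dots> = \<one>\<^bsub>\<Gamma>\<^esub>" using j_mult[of "inv y" y] y by (simp add: j_one)
        finally show False using False x y by (metis Units_inv_Units Units_m_closed)
      qed
      then show ?thesis using False lam_single_other by metis
    qed
    then show "lam \<gamma> (tsingle A \<one>\<^bsub>\<Gamma>\<^esub> y \<ominus>\<^bsub>W\<^esub> tsingle A (j y) \<one>) = \<zero>"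
      using y \<gamma> lam_closed[OF single_closed, of "\<one>\<^bsub>\<Gamma>\<^esub>" y \<gamma>]
      by (simp add: lam_minus single_closed j_closed Units_closed lam_closed minus_eq r_neg)
  qed
  then show ?thesis using f \<rho> by blast
qed

sublocale C: ring C
  unfolding crossed_product_def by (rule I.quotient_is_ring)

lemma q_hom: "(\<lambda>f. q f) \<in> ring_hom W C"
  unfolding crossed_product_def by (rule I.rcos_ring_hom)

lemmas q_simps = ring_hom_closed[OF q_hom] ring_hom_add[OF q_hom] ring_hom_mult[OF q_hom] ring_hom_one[OF q_hom]

lemma q_zero: "q \<zero>\<^bsub>W\<^esub> = \<zero>\<^bsub>C\<^esub>"
  using ring_hom_zero[OF q_hom W_ring C.ring_axioms] .

lemma q_surj: "c \<in> carrier C \<Longrightarrow> \<exists>f\<in>carrier W. c = q f"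
  by (auto simp: crossed_product_def FactRing_def A_RCOSETS_def RCOSETS_def a_r_coset_def)

lemma q_eq_iff: "f \<in> carrier W \<Longrightarrow> g \<in> carrier W \<Longrightarrow> q f = q g \<longleftrightarrow> f \<ominus>\<^bsub>W\<^esub> g \<in> I"
  using W.quotient_eq_iff_same_a_r_cos[OF I_ideal] by blast

text \<open>Since they kill the ideal, the functionals \<open>lam \<gamma>\<close> are well defined
  on \<open>C\<close>. This is how elements of the quotient are told apart.\<close>

lemma lam_cong:
  assumes "f \<in> carrier W" "g \<in> carrier W" "q f = q g" "\<gamma> \<in> carrier \<Gamma>"
  shows "lam \<gamma> f = lam \<gamma> g"
proof -
  have "lam \<gamma> f \<ominus> lam \<gamma> g = \<zero>"
    using lam_I[of "f \<ominus>\<^bsub>W\<^esub> g" \<gamma>] assms q_eq_iff lam_minus by metis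
  then show ?thesis using lam_closed assms by (metis r_right_minus_eq)
qed

lemma emb_q: "emb a = q (tsingle A \<one>\<^bsub>\<Gamma>\<^esub> a)"
  by (simp add: cp_emb_def)

lemma emb_closed: "a \<in> carrier A \<Longrightarrow> emb a \<in> carrier C"
  by (simp add: emb_q q_simps single_closed)

lemma emb_hom: "emb \<in> ring_hom A C"
proof (rule ring_hom_memI)
  fix a b assume ab: "a \<in> carrier A" "b \<in> carrier A"
  show "emb (a \<otimes> b) = emb a \<otimes>\<^bsub>C\<^esub> emb b"
    using ab q_simps(3)[OF single_closed single_closed, of "\<one>\<^bsub>\<Gamma>\<^esub>" a "\<one>\<^bsub>\<Gamma>\<^esub>" b]
    by (simp add: emb_q single_single \<theta>_id)
  show "emb (a \<oplus> b) = emb a \<oplus>\<^bsub>C\<^esub> emb b"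
    using ab q_simps(2)[OF single_closed single_closed, of "\<one>\<^bsub>\<Gamma>\<^esub>" a "\<one>\<^bsub>\<Gamma>\<^esub>" b]
    by (simp add: emb_q single_add)
next
  show "emb \<one> = \<one>\<^bsub>C\<^esub>" using q_simps(4) by (simp add: emb_q W_one)
qed (rule emb_closed)

lemmas emb_simps = ring_hom_mult[OF emb_hom] ring_hom_add[OF emb_hom] ring_hom_one[OF emb_hom]

text \<open>The coefficient at the neutral element recovers \<open>a\<close>, so \<open>A\<close> is
  not collapsed in the quotient.\<close>

lemma emb_inj: "inj_on emb (carrier A)"
proof (rule inj_onI)
  fix a b assume ab: "a \<in> carrier A" "b \<in> carrier A" and e: "emb a = emb b"
  have "lam \<one>\<^bsub>\<Gamma>\<^esub> (tsingle A \<one>\<^bsub>\<Gamma>\<^esub> a) = lam \<one>\<^bsub>\<Gamma>\<^esub> (tsingle A \<one>\<^bsub>\<Gamma>\<^esub> b)"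
    using e ab by (intro lam_cong single_closed) (simp_all add: emb_q)
  then show "a = b" using lam_single[of "\<one>\<^bsub>\<Gamma>\<^esub>" a \<one>] lam_single[of "\<one>\<^bsub>\<Gamma>\<^esub>" b \<one>] ab by (simp add: j_one)
qed

lemmas emb_unit = ring_hom_unit[OF ring_axioms C.ring_axioms emb_hom]

lemma v_closed: "\<gamma> \<in> carrier \<Gamma> \<Longrightarrow> v \<gamma> \<in> carrier C"
  by (simp add: v_def q_simps single_closed)

lemma v_mult: "\<gamma> \<in> carrier \<Gamma> \<Longrightarrow> \<delta> \<in> carrier \<Gamma> \<Longrightarrow> v (\<gamma> \<otimes>\<^bsub>\<Gamma>\<^esub> \<delta>) = v \<gamma> \<otimes>\<^bsub>C\<^esub> v \<delta>"
  using q_simps(3)[OF single_closed single_closed, of \<gamma> \<one> \<delta> \<one>] by (simp add: v_def single_single \<theta>_simps)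

lemma v_one: "v \<one>\<^bsub>\<Gamma>\<^esub> = \<one>\<^bsub>C\<^esub>"
  using q_simps(4) by (simp add: v_def W_one)

lemma v_unit:
  assumes "\<gamma> \<in> carrier \<Gamma>"
  shows "v \<gamma> \<in> Units C"
proof -
  have "v \<gamma> \<otimes>\<^bsub>C\<^esub> v (inv\<^bsub>\<Gamma>\<^esub> \<gamma>) = \<one>\<^bsub>C\<^esub>" "v (inv\<^bsub>\<Gamma>\<^esub> \<gamma>) \<otimes>\<^bsub>C\<^esub> v \<gamma> = \<one>\<^bsub>C\<^esub>"
    using assms by (simp_all add: v_one flip: v_mult)
  then show ?thesis using v_closed[of \<gamma>] v_closed[of "inv\<^bsub>\<Gamma>\<^esub> \<gamma>"] assms unfolding Units_def by auto
qed

lemma v_j: "y \<in> Units A \<Longrightarrow> v (j y) = emb y"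
  using q_eq_iff[of "tsingle A \<one>\<^bsub>\<Gamma>\<^esub> y" "tsingle A (j y) \<one>"] gen_in_I[of y]
  by (simp add: v_def emb_q single_closed Units_closed j_closed)

lemma q_single: "\<gamma> \<in> carrier \<Gamma> \<Longrightarrow> a \<in> carrier A \<Longrightarrow> q (tsingle A \<gamma> a) = emb a \<otimes>\<^bsub>C\<^esub> v \<gamma>"
  using q_simps(3)[OF single_closed single_closed, of "\<one>\<^bsub>\<Gamma>\<^esub>" a \<gamma> \<one>]
  by (simp add: v_def emb_q single_single \<theta>_id)

lemma v_emb: "\<gamma> \<in> carrier \<Gamma> \<Longrightarrow> a \<in> carrier A \<Longrightarrow> v \<gamma> \<otimes>\<^bsub>C\<^esub> emb a = emb (\<theta> \<gamma> a) \<otimes>\<^bsub>C\<^esub> v \<gamma>"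
  using q_simps(3)[OF single_closed single_closed, of \<gamma> \<one> "\<one>\<^bsub>\<Gamma>\<^esub>" a] q_single[of \<gamma> "\<theta> \<gamma> a"]
  by (simp add: v_def emb_q single_single \<theta>_simps)

text \<open>\<open>C\<close> is spanned additively by the products of \<open>emb a\<close> with
  \<open>v \<gamma>\<close>; homomorphisms out of \<open>C\<close> are compared, and commutation is
  tested, on these.\<close>

lemma C_induct [consumes 1, case_names zero step]:
  assumes c: "c \<in> carrier C" and z: "P \<zero>\<^bsub>C\<^esub>"
    and step: "\<And>\<gamma> a c. \<gamma> \<in> carrier \<Gamma> \<Longrightarrow> a \<in> carrier A \<Longrightarrow> c \<in> carrier C \<Longrightarrow> P c
      \<Longrightarrow> P (emb a \<otimes>\<^bsub>C\<^esub> v \<gamma> \<oplus>\<^bsub>C\<^esub> c)"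
  shows "P c"
proof -
  obtain f where f: "f \<in> carrier W" "c = q f" using q_surj[OF c] by auto
  have "P (q f)" using f(1)
  proof (induction f rule: W_induct)
    case zero
    then show ?case using z by (simp add: q_zero)
  next
    case (step x a f)
    then show ?case using assms(3)[of x a "q f"]
      by (simp add: q_simps q_single single_closed)
  qed
  then show ?thesis using f by simp
qed

text \<open>Every element of \<open>C\<close> can be written with at most one term per coset of
  j(U(A)), and then the functionals read off its coefficients. If only the trivial coset can
  contribute, a single monomial at some \<open>j x\<close> remains, and this is the image of an
  element of \<open>A\<close>.\<close>

lemma emb_if_lam_zero:
  assumes f: "f \<in> carrier W"
    and zero: "\<And>\<gamma>. \<gamma> \<in> carrier \<Gamma> \<Longrightarrow> \<gamma> \<notin> j ` Units A \<Longrightarrow> lam \<gamma> f = \<zero>"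
  shows "q f \<in> emb ` carrier A"
proof -
  define cl where "cl \<gamma> = (\<lambda>x. j x \<otimes>\<^bsub>\<Gamma>\<^esub> \<gamma>) ` Units A" for \<gamma>
  \<comment> \<open>Chosen from the coset as a set, the representative depends on the coset
    alone.\<close>
  define rep where "rep \<gamma> = (SOME \<delta>. \<delta> \<in> cl \<gamma>)" for \<gamma>
  have rep_cl: "rep \<gamma> \<in> cl \<gamma>" for \<gamma>
    unfolding rep_def by (rule someI[of _ "j \<one> \<otimes>\<^bsub>\<Gamma>\<^esub> \<gamma>"]) (auto simp: cl_def)
  have cl_sub: "cl (j x \<otimes>\<^bsub>\<Gamma>\<^esub> \<gamma>) \<subseteq> cl \<gamma>" if "x \<in> Units A" "\<gamma> \<in> carrier \<Gamma>" for x \<gamma>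
  proof
    fix \<delta> assume "\<delta> \<in> cl (j x \<otimes>\<^bsub>\<Gamma>\<^esub> \<gamma>)"
    then obtain y where y: "y \<in> Units A" "\<delta> = j y \<otimes>\<^bsub>\<Gamma>\<^esub> (j x \<otimes>\<^bsub>\<Gamma>\<^esub> \<gamma>)" by (auto simp: cl_def)
    then have "\<delta> = j (y \<otimes> x) \<otimes>\<^bsub>\<Gamma>\<^esub> \<gamma>" using that by (simp add: j_mult j_closed \<Gamma>.m_assoc)
    then show "\<delta> \<in> cl \<gamma>" using y that by (auto simp: cl_def)
  qed
  have cancel: "\<gamma> = j (inv x) \<otimes>\<^bsub>\<Gamma>\<^esub> (j x \<otimes>\<^bsub>\<Gamma>\<^esub> \<gamma>)" if "x \<in> Units A" "\<gamma> \<in> carrier \<Gamma>" for x \<gamma>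
    using j_mult[of "inv x" x] that by (simp add: j_closed j_one flip: \<Gamma>.m_assoc)
  have cl_eq: "cl (j x \<otimes>\<^bsub>\<Gamma>\<^esub> \<gamma>) = cl \<gamma>" if "x \<in> Units A" "\<gamma> \<in> carrier \<Gamma>" for x \<gamma>
    using cl_sub[OF that] cl_sub[of "inv x" "j x \<otimes>\<^bsub>\<Gamma>\<^esub> \<gamma>"] cancel[OF that] that by (simp add: j_closed)
  have rep_eq: "rep (j x \<otimes>\<^bsub>\<Gamma>\<^esub> \<gamma>) = rep \<gamma>" if "x \<in> Units A" "\<gamma> \<in> carrier \<Gamma>" for x \<gamma>
    unfolding rep_def cl_eq[OF that] ..
  have rep_dec: "\<exists>x\<in>Units A. \<gamma> = j x \<otimes>\<^bsub>\<Gamma>\<^esub> rep \<gamma>" if \<gamma>: "\<gamma> \<in> carrier \<Gamma>" for \<gamma>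
  proof -
    obtain x where x: "x \<in> Units A" "rep \<gamma> = j x \<otimes>\<^bsub>\<Gamma>\<^esub> \<gamma>" using rep_cl[of \<gamma>] by (auto simp: cl_def)
    then show ?thesis using cancel[OF x(1) \<gamma>] by (intro bexI[of _ "inv x"]) simp_all
  qed
  have rep_closed: "rep \<gamma> \<in> carrier \<Gamma>" if "\<gamma> \<in> carrier \<Gamma>" for \<gamma>
    using rep_cl[of \<gamma>] that by (auto simp: cl_def j_closed)
  have rep_rep: "rep (rep \<gamma>) = rep \<gamma>" if "\<gamma> \<in> carrier \<Gamma>" for \<gamma>
    using rep_dec[OF that] rep_eq rep_closed[OF that] by metis
  \<comment> \<open>Each monomial is carried to the representative \<rho> of its coset by a
    j(x)\<rho> = ax\<rho> in \<open>C\<close>.\<close>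
  have "\<exists>g\<in>carrier W. q f = q g \<and> (\<forall>\<gamma>. g \<gamma> \<noteq> \<zero> \<longrightarrow> rep \<gamma> = \<gamma>)"
    using f
  proof (induction f rule: W_induct)
    case zero
    have "\<forall>\<gamma>. \<zero>\<^bsub>W\<^esub> \<gamma> \<noteq> \<zero> \<longrightarrow> rep \<gamma> = \<gamma>" by (simp add: W_zero)
    then show ?case using W.zero_closed by blast
  next
    case (step \<gamma> a f)
    then obtain g where g: "g \<in> carrier W" "q f = q g" "\<And>\<gamma>. g \<gamma> \<noteq> \<zero> \<Longrightarrow> rep \<gamma> = \<gamma>" by blast
    obtain x where x: "x \<in> Units A" "\<gamma> = j x \<otimes>\<^bsub>\<Gamma>\<^esub> rep \<gamma>" using rep_dec[OF step(1)] by auto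
    have "q (tsingle A \<gamma> a) = emb a \<otimes>\<^bsub>C\<^esub> v (j x \<otimes>\<^bsub>\<Gamma>\<^esub> rep \<gamma>)" using q_single step(1,2) x(2) by simp
    also have "\<dots> = emb (a \<otimes> x) \<otimes>\<^bsub>C\<^esub> v (rep \<gamma>)"
      using x(1) step(1,2) rep_closed
      by (simp add: v_mult j_closed v_j emb_simps Units_closed C.m_assoc emb_closed v_closed)
    also have "\<dots> = q (tsingle A (rep \<gamma>) (a \<otimes> x))"
      using x(1) step(1,2) rep_closed by (simp add: q_single Units_closed)
    finally have e: "q (tsingle A \<gamma> a) = q (tsingle A (rep \<gamma>) (a \<otimes> x))" .
    have s: "tsingle A (rep \<gamma>) (a \<otimes> x) \<in> carrier W"
      using x(1) step(1,2) rep_closed by (simp add: single_closed Units_closed)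
    have "q (tsingle A \<gamma> a \<oplus>\<^bsub>W\<^esub> f) = q (tsingle A (rep \<gamma>) (a \<otimes> x) \<oplus>\<^bsub>W\<^esub> g)"
      using step g(1,2) e s by (simp add: q_simps single_closed)
    moreover have "\<forall>\<delta>. (tsingle A (rep \<gamma>) (a \<otimes> x) \<oplus>\<^bsub>W\<^esub> g) \<delta> \<noteq> \<zero> \<longrightarrow> rep \<delta> = \<delta>"
      using rep_rep[OF step(1)] g(3) W_closed[OF g(1)] by (auto simp: W_add tsingle_def split: if_splits)
    ultimately show ?case using s g(1) W_add_closed by blast
  qed
  then obtain g where g: "g \<in> carrier W" "q f = q g" "\<And>\<gamma>. g \<gamma> \<noteq> \<zero> \<Longrightarrow> rep \<gamma> = \<gamma>" by blast
  have lam_g: "lam \<gamma> g = g \<gamma>" if \<gamma>: "\<gamma> \<in> carrier \<Gamma>" "rep \<gamma> = \<gamma>" for \<gamma>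
  proof -
    have "lam \<gamma> g = (\<Oplus>x\<in>{\<one>}. g (j x \<otimes>\<^bsub>\<Gamma>\<^esub> \<gamma>) \<otimes> x)"
    proof (rule lam_over[OF g(1)])
      fix x assume x: "x \<in> Units A" "g (j x \<otimes>\<^bsub>\<Gamma>\<^esub> \<gamma>) \<noteq> \<zero>"
      then have "j x \<otimes>\<^bsub>\<Gamma>\<^esub> \<gamma> = \<gamma>" using g(3) rep_eq[OF x(1) \<gamma>(1)] \<gamma>(2) by metis
      then have "j x = j \<one>" using j_closed[OF x(1)] \<gamma>(1) by (simp add: j_one \<Gamma>.l_cancel_one)
      then show "x \<in> {\<one>}" using inj_onD[OF j_inj _ x(1)] by simp
    qed auto
    then show ?thesis using \<gamma> W_closed[OF g(1)] by (simp add: j_one)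
  qed
  \<comment> \<open>The representative of the trivial coset need not be the neutral element; it is
    j(x) for some unit x, which is absorbed into the coefficient at the end.\<close>
  obtain x where x: "x \<in> Units A" "rep \<one>\<^bsub>\<Gamma>\<^esub> = j x"
    using rep_cl[of "\<one>\<^bsub>\<Gamma>\<^esub>"] by (auto simp: cl_def j_closed)
  have "g \<gamma> = tsingle A (j x) (g (j x)) \<gamma>" for \<gamma>
  proof (cases "g \<gamma> = \<zero> \<or> \<gamma> = j x")
    case False
    have \<gamma>: "\<gamma> \<in> carrier \<Gamma>" "rep \<gamma> = \<gamma>" using False g(3) W_outside[OF g(1)] by blast+
    have "lam \<gamma> f \<noteq> \<zero>" using lam_cong[OF f g(1,2) \<gamma>(1)] lam_g[OF \<gamma>] False by simp
    then obtain y where y: "y \<in> Units A" "\<gamma> = j y" using zero[OF \<gamma>(1)] by auto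
    have "rep \<gamma> = rep \<one>\<^bsub>\<Gamma>\<^esub>" using rep_eq[OF y(1) \<Gamma>.one_closed] y by (simp add: j_closed)
    then show ?thesis using \<gamma>(2) x(2) False by simp
  qed (auto simp: tsingle_def)
  then have "g = tsingle A (j x) (g (j x))" by blast
  then have "q f = emb (g (j x)) \<otimes>\<^bsub>C\<^esub> v (j x)"
    using g(2) q_single[OF j_closed[OF x(1)] W_closed[OF g(1)]] by metis
  also have "\<dots> = emb (g (j x) \<otimes> x)"
    using x(1) W_closed[OF g(1)] by (simp add: v_j emb_simps Units_closed)
  finally show ?thesis using x(1) W_closed[OF g(1)] by (auto simp: Units_closed)
qed

text \<open>A central element commutes with \<open>emb t\<close>, so its coefficient l at \<gamma>
  satisfies t l = l \<theta>_\<gamma>(t) for t in \<open>A\<close>. For \<gamma> outside j(U(A)) the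
  Galois sums give l = \<Sum> x_i y_i l = l \<Sum> x_i \<theta>_\<gamma>(y_i) = 0, so the element
  comes from \<open>A\<close>. Commuting with \<open>A\<close> puts it into \<open>T\<close>, and
  commuting with every \<open>v \<gamma>\<close> makes it fixed by \<Gamma>.\<close>

lemma center_crossed_product:
  assumes T: "T = ring_center A"
    and gal: "\<And>\<gamma>. \<gamma> \<in> carrier \<Gamma> \<Longrightarrow> \<gamma> \<notin> j ` Units A \<Longrightarrow>
      \<exists>(n::nat) x y. (\<forall>i<n. x i \<in> T \<and> y i \<in> T) \<and> (\<Oplus>i\<in>{..<n}. x i \<otimes> y i) = \<one>
        \<and> (\<Oplus>i\<in>{..<n}. x i \<otimes> \<theta> \<gamma> (y i)) = \<zero>"
    and S: "S = {t \<in> T. \<forall>\<gamma>\<in>carrier \<Gamma>. \<theta> \<gamma> t = t}"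
  shows "ring_center C = emb ` S"
proof (rule equalityI; rule subsetI)
  have Tc: "t \<in> carrier A" "\<And>a. a \<in> carrier A \<Longrightarrow> t \<otimes> a = a \<otimes> t" if "t \<in> T" for t
    using that unfolding T ring_center_def by blast+
  fix c assume "c \<in> emb ` S"
  then obtain s where s: "s \<in> S" "c = emb s" by auto
  have sT: "s \<in> T" and sfix: "\<And>\<gamma>. \<gamma> \<in> carrier \<Gamma> \<Longrightarrow> \<theta> \<gamma> s = s" using s S by auto
  have "emb s \<otimes>\<^bsub>C\<^esub> d = d \<otimes>\<^bsub>C\<^esub> emb s" if "d \<in> carrier C" for d
    using that
  proof (induction d rule: C_induct)
    case zero
    then show ?case using Tc(1)[OF sT] by (simp add: emb_closed)
  next
    case (step \<gamma> a d)
    have "emb s \<otimes>\<^bsub>C\<^esub> (emb a \<otimes>\<^bsub>C\<^esub> v \<gamma>) = emb (s \<otimes> a) \<otimes>\<^bsub>C\<^esub> v \<gamma>"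
      using step(1,2) Tc(1)[OF sT] by (simp add: C.m_assoc emb_simps emb_closed v_closed)
    also have "\<dots> = emb a \<otimes>\<^bsub>C\<^esub> (emb s \<otimes>\<^bsub>C\<^esub> v \<gamma>)"
      using step(1,2) Tc(1)[OF sT] unfolding Tc(2)[OF sT step(2)] by (simp add: C.m_assoc emb_simps emb_closed v_closed)
    also have "\<dots> = emb a \<otimes>\<^bsub>C\<^esub> v \<gamma> \<otimes>\<^bsub>C\<^esub> emb s"
      using step(1,2) Tc(1)[OF sT] v_emb[OF step(1) Tc(1)[OF sT]] sfix[OF step(1)]
      by (simp add: C.m_assoc emb_closed v_closed)
    finally show ?case using step Tc(1)[OF sT] by (simp add: C.r_distr C.l_distr emb_closed v_closed)
  qed
  then show "c \<in> ring_center C"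
    unfolding ring_center_def s(2) using emb_closed[OF Tc(1)[OF sT]] by blast
next
  have Tc: "t \<in> carrier A" "\<And>a. a \<in> carrier A \<Longrightarrow> t \<otimes> a = a \<otimes> t" if "t \<in> T" for t
    using that unfolding T ring_center_def by blast+
  fix c assume c: "c \<in> ring_center C"
  then have cC: "c \<in> carrier C" and comm: "\<And>d. d \<in> carrier C \<Longrightarrow> c \<otimes>\<^bsub>C\<^esub> d = d \<otimes>\<^bsub>C\<^esub> c"
    unfolding ring_center_def by blast+
  obtain f where f: "f \<in> carrier W" "c = q f" using q_surj[OF cC] by auto
  have lam_t: "t \<otimes> lam \<gamma> f = lam \<gamma> f \<otimes> \<theta> \<gamma> t" if t: "t \<in> carrier A" and \<gamma>: "\<gamma> \<in> carrier \<Gamma>" for t \<gamma>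
  proof -
    let ?t = "tsingle A \<one>\<^bsub>\<Gamma>\<^esub> t"
    have tW: "?t \<in> carrier W" using t by (simp add: single_closed)
    have "q (?t \<otimes>\<^bsub>W\<^esub> f) = q (f \<otimes>\<^bsub>W\<^esub> ?t)"
      using comm[OF emb_closed[OF t]] f tW by (simp add: q_simps emb_q)
    then have "lam \<gamma> (?t \<otimes>\<^bsub>W\<^esub> f) = lam \<gamma> (f \<otimes>\<^bsub>W\<^esub> ?t)"
      by (rule lam_cong[OF W.m_closed[OF tW f(1)] W.m_closed[OF f(1) tW] _ \<gamma>])
    then show ?thesis
      using lam_left[OF f(1) \<Gamma>.one_closed t \<gamma>] lam_right[OF f(1) \<Gamma>.one_closed t \<gamma>] \<gamma> f
      by (simp add: \<theta>_id lam_closed)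
  qed
  have "c \<in> emb ` carrier A"
    unfolding f(2)
  proof (rule emb_if_lam_zero[OF f(1)])
    fix \<gamma> assume \<gamma>: "\<gamma> \<in> carrier \<Gamma>" "\<gamma> \<notin> j ` Units A"
    obtain n :: nat and x y where xy: "\<And>i. i < n \<Longrightarrow> x i \<in> T \<and> y i \<in> T"
      and one: "(\<Oplus>i\<in>{..<n}. x i \<otimes> y i) = \<one>" and zero: "(\<Oplus>i\<in>{..<n}. x i \<otimes> \<theta> \<gamma> (y i)) = \<zero>"
      using gal[OF \<gamma>] by blast
    have xc: "x i \<in> carrier A" and yc: "y i \<in> carrier A" if "i < n" for i using xy[OF that] Tc by auto
    let ?l = "lam \<gamma> f"
    have l: "?l \<in> carrier A" using lam_closed[OF f(1)] .
    have "?l = (\<Oplus>i\<in>{..<n}. x i \<otimes> y i) \<otimes> ?l" using one l by simp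
    also have "\<dots> = (\<Oplus>i\<in>{..<n}. x i \<otimes> y i \<otimes> ?l)"
      using l xc yc by (intro finsum_ldistr) auto
    also have "\<dots> = (\<Oplus>i\<in>{..<n}. ?l \<otimes> (x i \<otimes> \<theta> \<gamma> (y i)))"
    proof (rule finsum_cong')
      fix i assume "i \<in> {..<n}"
      then have i: "i < n" by simp
      \<comment> \<open>\<open>y i\<close> crosses the coefficient by the twisted rule and picks up
        \<open>\<theta> \<gamma>\<close>; \<open>x i\<close> crosses it unchanged, being central in
        \<open>A\<close>.\<close>
      have "x i \<otimes> y i \<otimes> ?l = x i \<otimes> (?l \<otimes> \<theta> \<gamma> (y i))"
        using l xc[OF i] yc[OF i] lam_t[OF yc[OF i] \<gamma>(1)] by (simp add: m_assoc)
      also have "\<dots> = (x i \<otimes> ?l) \<otimes> \<theta> \<gamma> (y i)"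
        using l xc[OF i] yc[OF i] \<gamma>(1) by (simp add: m_assoc \<theta>_simps)
      also have "x i \<otimes> ?l = ?l \<otimes> x i" using xy[OF i] Tc(2) l by blast
      finally show "x i \<otimes> y i \<otimes> ?l = ?l \<otimes> (x i \<otimes> \<theta> \<gamma> (y i))"
        using l xc[OF i] yc[OF i] \<gamma>(1) by (simp add: m_assoc \<theta>_simps)
    next
      show "(\<lambda>i. ?l \<otimes> (x i \<otimes> \<theta> \<gamma> (y i))) \<in> {..<n} \<rightarrow> carrier A"
        using l xc yc \<gamma>(1) by (simp add: \<theta>_simps)
    qed (rule refl)
    also have "\<dots> = ?l \<otimes> (\<Oplus>i\<in>{..<n}. x i \<otimes> \<theta> \<gamma> (y i))"
      using l xc yc \<gamma>(1) by (intro finsum_rdistr[symmetric]) (auto simp: \<theta>_simps)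
    finally have "?l = ?l \<otimes> \<zero>" unfolding zero .
    then show "?l = \<zero>" using r_null[OF l] by (rule trans)
  qed
  then obtain a where a: "a \<in> carrier A" "c = emb a" by auto
  have "a \<otimes> b = b \<otimes> a" if b: "b \<in> carrier A" for b
    using comm[OF emb_closed[OF b]] a b inj_onD[OF emb_inj, of "a \<otimes> b" "b \<otimes> a"] by (simp add: emb_simps)
  then have aT: "a \<in> T" using a(1) unfolding T ring_center_def by blast
  have "\<theta> \<gamma> a = a" if \<gamma>: "\<gamma> \<in> carrier \<Gamma>" for \<gamma>
  proof -
    have "emb (\<theta> \<gamma> a) \<otimes>\<^bsub>C\<^esub> v \<gamma> = emb a \<otimes>\<^bsub>C\<^esub> v \<gamma>"
      using comm[OF v_closed[OF \<gamma>]] v_emb[OF \<gamma> a(1)] a(2) by simp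
    then have "emb (\<theta> \<gamma> a) = emb a"
      using v_unit[OF \<gamma>] a(1) \<gamma> by (metis C.Units_inv_closed C.Units_r_inv C.m_assoc C.r_one emb_closed \<theta>_simps(1) v_closed)
    then show ?thesis using inj_onD[OF emb_inj] a(1) \<gamma> by (simp add: \<theta>_simps)
  qed
  then show "c \<in> emb ` S" using a aT S by blast
qed

text \<open>Transport of coefficients along a bijection of \<Gamma> whose inverse is
  \<open>d\<close>. Composing with \<open>d\<close> gives a pointwise formula, with no sum over
  fibres.\<close>

definition push where
  "push \<alpha> d f = (\<lambda>z. if z \<in> carrier \<Gamma> then \<alpha> (f (d z)) else \<zero>)"

text \<open>Functoriality of the crossed product: since \<alpha> and \<open>c\<close> are compatible
  with \<open>j\<close> and with the action, the relation for y goes to the relation for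
  \<alpha>(y). Only an endomorphism is produced here; bijectivity comes later from the same
  statement for the inverse pair.\<close>

lemma induced_endo:
  assumes \<alpha>: "\<alpha> \<in> ring_aut A"
    and c_closed: "\<And>\<gamma>. \<gamma> \<in> carrier \<Gamma> \<Longrightarrow> c \<gamma> \<in> carrier \<Gamma>"
    and d_closed: "\<And>\<gamma>. \<gamma> \<in> carrier \<Gamma> \<Longrightarrow> d \<gamma> \<in> carrier \<Gamma>"
    and cd: "\<And>\<gamma>. \<gamma> \<in> carrier \<Gamma> \<Longrightarrow> c (d \<gamma>) = \<gamma>"
    and dc: "\<And>\<gamma>. \<gamma> \<in> carrier \<Gamma> \<Longrightarrow> d (c \<gamma>) = \<gamma>"
    and c_mult: "\<And>\<gamma> \<delta>. \<gamma> \<in> carrier \<Gamma> \<Longrightarrow> \<delta> \<in> carrier \<Gamma> \<Longrightarrow> c (\<gamma> \<otimes>\<^bsub>\<Gamma>\<^esub> \<delta>) = c \<gamma> \<otimes>\<^bsub>\<Gamma>\<^esub> c \<delta>"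
    and c_j: "\<And>y. y \<in> Units A \<Longrightarrow> c (j y) = j (\<alpha> y)"
    and c_\<theta>: "\<And>\<gamma> a. \<gamma> \<in> carrier \<Gamma> \<Longrightarrow> a \<in> carrier A \<Longrightarrow> \<theta> (c \<gamma>) (\<alpha> a) = \<alpha> (\<theta> \<gamma> a)"
  shows "\<exists>\<beta>\<in>ring_hom C C. \<beta> \<in> extensional (carrier C) \<and>
    (\<forall>\<gamma>\<in>carrier \<Gamma>. \<forall>a\<in>carrier A. \<beta> (emb a \<otimes>\<^bsub>C\<^esub> v \<gamma>) = emb (\<alpha> a) \<otimes>\<^bsub>C\<^esub> v (c \<gamma>))"
proof -
  note \<alpha>_simps = ring_autD(4-7)[OF \<alpha>] ring_aut_zero[OF \<alpha>]
  let ?p = "push \<alpha> d"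
  have c1: "c \<one>\<^bsub>\<Gamma>\<^esub> = \<one>\<^bsub>\<Gamma>\<^esub>" using c_mult[of "\<one>\<^bsub>\<Gamma>\<^esub>" "\<one>\<^bsub>\<Gamma>\<^esub>"] c_closed[of "\<one>\<^bsub>\<Gamma>\<^esub>"]
    by (simp add: \<Gamma>.r_cancel_one')
  have p_closed: "?p f \<in> carrier W" if f: "f \<in> carrier W" for f
  proof (rule W_carrierI)
    have "{x. ?p f x \<noteq> \<zero>} \<subseteq> c ` {x. f x \<noteq> \<zero>}"
    proof
      fix z assume "z \<in> {x. ?p f x \<noteq> \<zero>}"
      then have "z \<in> carrier \<Gamma>" "f (d z) \<noteq> \<zero>" using \<alpha>_simps by (auto simp: push_def split: if_splits)
      then show "z \<in> c ` {x. f x \<noteq> \<zero>}" using cd by force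
    qed
    then show "finite {x. ?p f x \<noteq> \<zero>}" using W_finite[OF f] finite_surj by blast
  qed (auto simp: push_def \<alpha>_simps W_closed[OF f])
  have p_single: "?p (tsingle A \<gamma> a) = tsingle A (c \<gamma>) (\<alpha> a)" if \<gamma>: "\<gamma> \<in> carrier \<Gamma>" for \<gamma> a
  proof
    fix z
    have "d z = \<gamma> \<longleftrightarrow> z = c \<gamma>" if "z \<in> carrier \<Gamma>" using cd[OF that] dc[OF \<gamma>] by auto
    then show "?p (tsingle A \<gamma> a) z = tsingle A (c \<gamma>) (\<alpha> a) z"
      using c_closed[OF \<gamma>] by (auto simp: push_def tsingle_def \<alpha>_simps)
  qed
  have p_add: "?p (f \<oplus>\<^bsub>W\<^esub> g) = ?p f \<oplus>\<^bsub>W\<^esub> ?p g" if "f \<in> carrier W" "g \<in> carrier W" for f g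
    using that by (auto simp: push_def W_add \<alpha>_simps W_closed)
  have p_zero: "?p \<zero>\<^bsub>W\<^esub> = \<zero>\<^bsub>W\<^esub>" by (auto simp: push_def W_zero \<alpha>_simps)
  have p_single_mult: "?p (tsingle A \<gamma> a \<otimes>\<^bsub>W\<^esub> g) = ?p (tsingle A \<gamma> a) \<otimes>\<^bsub>W\<^esub> ?p g"
    if \<gamma>: "\<gamma> \<in> carrier \<Gamma>" and a: "a \<in> carrier A" and g: "g \<in> carrier W" for \<gamma> a g
    using g
  proof (induction g rule: W_induct)
    case zero
    then show ?case using \<gamma> a by (simp add: p_zero single_closed p_closed)
  next
    case (step \<delta> b g)
    then show ?case using \<gamma> a
      by (simp add: W.r_distr single_closed p_add p_closed single_single p_single \<alpha>_simps c_closed c_mult c_\<theta> \<theta>_simps)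
  qed
  have p_mult: "?p (f \<otimes>\<^bsub>W\<^esub> g) = ?p f \<otimes>\<^bsub>W\<^esub> ?p g" if f: "f \<in> carrier W" and g: "g \<in> carrier W" for f g
    using f
  proof (induction f rule: W_induct)
    case zero
    then show ?case using g by (simp add: p_zero p_closed)
  next
    case (step \<gamma> a f)
    then show ?case using g by (simp add: W.l_distr single_closed p_add p_closed p_single_mult)
  qed
  have p_hom: "?p \<in> ring_hom W W"
    by (rule ring_hom_memI) (use p_single[of "\<one>\<^bsub>\<Gamma>\<^esub>" \<one>] in \<open>simp_all add: p_closed p_mult p_add W_one c1 \<alpha>_simps\<close>)
  \<comment> \<open>The preimage of the ideal under the transport is an ideal containing the
    generators.\<close>
  have "I \<subseteq> {f \<in> carrier W. ?p f \<in> I}"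
  proof -
    interpret p: ring_hom_ring W W ?p
      using p_hom W_ring by (simp add: ring_hom_ringI2)
    have gens: "tsingle A \<one>\<^bsub>\<Gamma>\<^esub> y \<ominus>\<^bsub>W\<^esub> tsingle A (j y) \<one> \<in> {f \<in> carrier W. ?p f \<in> I}"
      if y: "y \<in> Units A" for y
    proof -
      have "?p (tsingle A \<one>\<^bsub>\<Gamma>\<^esub> y \<ominus>\<^bsub>W\<^esub> tsingle A (j y) \<one>)
          = tsingle A \<one>\<^bsub>\<Gamma>\<^esub> (\<alpha> y) \<ominus>\<^bsub>W\<^esub> tsingle A (j (\<alpha> y)) \<one>"
        using y by (simp add: W.minus_eq single_closed Units_closed j_closed p_single c1 c_j \<alpha>_simps)
      then show ?thesis using gen_in_I[OF ring_aut_unit(1)[OF ring_axioms \<alpha> y]] gen_closed[OF y] by simp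
    qed
    show ?thesis
      by (subst cp_ideal_def, rule W.genideal_minimal[OF p.ideal_vimage[OF I_ideal]]) (use gens in blast)
  qed
  then have p_I: "?p f \<in> I" if "f \<in> I" for f using that by blast
  have p_cong: "q (?p f) = q (?p g)" if "f \<in> carrier W" "g \<in> carrier W" "q f = q g" for f g
  proof -
    have "f \<ominus>\<^bsub>W\<^esub> g \<in> I" using that q_eq_iff by blast
    then have i: "?p (f \<ominus>\<^bsub>W\<^esub> g) \<in> I" by (rule p_I)
    have "f = (f \<ominus>\<^bsub>W\<^esub> g) \<oplus>\<^bsub>W\<^esub> g" using that by (simp add: W.minus_eq W.a_assoc W.l_neg)
    then have "?p f = ?p (f \<ominus>\<^bsub>W\<^esub> g) \<oplus>\<^bsub>W\<^esub> ?p g" using p_add[of "f \<ominus>\<^bsub>W\<^esub> g" g] that by simp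
    then have "?p f \<ominus>\<^bsub>W\<^esub> ?p g = ?p (f \<ominus>\<^bsub>W\<^esub> g)"
      using that p_closed by (simp add: W.minus_eq W.a_assoc W.r_neg)
    then show ?thesis using i q_eq_iff p_closed that by simp
  qed
  \<comment> \<open>The value on a coset is taken through a chosen representative;
    \<open>p_cong\<close> makes the choice irrelevant.\<close>
  define \<beta> where "\<beta> = restrict (\<lambda>c. q (?p (SOME f. f \<in> carrier W \<and> q f = c))) (carrier C)"
  have \<beta>_q: "\<beta> (q f) = q (?p f)" if f: "f \<in> carrier W" for f
  proof -
    have "(SOME g. g \<in> carrier W \<and> q g = q f) \<in> carrier W \<and> q (SOME g. g \<in> carrier W \<and> q g = q f) = q f"
      by (rule someI[of _ f]) (use f in simp)
    then have "q (?p (SOME g. g \<in> carrier W \<and> q g = q f)) = q (?p f)"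
      using p_cong[OF _ f] by blast
    then show ?thesis unfolding \<beta>_def using q_simps(1)[OF f] by simp
  qed
  have "\<beta> \<in> ring_hom C C"
  proof (rule ring_hom_memI)
    fix x y assume "x \<in> carrier C" "y \<in> carrier C"
    then obtain f g where fg: "f \<in> carrier W" "x = q f" "g \<in> carrier W" "y = q g" using q_surj by metis
    show "\<beta> x \<in> carrier C" using fg \<beta>_q p_closed q_simps(1) by simp
    show "\<beta> (x \<otimes>\<^bsub>C\<^esub> y) = \<beta> x \<otimes>\<^bsub>C\<^esub> \<beta> y"
      using fg \<beta>_q[of "f \<otimes>\<^bsub>W\<^esub> g"] by (simp add: q_simps \<beta>_q p_mult p_closed)
    show "\<beta> (x \<oplus>\<^bsub>C\<^esub> y) = \<beta> x \<oplus>\<^bsub>C\<^esub> \<beta> y"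
      using fg \<beta>_q[of "f \<oplus>\<^bsub>W\<^esub> g"] by (simp add: q_simps \<beta>_q p_add p_closed)
  next
    show "\<beta> \<one>\<^bsub>C\<^esub> = \<one>\<^bsub>C\<^esub>" using \<beta>_q[OF W.one_closed] ring_hom_one[OF p_hom] q_simps(4) by simp
  qed
  moreover have "\<beta> (emb a \<otimes>\<^bsub>C\<^esub> v \<gamma>) = emb (\<alpha> a) \<otimes>\<^bsub>C\<^esub> v (c \<gamma>)" if "\<gamma> \<in> carrier \<Gamma>" "a \<in> carrier A" for \<gamma> a
    using \<beta>_q[OF single_closed[OF that]] that by (simp add: q_single p_single c_closed \<alpha>_simps)
  moreover have "\<beta> \<in> extensional (carrier C)" by (simp add: \<beta>_def)
  ultimately show ?thesis by blast
qed

lemma C_hom_eqI: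
  assumes \<beta>: "\<beta> \<in> ring_hom C C" and \<beta>': "\<beta>' \<in> ring_hom C C"
    and e: "\<And>\<gamma> a. \<gamma> \<in> carrier \<Gamma> \<Longrightarrow> a \<in> carrier A \<Longrightarrow> \<beta> (emb a \<otimes>\<^bsub>C\<^esub> v \<gamma>) = \<beta>' (emb a \<otimes>\<^bsub>C\<^esub> v \<gamma>)"
    and c: "c \<in> carrier C"
  shows "\<beta> c = \<beta>' c"
  using c
proof (induction c rule: C_induct)
  case zero
  then show ?case using ring_hom_zero[OF \<beta>] ring_hom_zero[OF \<beta>'] C.ring_axioms by simp
next
  case (step \<gamma> a c)
  then show ?case
    using e ring_hom_add[OF \<beta>, of "emb a \<otimes>\<^bsub>C\<^esub> v \<gamma>" c] ring_hom_add[OF \<beta>', of "emb a \<otimes>\<^bsub>C\<^esub> v \<gamma>" c]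
    by (simp add: emb_closed v_closed)
qed

end

section \<open>Teichmueller classes as cohomology classes\<close>

context ring begin

section \<open>The center of a ring under inverses and automorphisms\<close>

lemma ring_centerD: "z \<in> ring_center R \<Longrightarrow> z \<in> carrier R"
  "z \<in> ring_center R \<Longrightarrow> x \<in> carrier R \<Longrightarrow> z \<otimes> x = x \<otimes> z"
  unfolding ring_center_def by blast+

lemma ring_center_inv:
  assumes z: "z \<in> ring_center R" "z \<in> Units R"
  shows "inv z \<in> ring_center R"
proof -
  have "inv z \<otimes> x = x \<otimes> inv z" if x: "x \<in> carrier R" for x
  proof -
    have "inv z \<otimes> x = inv z \<otimes> (x \<otimes> z) \<otimes> inv z"
      using x z(2) by (simp add: m_assoc Units_closed)
    also have "\<dots> = inv z \<otimes> (z \<otimes> x) \<otimes> inv z" using ring_centerD(2)[OF z(1) x] by simp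
    also have "\<dots> = x \<otimes> inv z" using x z(2) by (simp add: Units_closed flip: m_assoc)
    finally show ?thesis .
  qed
  then show ?thesis using z(2) unfolding ring_center_def by blast
qed

lemma ring_aut_center:
  assumes \<phi>: "\<phi> \<in> ring_aut R" and z: "z \<in> ring_center R"
  shows "\<phi> z \<in> ring_center R"
proof -
  have "\<phi> z \<otimes> y = y \<otimes> \<phi> z" if y: "y \<in> carrier R" for y
  proof -
    obtain x where x: "x \<in> carrier R" "\<phi> x = y" using ring_aut_surj[OF \<phi> y] .
    then show ?thesis
      using ring_autD(5)[OF \<phi> ring_centerD(1)[OF z] x(1)] ring_autD(5)[OF \<phi> x(1) ring_centerD(1)[OF z]]
        ring_centerD(2)[OF z x(1)] by simp
  qed
  then show ?thesis using ring_autD(4)[OF \<phi> ring_centerD(1)[OF z]] unfolding ring_center_def by blast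
qed

lemma inv_cancel:
  "u \<in> Units R \<Longrightarrow> x \<in> carrier R \<Longrightarrow> inv u \<otimes> (u \<otimes> x) = x"
  "u \<in> Units R \<Longrightarrow> x \<in> carrier R \<Longrightarrow> u \<otimes> (inv u \<otimes> x) = x"
  by (simp_all add: Units_closed flip: m_assoc)

text \<open>The choices that witness membership in a Teichmueller class, separated from the normal
  structure so that section, units and cocycle can be varied one at a time.\<close>

definition teich_data ::
  "('g, 'c) monoid_scheme \<Rightarrow> ('g \<Rightarrow> 'a \<Rightarrow> 'a) \<Rightarrow> ('g \<times> 'g \<Rightarrow> 'a) \<Rightarrow> ('g \<times> 'g \<times> 'g \<Rightarrow> 'a) \<Rightarrow> bool" where
  "teich_data G \<alpha> u f \<longleftrightarrow>
     (\<forall>a \<in> carrier G. \<forall>b \<in> carrier G. u (a, b) \<in> Units R \<and>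
        (\<forall>x \<in> carrier R. \<alpha> a (\<alpha> b x) = u (a, b) \<otimes> \<alpha> (a \<otimes>\<^bsub>G\<^esub> b) x \<otimes> inv (u (a, b)))) \<and>
     (\<forall>a \<in> carrier G. \<forall>b \<in> carrier G. \<forall>c \<in> carrier G.
        \<alpha> a (u (b, c)) \<otimes> u (a, b \<otimes>\<^bsub>G\<^esub> c) = f (a, b, c) \<otimes> u (a, b) \<otimes> u (a \<otimes>\<^bsub>G\<^esub> b, c))"

lemma teich_class_alt:
  "teich_class R G \<tau> = {f \<in> triples G \<rightarrow>\<^sub>E carrier R. \<exists>\<alpha> u. (\<forall>g \<in> carrier G. \<alpha> g \<in> \<tau> g) \<and> teich_data G \<alpha> u f}"
  unfolding teich_class_def teich_data_def by simp

lemma teich_dataD: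
  assumes "teich_data G \<alpha> u f" "a \<in> carrier G" "b \<in> carrier G"
  shows "u (a, b) \<in> Units R"
    "x \<in> carrier R \<Longrightarrow> \<alpha> a (\<alpha> b x) = u (a, b) \<otimes> \<alpha> (a \<otimes>\<^bsub>G\<^esub> b) x \<otimes> inv (u (a, b))"
    "c \<in> carrier G \<Longrightarrow> \<alpha> a (u (b, c)) \<otimes> u (a, b \<otimes>\<^bsub>G\<^esub> c) = f (a, b, c) \<otimes> u (a, b) \<otimes> u (a \<otimes>\<^bsub>G\<^esub> b, c)"
  using assms unfolding teich_data_def by blast+

text \<open>Replacing \<alpha>_a by \<partial>(w_a)\<alpha>_a is matched by multiplying out (w_a
  \<alpha>_a)(w_b \<alpha>_b), which gives the displayed units. The obstruction stays literally the
  same because it is central.\<close>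

lemma teich_data_change_section:
  assumes G: "group G" and d: "teich_data G \<alpha> u f"
    and \<alpha>: "\<And>g. g \<in> carrier G \<Longrightarrow> \<alpha> g \<in> ring_aut R"
    and w: "\<And>g. g \<in> carrier G \<Longrightarrow> w g \<in> Units R"
    and \<alpha>': "\<And>g x. g \<in> carrier G \<Longrightarrow> x \<in> carrier R \<Longrightarrow> \<alpha>' g x = w g \<otimes> \<alpha> g x \<otimes> inv (w g)"
    and f: "\<And>a b c. a \<in> carrier G \<Longrightarrow> b \<in> carrier G \<Longrightarrow> c \<in> carrier G \<Longrightarrow> f (a, b, c) \<in> ring_center R"
  shows "teich_data G \<alpha>' (\<lambda>(a, b). w a \<otimes> \<alpha> a (w b) \<otimes> u (a, b) \<otimes> inv (w (a \<otimes>\<^bsub>G\<^esub> b))) f"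
proof -
  interpret G: group G by fact
  have wc: "w a \<in> carrier R" if "a \<in> carrier G" for a using w[OF that] by auto
  note \<alpha>c = ring_autD(4)[OF \<alpha>] and \<alpha>m = ring_autD(5)[OF \<alpha>] and \<alpha>u = ring_aut_unit[OF ring_axioms \<alpha>]
  note u = teich_dataD(1)[OF d]
  show ?thesis
    unfolding teich_data_def
  proof (intro conjI ballI, goal_cases)
    case (1 a b)
    then show ?case using w u \<alpha>u by simp
  next
    case (2 a b x)
    then show ?case
      using w u wc \<alpha>u(1)[OF _ w]
      by (simp add: \<alpha>' \<alpha>m \<alpha>c teich_dataD(2)[OF d] m_assoc inv_mult_units inv_cancel \<alpha>u Units_closed)
  next
    case (3 a b c)
    let ?ab = "a \<otimes>\<^bsub>G\<^esub> b" and ?bc = "b \<otimes>\<^bsub>G\<^esub> c" and ?abc = "a \<otimes>\<^bsub>G\<^esub> (b \<otimes>\<^bsub>G\<^esub> c)"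
    have cl: "?ab \<in> carrier G" "?bc \<in> carrier G" "?abc \<in> carrier G" using 3 by auto
    have ass: "?ab \<otimes>\<^bsub>G\<^esub> c = ?abc" using 3 by (simp add: G.m_assoc)
    note uu = u[OF 3(1,2)] u[OF 3(2,3)] u[OF 3(1) cl(2)] u[OF cl(1) 3(3)]
    note ww = w[OF 3(1)] w[OF 3(2)] w[OF 3(3)] w[OF cl(1)] w[OF cl(2)] w[OF cl(3)]
    note fc = f[OF 3]
    have wb: "\<alpha> a (w b) \<in> Units R" "\<alpha> a (w ?bc) \<in> Units R" "\<alpha> ?ab (w c) \<in> Units R" "\<alpha> a (u (b, c)) \<in> Units R"
      using \<alpha>u(1) 3 cl w u by auto
    have "\<alpha>' a (w b \<otimes> \<alpha> b (w c) \<otimes> u (b, c) \<otimes> inv (w ?bc)) \<otimes> (w a \<otimes> \<alpha> a (w ?bc) \<otimes> u (a, ?bc) \<otimes> inv (w ?abc))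
      = w a \<otimes> \<alpha> a (w b) \<otimes> \<alpha> a (\<alpha> b (w c)) \<otimes> (\<alpha> a (u (b, c)) \<otimes> u (a, ?bc)) \<otimes> inv (w ?abc)"
      using uu ww wb 3 cl
      by (simp add: \<alpha>' \<alpha>m \<alpha>c m_assoc inv_cancel Units_closed \<alpha>u(2)[OF 3(1) w[OF cl(2)], symmetric])
    also have "\<dots> = w a \<otimes> \<alpha> a (w b) \<otimes> u (a, b) \<otimes> \<alpha> ?ab (w c) \<otimes> inv (u (a, b)) \<otimes> (f (a, b, c) \<otimes> (u (a, b) \<otimes> u (?ab, c))) \<otimes> inv (w ?abc)"
      unfolding teich_dataD(2)[OF d 3(1,2) Units_closed[OF ww(3)]] teich_dataD(3)[OF d 3]
      using uu ww wb ring_centerD(1)[OF fc] by (simp add: m_assoc Units_closed)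
    also have "\<dots> = w a \<otimes> \<alpha> a (w b) \<otimes> u (a, b) \<otimes> \<alpha> ?ab (w c) \<otimes> inv (u (a, b)) \<otimes> f (a, b, c) \<otimes> (u (a, b) \<otimes> u (?ab, c) \<otimes> inv (w ?abc))"
      using uu ww wb ring_centerD(1)[OF fc] by (simp add: m_assoc Units_closed)
    \<comment> \<open>Centrality of \<open>f\<close> moves it past the product that precedes
      it.\<close>
    also have "\<dots> = f (a, b, c) \<otimes> (w a \<otimes> \<alpha> a (w b) \<otimes> u (a, b) \<otimes> \<alpha> ?ab (w c) \<otimes> inv (u (a, b))) \<otimes> (u (a, b) \<otimes> u (?ab, c) \<otimes> inv (w ?abc))"
      using uu ww wb by (subst ring_centerD(2)[OF fc]) (simp_all add: Units_closed)
    also have "\<dots> = f (a, b, c) \<otimes> (w a \<otimes> \<alpha> a (w b) \<otimes> u (a, b) \<otimes> inv (w ?ab)) \<otimes> (w ?ab \<otimes> \<alpha> ?ab (w c) \<otimes> u (?ab, c) \<otimes> inv (w ?abc))"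
      using uu ww wb ring_centerD(1)[OF fc] by (simp add: m_assoc Units_closed inv_cancel)
    finally show ?case by (simp add: ass)
  qed
qed

text \<open>The computation behind \<open>teich_data_scale\<close>: p, q, r, s stand for the values
  of the rescaling cochain, p already acted upon, and p s^-1 q r^-1 is its coboundary. Only these
  four are central; the other factors are arbitrary.\<close>

lemma central_unit_shuffle:
  assumes c: "p \<in> ring_center R" "q \<in> ring_center R" "r \<in> ring_center R" "s \<in> ring_center R"
    and U: "r \<in> Units R" "s \<in> Units R"
    and k: "k \<in> carrier R" "l \<in> carrier R" "m \<in> carrier R" "n \<in> carrier R" "F \<in> carrier R"
    and e: "k \<otimes> l = F \<otimes> m \<otimes> n"
  shows "(p \<otimes> k) \<otimes> (q \<otimes> l) = (F \<otimes> (p \<otimes> inv s \<otimes> q \<otimes> inv r)) \<otimes> (r \<otimes> m) \<otimes> (s \<otimes> n)"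
proof -
  note pc = ring_centerD(1)[OF c(1)] ring_centerD(1)[OF c(2)] ring_centerD(1)[OF c(3)] ring_centerD(1)[OF c(4)]
  have si: "inv s \<in> ring_center R" using ring_center_inv[OF c(4) U(2)] .
  have "(p \<otimes> k) \<otimes> (q \<otimes> l) = p \<otimes> (k \<otimes> q) \<otimes> l" using pc k by (simp add: m_assoc)
  also have "\<dots> = p \<otimes> (q \<otimes> k) \<otimes> l" using ring_centerD(2)[OF c(2) k(1)] by simp
  also have "\<dots> = (p \<otimes> q) \<otimes> (F \<otimes> (m \<otimes> n))" using pc k e by (simp add: m_assoc)
  also have "\<dots> = p \<otimes> (q \<otimes> F) \<otimes> (m \<otimes> n)" using pc k by (simp add: m_assoc)
  also have "\<dots> = (p \<otimes> F) \<otimes> (q \<otimes> (m \<otimes> n))" using ring_centerD(2)[OF c(2) k(5)] pc k by (simp add: m_assoc)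
  also have "\<dots> = F \<otimes> p \<otimes> (q \<otimes> (m \<otimes> n))" using ring_centerD(2)[OF c(1) k(5)] by simp
  finally have L: "(p \<otimes> k) \<otimes> (q \<otimes> l) = F \<otimes> p \<otimes> (q \<otimes> (m \<otimes> n))" .
  have "(F \<otimes> (p \<otimes> inv s \<otimes> q \<otimes> inv r)) \<otimes> (r \<otimes> m) \<otimes> (s \<otimes> n) = F \<otimes> p \<otimes> (inv s \<otimes> (q \<otimes> m \<otimes> s)) \<otimes> n"
    using pc k U by (simp add: m_assoc inv_cancel)
  also have "q \<otimes> m \<otimes> s = s \<otimes> (q \<otimes> m)" using ring_centerD(2)[OF c(4), of "q \<otimes> m"] pc k by simp
  also have "F \<otimes> p \<otimes> (inv s \<otimes> (s \<otimes> (q \<otimes> m))) \<otimes> n = F \<otimes> p \<otimes> (q \<otimes> (m \<otimes> n))"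
    using pc k U by (simp add: m_assoc inv_cancel)
  finally show ?thesis using L by simp
qed

text \<open>With the section kept, a central factor in the units does not change the conjugations
  they induce; it multiplies the obstruction by the coboundary.\<close>

lemma teich_data_scale:
  assumes G: "group G" and d: "teich_data G \<alpha> u f"
    and \<alpha>: "\<And>g. g \<in> carrier G \<Longrightarrow> \<alpha> g \<in> ring_aut R"
    and z: "\<And>a b. a \<in> carrier G \<Longrightarrow> b \<in> carrier G \<Longrightarrow> z (a, b) \<in> Units R \<inter> ring_center R"
    and f: "\<And>a b c. a \<in> carrier G \<Longrightarrow> b \<in> carrier G \<Longrightarrow> c \<in> carrier G \<Longrightarrow> f (a, b, c) \<in> carrier R"
  shows "teich_data G \<alpha> (\<lambda>x. z x \<otimes> u x) (\<lambda>x. f x \<otimes> coboundary2 R G \<alpha> z x)"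
proof -
  interpret G: group G by fact
  note \<alpha>c = ring_autD(4)[OF \<alpha>] and \<alpha>m = ring_autD(5)[OF \<alpha>] and \<alpha>u = ring_aut_unit[OF ring_axioms \<alpha>]
  note u = teich_dataD(1)[OF d]
  have zU: "z (a, b) \<in> Units R" and zC: "z (a, b) \<in> ring_center R" and zc: "z (a, b) \<in> carrier R"
    if "a \<in> carrier G" "b \<in> carrier G" for a b using z[OF that] by (auto dest: ring_centerD(1))
  show ?thesis
    unfolding teich_data_def
  proof (intro conjI ballI, goal_cases)
    case (1 a b)
    then show ?case using zU u by simp
  next
    case (2 a b x)
    let ?z = "z (a, b)" and ?u = "u (a, b)"
    have ab: "a \<otimes>\<^bsub>G\<^esub> b \<in> carrier G" using 2 by simp
    let ?y = "?u \<otimes> \<alpha> (a \<otimes>\<^bsub>G\<^esub> b) x \<otimes> inv ?u"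
    have y: "?y \<in> carrier R" using u[OF 2(1,2)] \<alpha>c[OF ab 2(3)] by (simp add: Units_closed)
    have "(?z \<otimes> ?u) \<otimes> \<alpha> (a \<otimes>\<^bsub>G\<^esub> b) x \<otimes> inv (?z \<otimes> ?u) = ?z \<otimes> ?y \<otimes> inv ?z"
      using u[OF 2(1,2)] zU[OF 2(1,2)] \<alpha>c[OF ab 2(3)] by (simp add: inv_mult_units m_assoc Units_closed)
    also have "\<dots> = ?y" unfolding ring_centerD(2)[OF zC[OF 2(1,2)] y] using zU[OF 2(1,2)] y by (simp add: m_assoc Units_closed)
    finally show ?case using teich_dataD(2)[OF d 2] by simp
  next
    case (3 a b c)
    have cl: "a \<otimes>\<^bsub>G\<^esub> b \<in> carrier G" "b \<otimes>\<^bsub>G\<^esub> c \<in> carrier G" using 3 by auto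
    have t: "(a, b, c) \<in> triples G" using 3 by (simp add: triples_def)
    have e: "\<alpha> a (z (b, c) \<otimes> u (b, c)) = \<alpha> a (z (b, c)) \<otimes> \<alpha> a (u (b, c))"
      using \<alpha>m[OF 3(1) zc[OF 3(2,3)] Units_closed[OF u[OF 3(2,3)]]] .
    show ?case
      unfolding e coboundary2_def using t
      by simp (intro central_unit_shuffle ring_aut_center[OF \<alpha>[OF 3(1)]] zC zU 3 cl f \<alpha>c[OF 3(1)] Units_closed u teich_dataD(3)[OF d])
  qed
qed

text \<open>The units cancel on the right, so section and units determine the obstruction on
  triples; elsewhere extensionality fixes the value.\<close>

lemma teich_data_unique:
  assumes G: "group G" and d: "teich_data G \<alpha> u f" "teich_data G \<alpha> u f'"
    and f: "f \<in> triples G \<rightarrow>\<^sub>E carrier R" "f' \<in> triples G \<rightarrow>\<^sub>E carrier R"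
  shows "f = f'"
proof (rule PiE_ext[OF f])
  interpret G: group G by fact
  fix x assume "x \<in> triples G"
  then obtain a b c where x: "x = (a, b, c)" "a \<in> carrier G" "b \<in> carrier G" "c \<in> carrier G"
    by (auto simp: triples_def)
  let ?p = "u (a, b) \<otimes> u (a \<otimes>\<^bsub>G\<^esub> b, c)"
  have p: "?p \<in> Units R" using teich_dataD(1)[OF d(1)] x by simp
  have cl: "f x \<in> carrier R" "f' x \<in> carrier R" using f \<open>x \<in> triples G\<close> by auto
  have "f x \<otimes> ?p = f' x \<otimes> ?p"
    using teich_dataD(3)[OF d(1) x(2-4)] teich_dataD(3)[OF d(2) x(2-4)] teich_dataD(1)[OF d(1)] x cl
    by (simp add: m_assoc Units_closed)
  then have "f x \<otimes> ?p \<otimes> inv ?p = f' x \<otimes> ?p \<otimes> inv ?p" by simp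
  then show "f x = f' x" using cl p by (simp add: m_assoc[OF _ Units_closed[OF p]] Units_closed)
qed

text \<open>Any other choice of section and units is reached in two moves. Changing the section
  leaves the obstruction fixed, and two families of units over the same section differ by a central
  cochain, because they induce the same inner automorphisms. Conversely, every central cochain may
  be used to rescale the units.\<close>

lemma teich_class_eq_cohom_class:
  assumes G: "group G" and d: "teich_data G \<alpha> u f"
    and \<tau>: "\<And>g. g \<in> carrier G \<Longrightarrow> \<tau> g = conj_by R ` Units R #>\<^bsub>aut_group R\<^esub> \<alpha> g"
    and \<alpha>: "\<And>g. g \<in> carrier G \<Longrightarrow> \<alpha> g \<in> ring_aut R"
    and f: "f \<in> triples G \<rightarrow>\<^sub>E ring_center R"
  shows "teich_class R G \<tau> = cohom_class3 R G (Units R \<inter> ring_center R) \<alpha> f"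
proof (rule equalityI; rule subsetI)
  interpret G: group G by fact
  have fC: "f (a, b, c) \<in> ring_center R" if "a \<in> carrier G" "b \<in> carrier G" "c \<in> carrier G" for a b c
    using f that by (auto simp: triples_def PiE_def Pi_def)
  have restr: "teich_data G \<alpha>' u' (restrict F (triples G)) = teich_data G \<alpha>' u' F" for \<alpha>' u' F
    unfolding teich_data_def triples_def by auto
  have cob_closed: "f x \<otimes> coboundary2 R G \<alpha>' h x \<in> carrier R"
    if h: "h \<in> carrier G \<times> carrier G \<rightarrow> Units R \<inter> ring_center R" and x: "x \<in> triples G"
      and \<alpha>': "\<And>g. g \<in> carrier G \<Longrightarrow> \<alpha>' g \<in> ring_aut R" for h x \<alpha>'
  proof -
    obtain a b c where abc: "x = (a, b, c)" "a \<in> carrier G" "b \<in> carrier G" "c \<in> carrier G"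
      using x by (auto simp: triples_def)
    have hU: "h (y, z) \<in> Units R" if "y \<in> carrier G" "z \<in> carrier G" for y z using h that by blast
    show ?thesis using abc x hU ring_centerD(1)[OF fC] ring_autD(4)[OF \<alpha>']
      by (simp add: coboundary2_def Units_closed)
  qed
  {
    fix f' assume "f' \<in> cohom_class3 R G (Units R \<inter> ring_center R) \<alpha> f"
    then obtain h where h: "h \<in> carrier G \<times> carrier G \<rightarrow>\<^sub>E Units R \<inter> ring_center R"
      and f': "f' = restrict (\<lambda>x. f x \<otimes> coboundary2 R G \<alpha> h x) (triples G)"
      unfolding cohom_class3_def by blast
    have hP: "h \<in> carrier G \<times> carrier G \<rightarrow> Units R \<inter> ring_center R" using h by (simp add: PiE_def)
    have "teich_data G \<alpha> (\<lambda>x. h x \<otimes> u x) f'"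
      unfolding f' restr by (rule teich_data_scale[OF G d \<alpha>]) (use hP ring_centerD(1)[OF fC] in blast)+
    moreover have "f' \<in> triples G \<rightarrow>\<^sub>E carrier R"
      unfolding f' using cob_closed[OF hP _ \<alpha>] by (simp add: PiE_def Pi_def)
    moreover have "\<alpha> g \<in> \<tau> g" if g: "g \<in> carrier G" for g
      using group.rcos_self[OF aut_group_group[OF ring_axioms] _ normal_imp_subgroup[OF inner_normal]] \<alpha>[OF g] \<tau>[OF g]
      by (simp add: aut_group_def)
    ultimately show "f' \<in> teich_class R G \<tau>" unfolding teich_class_alt by blast
  next
    fix f' assume "f' \<in> teich_class R G \<tau>"
    then obtain \<alpha>' u' where f': "f' \<in> triples G \<rightarrow>\<^sub>E carrier R" and \<alpha>'\<tau>: "\<And>g. g \<in> carrier G \<Longrightarrow> \<alpha>' g \<in> \<tau> g"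
      and d': "teich_data G \<alpha>' u' f'" unfolding teich_class_alt by blast
    have "\<exists>w\<in>Units R. \<alpha>' g = compose (carrier R) (conj_by R w) (\<alpha> g)" if g: "g \<in> carrier G" for g
      using \<alpha>'\<tau>[OF g] unfolding \<tau>[OF g] r_coset_def by (auto simp: aut_group_def)
    then obtain w where w: "\<And>g. g \<in> carrier G \<Longrightarrow> w g \<in> Units R"
      and \<alpha>'w: "\<And>g. g \<in> carrier G \<Longrightarrow> \<alpha>' g = compose (carrier R) (conj_by R (w g)) (\<alpha> g)" by metis
    have \<alpha>'aut: "\<alpha>' g \<in> ring_aut R" if g: "g \<in> carrier G" for g
      unfolding \<alpha>'w[OF g] by (rule compose_ring_aut[OF conj_by_aut[OF w[OF g]] \<alpha>[OF g] ring_axioms])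
    have \<alpha>'x: "\<alpha>' g x = w g \<otimes> \<alpha> g x \<otimes> inv (w g)" if "g \<in> carrier G" "x \<in> carrier R" for g x
      using that ring_autD(4)[OF \<alpha>] by (simp add: \<alpha>'w compose_eq conj_by_app)
    define U where "U = (\<lambda>(a, b). w a \<otimes> \<alpha> a (w b) \<otimes> u (a, b) \<otimes> inv (w (a \<otimes>\<^bsub>G\<^esub> b)))"
    have dU: "teich_data G \<alpha>' U f"
      unfolding U_def by (rule teich_data_change_section[OF G d \<alpha> w \<alpha>'x fC])
    note UU = teich_dataD(1)[OF dU] and u'U = teich_dataD(1)[OF d']
    define h where "h = restrict (\<lambda>x. u' x \<otimes> inv (U x)) (carrier G \<times> carrier G)"
    have hab: "h (a, b) \<in> Units R \<inter> ring_center R" if ab: "a \<in> carrier G" "b \<in> carrier G" for a b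
    proof -
      have hU: "h (a, b) \<in> Units R" using ab UU[OF ab] u'U[OF ab] by (simp add: h_def)
      have "h (a, b) \<otimes> y = y \<otimes> h (a, b)" if y: "y \<in> carrier R" for y
      proof -
        have abG: "a \<otimes>\<^bsub>G\<^esub> b \<in> carrier G" using ab by simp
        have y': "inv (U (a, b)) \<otimes> y \<otimes> U (a, b) \<in> carrier R" using y UU[OF ab] by (simp add: Units_closed)
        \<comment> \<open>\<open>u'\<close> and \<open>U\<close> conjugate the values of the lift at
          the product ab in the same way, and these values exhaust the ring, so commutation can be
          tested at an arbitrary y.\<close>
        obtain x where x: "x \<in> carrier R" "\<alpha>' (a \<otimes>\<^bsub>G\<^esub> b) x = inv (U (a, b)) \<otimes> y \<otimes> U (a, b)"
          using ring_aut_surj[OF \<alpha>'aut[OF abG] y'] .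
        have "u' (a, b) \<otimes> (inv (U (a, b)) \<otimes> y \<otimes> U (a, b)) \<otimes> inv (u' (a, b))
            = U (a, b) \<otimes> (inv (U (a, b)) \<otimes> y \<otimes> U (a, b)) \<otimes> inv (U (a, b))"
          using teich_dataD(2)[OF d' ab x(1)] teich_dataD(2)[OF dU ab x(1)] x(2) by simp
        also have "\<dots> = y" using y UU[OF ab] by (simp add: m_assoc inv_cancel Units_closed)
        finally have "u' (a, b) \<otimes> (inv (U (a, b)) \<otimes> y \<otimes> U (a, b)) \<otimes> inv (u' (a, b)) \<otimes> h (a, b) = y \<otimes> h (a, b)" by simp
        then show ?thesis using y UU[OF ab] u'U[OF ab] ab
          by (simp add: h_def m_assoc inv_cancel Units_closed)
      qed
      then show ?thesis using hU Units_closed[OF hU] unfolding ring_center_def by blast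
    qed
    have hP: "h \<in> carrier G \<times> carrier G \<rightarrow> Units R \<inter> ring_center R" using hab by auto
    have "teich_data G \<alpha>' (\<lambda>x. h x \<otimes> U x) (\<lambda>x. f x \<otimes> coboundary2 R G \<alpha>' h x)"
      by (rule teich_data_scale[OF G dU \<alpha>'aut]) (use hab ring_centerD(1)[OF fC] in blast)+
    moreover have "h (a, b) \<otimes> U (a, b) = u' (a, b)" if "a \<in> carrier G" "b \<in> carrier G" for a b
      using UU[OF that] u'U[OF that] that by (simp add: h_def m_assoc Units_closed)
    ultimately have "teich_data G \<alpha>' u' (\<lambda>x. f x \<otimes> coboundary2 R G \<alpha>' h x)"
      unfolding teich_data_def by simp
    then have "teich_data G \<alpha>' u' (restrict (\<lambda>x. f x \<otimes> coboundary2 R G \<alpha>' h x) (triples G))"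
      unfolding restr .
    from teich_data_unique[OF G d' this f']
    have "f' = restrict (\<lambda>x. f x \<otimes> coboundary2 R G \<alpha>' h x) (triples G)"
      using cob_closed[OF hP _ \<alpha>'aut] by (simp add: PiE_def Pi_def)
    \<comment> \<open>The two sections differ by inner automorphisms, which are trivial on the
      center, so they give central cochains the same coboundaries.\<close>
    moreover have "coboundary2 R G \<alpha>' h = coboundary2 R G \<alpha> h"
    proof -
      have "\<alpha>' a (h (b, c)) = \<alpha> a (h (b, c))" if abc: "a \<in> carrier G" "b \<in> carrier G" "c \<in> carrier G" for a b c
      proof -
        have z: "\<alpha> a (h (b, c)) \<in> ring_center R" using ring_aut_center[OF \<alpha>[OF abc(1)]] hab abc by blast
        have "w a \<otimes> \<alpha> a (h (b, c)) = \<alpha> a (h (b, c)) \<otimes> w a"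
          using ring_centerD(2)[OF z, of "w a"] w[OF abc(1)] Units_closed by simp
        then show ?thesis using \<alpha>'x[OF abc(1)] hab[OF abc(2,3)] w[OF abc(1)] ring_centerD(1)[OF z]
          by (simp add: m_assoc Units_closed)
      qed
      then show ?thesis unfolding coboundary2_def by (intro restrict_ext) (auto simp: triples_def)
    qed
    ultimately have "f' = restrict (\<lambda>x. f x \<otimes> coboundary2 R G \<alpha> h x) (triples G)" by simp
    moreover have "h \<in> carrier G \<times> carrier G \<rightarrow>\<^sub>E Units R \<inter> ring_center R"
      using hP by (simp add: PiE_def h_def)
    ultimately show "f' \<in> cohom_class3 R G (Units R \<inter> ring_center R) \<alpha> f"
      unfolding cohom_class3_def by blast
  }
qed

end

section \<open>Automorphisms of a crossed product from a nuclear extension\<close>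

context crossed begin

text \<open>\<open>induced_endo\<close> is applied to \<alpha> and \<open>c\<close> and to their
  inverses; both composites fix the generators of \<open>C\<close> and hence are the
  identity.\<close>

lemma induced_aut:
  assumes \<alpha>: "\<alpha> \<in> ring_aut A"
    and c_closed: "\<And>\<gamma>. \<gamma> \<in> carrier \<Gamma> \<Longrightarrow> c \<gamma> \<in> carrier \<Gamma>"
    and d_closed: "\<And>\<gamma>. \<gamma> \<in> carrier \<Gamma> \<Longrightarrow> d \<gamma> \<in> carrier \<Gamma>"
    and cd: "\<And>\<gamma>. \<gamma> \<in> carrier \<Gamma> \<Longrightarrow> c (d \<gamma>) = \<gamma>"
    and dc: "\<And>\<gamma>. \<gamma> \<in> carrier \<Gamma> \<Longrightarrow> d (c \<gamma>) = \<gamma>"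
    and c_mult: "\<And>\<gamma> \<delta>. \<gamma> \<in> carrier \<Gamma> \<Longrightarrow> \<delta> \<in> carrier \<Gamma> \<Longrightarrow> c (\<gamma> \<otimes>\<^bsub>\<Gamma>\<^esub> \<delta>) = c \<gamma> \<otimes>\<^bsub>\<Gamma>\<^esub> c \<delta>"
    and c_j: "\<And>y. y \<in> Units A \<Longrightarrow> c (j y) = j (\<alpha> y)"
    and c_\<theta>: "\<And>\<gamma> a. \<gamma> \<in> carrier \<Gamma> \<Longrightarrow> a \<in> carrier A \<Longrightarrow> \<theta> (c \<gamma>) (\<alpha> a) = \<alpha> (\<theta> \<gamma> a)"
  shows "\<exists>\<beta>\<in>ring_aut C. \<forall>\<gamma>\<in>carrier \<Gamma>. \<forall>a\<in>carrier A.
    \<beta> (emb a \<otimes>\<^bsub>C\<^esub> v \<gamma>) = emb (\<alpha> a) \<otimes>\<^bsub>C\<^esub> v (c \<gamma>)"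
proof -
  obtain \<alpha>' where \<alpha>': "\<alpha>' \<in> ring_aut A" and \<alpha>'\<alpha>: "\<And>a. a \<in> carrier A \<Longrightarrow> \<alpha>' (\<alpha> a) = a"
    and \<alpha>\<alpha>': "\<And>a. a \<in> carrier A \<Longrightarrow> \<alpha> (\<alpha>' a) = a"
    using ring_aut_inverse[OF ring_axioms \<alpha>] by blast
  note \<alpha>'c = ring_autD(4)[OF \<alpha>'] and \<alpha>c = ring_autD(4)[OF \<alpha>]
  obtain \<beta> where \<beta>: "\<beta> \<in> ring_hom C C" "\<beta> \<in> extensional (carrier C)"
    and \<beta>_gen: "\<And>\<gamma> a. \<gamma> \<in> carrier \<Gamma> \<Longrightarrow> a \<in> carrier A \<Longrightarrow> \<beta> (emb a \<otimes>\<^bsub>C\<^esub> v \<gamma>) = emb (\<alpha> a) \<otimes>\<^bsub>C\<^esub> v (c \<gamma>)"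
    using induced_endo[OF \<alpha> c_closed d_closed cd dc c_mult c_j c_\<theta>] by blast
  have d_mult: "d (\<gamma> \<otimes>\<^bsub>\<Gamma>\<^esub> \<delta>) = d \<gamma> \<otimes>\<^bsub>\<Gamma>\<^esub> d \<delta>" if "\<gamma> \<in> carrier \<Gamma>" "\<delta> \<in> carrier \<Gamma>" for \<gamma> \<delta>
    using dc[of "d \<gamma> \<otimes>\<^bsub>\<Gamma>\<^esub> d \<delta>"] c_mult[of "d \<gamma>" "d \<delta>"] that by (simp add: d_closed cd)
  have d_j: "d (j y) = j (\<alpha>' y)" if y: "y \<in> Units A" for y
    using dc[of "j (\<alpha>' y)"] c_j[of "\<alpha>' y"] ring_aut_unit(1)[OF ring_axioms \<alpha>' y] y
    by (simp add: j_closed \<alpha>\<alpha>' Units_closed)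
  have d_\<theta>: "\<theta> (d \<gamma>) (\<alpha>' a) = \<alpha>' (\<theta> \<gamma> a)" if "\<gamma> \<in> carrier \<Gamma>" "a \<in> carrier A" for \<gamma> a
  proof -
    have "\<alpha>' (\<theta> (c (d \<gamma>)) (\<alpha> (\<alpha>' a))) = \<alpha>' (\<alpha> (\<theta> (d \<gamma>) (\<alpha>' a)))"
      using c_\<theta>[of "d \<gamma>" "\<alpha>' a"] that by (simp add: d_closed \<alpha>'c)
    then show ?thesis using that by (simp add: cd \<alpha>\<alpha>' \<alpha>'\<alpha> \<theta>_simps d_closed \<alpha>'c)
  qed
  obtain \<beta>' where \<beta>': "\<beta>' \<in> ring_hom C C"
    and \<beta>'_gen: "\<And>\<gamma> a. \<gamma> \<in> carrier \<Gamma> \<Longrightarrow> a \<in> carrier A \<Longrightarrow> \<beta>' (emb a \<otimes>\<^bsub>C\<^esub> v \<gamma>) = emb (\<alpha>' a) \<otimes>\<^bsub>C\<^esub> v (d \<gamma>)"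
    using induced_endo[OF \<alpha>' d_closed c_closed dc cd d_mult d_j d_\<theta>] by blast
  have id: "id \<in> ring_hom C C" by (rule ring_hom_memI) auto
  have 1: "(\<beta>' \<circ> \<beta>) x = id x" if "x \<in> carrier C" for x
    by (rule C_hom_eqI[OF ring_hom_trans[OF \<beta>(1) \<beta>'] id _ that])
      (simp add: \<beta>_gen \<beta>'_gen \<alpha>c c_closed dc \<alpha>'\<alpha>)
  have 2: "(\<beta> \<circ> \<beta>') x = id x" if "x \<in> carrier C" for x
    by (rule C_hom_eqI[OF ring_hom_trans[OF \<beta>' \<beta>(1)] id _ that])
      (simp add: \<beta>_gen \<beta>'_gen \<alpha>'c d_closed cd \<alpha>\<alpha>')
  have "\<beta> \<in> ring_aut C"
  proof (rule ring_autI[where \<psi> = \<beta>'])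
    show "\<beta>' (\<beta> x) = x" if "x \<in> carrier C" for x using 1[OF that] by simp
    show "\<beta> (\<beta>' x) = x" if "x \<in> carrier C" for x using 2[OF that] by simp
  qed (simp_all add: \<beta>(2) ring_hom_closed[OF \<beta>(1)] ring_hom_closed[OF \<beta>'] ring_hom_mult[OF \<beta>(1)]
      ring_hom_add[OF \<beta>(1)] ring_hom_one[OF \<beta>(1)])
  then show ?thesis using \<beta>_gen by blast
qed

lemma C_aut_eqI:
  assumes "\<beta> \<in> ring_aut C" "\<beta>' \<in> ring_aut C"
    and "\<And>\<gamma> a. \<gamma> \<in> carrier \<Gamma> \<Longrightarrow> a \<in> carrier A \<Longrightarrow> \<beta> (emb a \<otimes>\<^bsub>C\<^esub> v \<gamma>) = \<beta>' (emb a \<otimes>\<^bsub>C\<^esub> v \<gamma>)"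
  shows "\<beta> = \<beta>'"
  using assms(1,2) by (rule ring_aut_eqI) (rule C_hom_eqI[OF ring_autD(1)[OF assms(1)] ring_autD(1)[OF assms(2)] assms(3)])

end

text \<open>A set \<open>M\<close> with a product over \<open>G\<close>, into which \<open>\<iota>\<close> embeds the group \<open>\<Gamma>\<close> as the elements over the
  kernel of \<open>\<pi>\<close>. Associativity holds as soon as one of three factors lies in \<open>\<Gamma>\<close>, and in general up to \<open>f\<close>.\<close>

locale nuclear = crossed A \<Gamma> \<theta> j + G: group G + Q: group Q
  for A :: "('a,'b) ring_scheme" (structure) and \<Gamma> :: "('x,'c) monoid_scheme" and \<theta> j
    and G :: "('g,'d) monoid_scheme" and Q :: "('q,'e) monoid_scheme" +
  fixes M :: "'m set" and mul :: "'m \<Rightarrow> 'm \<Rightarrow> 'm" (infixl \<open>\<star>\<close> 70) and \<iota> :: "'x \<Rightarrow> 'm"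
    and \<Theta> :: "'m \<Rightarrow> 'a \<Rightarrow> 'a" and pr :: "'m \<Rightarrow> 'g" and \<pi> :: "'g \<Rightarrow> 'q"
    and f :: "'q \<times> 'q \<times> 'q \<Rightarrow> 'a"
  assumes mul_closed: "E \<in> M \<Longrightarrow> F \<in> M \<Longrightarrow> E \<star> F \<in> M"
    and \<iota>_closed: "\<gamma> \<in> carrier \<Gamma> \<Longrightarrow> \<iota> \<gamma> \<in> M"
    and \<iota>_mult: "\<gamma> \<in> carrier \<Gamma> \<Longrightarrow> \<delta> \<in> carrier \<Gamma> \<Longrightarrow> \<iota> (\<gamma> \<otimes>\<^bsub>\<Gamma>\<^esub> \<delta>) = \<iota> \<gamma> \<star> \<iota> \<delta>"
    and assoc1: "\<gamma> \<in> carrier \<Gamma> \<Longrightarrow> E \<in> M \<Longrightarrow> F \<in> M \<Longrightarrow> \<iota> \<gamma> \<star> (E \<star> F) = \<iota> \<gamma> \<star> E \<star> F"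
    and assoc2: "\<gamma> \<in> carrier \<Gamma> \<Longrightarrow> E \<in> M \<Longrightarrow> F \<in> M \<Longrightarrow> E \<star> (\<iota> \<gamma> \<star> F) = E \<star> \<iota> \<gamma> \<star> F"
    and assoc3: "\<gamma> \<in> carrier \<Gamma> \<Longrightarrow> E \<in> M \<Longrightarrow> F \<in> M \<Longrightarrow> E \<star> (F \<star> \<iota> \<gamma>) = E \<star> F \<star> \<iota> \<gamma>"
    and associator: "E \<in> M \<Longrightarrow> F \<in> M \<Longrightarrow> H \<in> M \<Longrightarrow>
      E \<star> (F \<star> H) = \<iota> (j (f (\<pi> (pr E), \<pi> (pr F), \<pi> (pr H)))) \<star> (E \<star> F \<star> H)"
    and f_unit: "f \<in> triples Q \<rightarrow>\<^sub>E Units A"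
    and ldiv: "E \<in> M \<Longrightarrow> F \<in> M \<Longrightarrow> \<pi> (pr E) = \<pi> (pr F) \<Longrightarrow> \<exists>\<gamma>\<in>carrier \<Gamma>. F = \<iota> \<gamma> \<star> E"
    and rdiv: "E \<in> M \<Longrightarrow> F \<in> M \<Longrightarrow> \<pi> (pr E) = \<pi> (pr F) \<Longrightarrow> \<exists>\<gamma>\<in>carrier \<Gamma>. F = E \<star> \<iota> \<gamma>"
    and lcancel: "E \<in> M \<Longrightarrow> \<gamma> \<in> carrier \<Gamma> \<Longrightarrow> \<delta> \<in> carrier \<Gamma> \<Longrightarrow> \<iota> \<gamma> \<star> E = \<iota> \<delta> \<star> E \<Longrightarrow> \<gamma> = \<delta>"
    and rcancel: "E \<in> M \<Longrightarrow> \<gamma> \<in> carrier \<Gamma> \<Longrightarrow> \<delta> \<in> carrier \<Gamma> \<Longrightarrow> E \<star> \<iota> \<gamma> = E \<star> \<iota> \<delta> \<Longrightarrow> \<gamma> = \<delta>"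
    and \<Theta>_aut: "E \<in> M \<Longrightarrow> \<Theta> E \<in> ring_aut A"
    and \<Theta>_mult: "E \<in> M \<Longrightarrow> F \<in> M \<Longrightarrow> a \<in> carrier A \<Longrightarrow> \<Theta> (E \<star> F) a = \<Theta> E (\<Theta> F a)"
    and \<Theta>_\<iota>: "\<gamma> \<in> carrier \<Gamma> \<Longrightarrow> a \<in> carrier A \<Longrightarrow> \<Theta> (\<iota> \<gamma>) a = \<theta> \<gamma> a"
    and move_\<iota>_j: "E \<in> M \<Longrightarrow> y \<in> Units A \<Longrightarrow> E \<star> \<iota> (j y) = \<iota> (j (\<Theta> E y)) \<star> E"
    and pr_closed: "E \<in> M \<Longrightarrow> pr E \<in> carrier G"
    and pr_mult: "E \<in> M \<Longrightarrow> F \<in> M \<Longrightarrow> pr (E \<star> F) = pr E \<otimes>\<^bsub>G\<^esub> pr F"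
    and pr_surj: "g \<in> carrier G \<Longrightarrow> \<exists>E\<in>M. pr E = g"
    and pr_eq: "E \<in> M \<Longrightarrow> F \<in> M \<Longrightarrow> pr E = pr F \<Longrightarrow> \<exists>y\<in>Units A. F = \<iota> (j y) \<star> E"
    and \<pi>_pr_\<iota>: "\<gamma> \<in> carrier \<Gamma> \<Longrightarrow> \<pi> (pr (\<iota> \<gamma>)) = \<one>\<^bsub>Q\<^esub>"
    and \<pi>_hom: "\<pi> \<in> hom G Q"
    and \<pi>_surj: "r \<in> carrier Q \<Longrightarrow> \<exists>g\<in>carrier G. \<pi> g = r"
begin

section \<open>Conjugation in the quasigroup and the automorphisms it induces\<close>

lemma \<pi>_closed: "g \<in> carrier G \<Longrightarrow> \<pi> g \<in> carrier Q"
  using \<pi>_hom by (auto simp: hom_def)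

lemma \<pi>_mult: "g \<in> carrier G \<Longrightarrow> h \<in> carrier G \<Longrightarrow> \<pi> (g \<otimes>\<^bsub>G\<^esub> h) = \<pi> g \<otimes>\<^bsub>Q\<^esub> \<pi> h"
  using \<pi>_hom by (auto simp: hom_def)

lemmas pr_simps = pr_closed pr_mult \<pi>_closed \<pi>_mult \<pi>_pr_\<iota> mul_closed \<iota>_closed

text \<open>Conjugation of \<gamma> by \<open>E\<close>. Without associativity a product of
  \<open>E\<close>, \<gamma> and an inverse of \<open>E\<close> is ambiguous, so the conjugate is
  defined as the solution \<delta> of E \<gamma> = \<delta> E; \<open>dj\<close> solves the same
  equation for \<gamma>.\<close>

definition cj where "cj E \<gamma> = (THE \<delta>. \<delta> \<in> carrier \<Gamma> \<and> E \<star> \<iota> \<gamma> = \<iota> \<delta> \<star> E)"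
definition dj where "dj E \<delta> = (THE \<gamma>. \<gamma> \<in> carrier \<Gamma> \<and> E \<star> \<iota> \<gamma> = \<iota> \<delta> \<star> E)"

lemma cj:
  assumes "E \<in> M" "\<gamma> \<in> carrier \<Gamma>"
  shows "cj E \<gamma> \<in> carrier \<Gamma>" "E \<star> \<iota> \<gamma> = \<iota> (cj E \<gamma>) \<star> E"
proof -
  \<comment> \<open>Both products lie over the same element of \<open>Q\<close>, so they differ by
    an element of \<Gamma>.\<close>
  have "\<exists>\<delta>\<in>carrier \<Gamma>. E \<star> \<iota> \<gamma> = \<iota> \<delta> \<star> E"
    using assms by (intro ldiv) (simp_all add: pr_simps)
  then have "\<exists>!\<delta>. \<delta> \<in> carrier \<Gamma> \<and> E \<star> \<iota> \<gamma> = \<iota> \<delta> \<star> E"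
    using lcancel[OF assms(1)] by metis
  from theI'[OF this] show "cj E \<gamma> \<in> carrier \<Gamma>" "E \<star> \<iota> \<gamma> = \<iota> (cj E \<gamma>) \<star> E"
    unfolding cj_def by blast+
qed

lemma dj:
  assumes "E \<in> M" "\<delta> \<in> carrier \<Gamma>"
  shows "dj E \<delta> \<in> carrier \<Gamma>" "E \<star> \<iota> (dj E \<delta>) = \<iota> \<delta> \<star> E"
proof -
  have "\<exists>\<gamma>\<in>carrier \<Gamma>. \<iota> \<delta> \<star> E = E \<star> \<iota> \<gamma>"
    using assms by (intro rdiv) (simp_all add: pr_simps)
  then have "\<exists>!\<gamma>. \<gamma> \<in> carrier \<Gamma> \<and> E \<star> \<iota> \<gamma> = \<iota> \<delta> \<star> E"
    using rcancel[OF assms(1)] by metis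
  from theI'[OF this] show "dj E \<delta> \<in> carrier \<Gamma>" "E \<star> \<iota> (dj E \<delta>) = \<iota> \<delta> \<star> E"
    unfolding dj_def by blast+
qed

lemma cj_eqI:
  assumes "E \<in> M" "\<gamma> \<in> carrier \<Gamma>" "\<delta> \<in> carrier \<Gamma>" "E \<star> \<iota> \<gamma> = \<iota> \<delta> \<star> E"
  shows "cj E \<gamma> = \<delta>"
  using lcancel[OF assms(1) cj(1)[OF assms(1,2)] assms(3)] cj(2)[OF assms(1,2)] assms(4) by simp

text \<open>Every rebracketing involves a factor from \<Gamma>, so nuclearity suffices.\<close>

lemma cj_mult:
  assumes E: "E \<in> M" and \<gamma>: "\<gamma> \<in> carrier \<Gamma>" and \<delta>: "\<delta> \<in> carrier \<Gamma>"
  shows "cj E (\<gamma> \<otimes>\<^bsub>\<Gamma>\<^esub> \<delta>) = cj E \<gamma> \<otimes>\<^bsub>\<Gamma>\<^esub> cj E \<delta>"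
proof (rule cj_eqI[OF E])
  note cl = cj(1)[OF E \<gamma>] cj(1)[OF E \<delta>]
  have "E \<star> \<iota> (\<gamma> \<otimes>\<^bsub>\<Gamma>\<^esub> \<delta>) = E \<star> \<iota> \<gamma> \<star> \<iota> \<delta>"
    using \<gamma> \<delta> E by (simp add: \<iota>_mult assoc2 \<iota>_closed)
  also have "\<dots> = \<iota> (cj E \<gamma>) \<star> E \<star> \<iota> \<delta>" using cj(2)[OF E \<gamma>] by simp
  also have "\<dots> = \<iota> (cj E \<gamma>) \<star> (E \<star> \<iota> \<delta>)" using cl E \<delta> by (simp add: assoc1 \<iota>_closed)
  also have "\<dots> = \<iota> (cj E \<gamma>) \<star> (\<iota> (cj E \<delta>) \<star> E)" using cj(2)[OF E \<delta>] by simp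
  also have "\<dots> = \<iota> (cj E \<gamma> \<otimes>\<^bsub>\<Gamma>\<^esub> cj E \<delta>) \<star> E" using cl E by (simp add: assoc1 \<iota>_closed \<iota>_mult)
  finally show "E \<star> \<iota> (\<gamma> \<otimes>\<^bsub>\<Gamma>\<^esub> \<delta>) = \<iota> (cj E \<gamma> \<otimes>\<^bsub>\<Gamma>\<^esub> cj E \<delta>) \<star> E" .
qed (use \<gamma> \<delta> cj(1)[OF E] in auto)

text \<open>\<open>E\<close> and \<open>F\<close> may both lie outside the nucleus, but the third
  factor is always in \<Gamma>, in last, middle and first place in turn. Hence conjugation is
  multiplicative in the conjugating element although \<open>M\<close> is not associative.\<close>

lemma cj_comp:
  assumes E: "E \<in> M" and F: "F \<in> M" and \<gamma>: "\<gamma> \<in> carrier \<Gamma>"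
  shows "cj (E \<star> F) \<gamma> = cj E (cj F \<gamma>)"
proof (rule cj_eqI[OF mul_closed[OF E F] \<gamma>])
  note cY = cj(1)[OF F \<gamma>] and cX = cj(1)[OF E cj(1)[OF F \<gamma>]]
  show "cj E (cj F \<gamma>) \<in> carrier \<Gamma>" by (rule cX)
  have "E \<star> F \<star> \<iota> \<gamma> = E \<star> (F \<star> \<iota> \<gamma>)" using E F \<gamma> by (simp add: assoc3)
  also have "\<dots> = E \<star> \<iota> (cj F \<gamma>) \<star> F" using cj(2)[OF F \<gamma>] E F cY by (simp add: assoc2)
  also have "\<dots> = \<iota> (cj E (cj F \<gamma>)) \<star> E \<star> F" using cj(2)[OF E cY] by simp
  also have "\<dots> = \<iota> (cj E (cj F \<gamma>)) \<star> (E \<star> F)" using cX E F by (simp add: assoc1)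
  finally show "E \<star> F \<star> \<iota> \<gamma> = \<iota> (cj E (cj F \<gamma>)) \<star> (E \<star> F)" .
qed

lemma cj_\<iota>:
  assumes "\<gamma> \<in> carrier \<Gamma>" "\<delta> \<in> carrier \<Gamma>"
  shows "cj (\<iota> \<gamma>) \<delta> = \<gamma> \<otimes>\<^bsub>\<Gamma>\<^esub> \<delta> \<otimes>\<^bsub>\<Gamma>\<^esub> inv\<^bsub>\<Gamma>\<^esub> \<gamma>"
proof (rule cj_eqI)
  have "\<iota> (\<gamma> \<otimes>\<^bsub>\<Gamma>\<^esub> \<delta>) = \<iota> (\<gamma> \<otimes>\<^bsub>\<Gamma>\<^esub> \<delta> \<otimes>\<^bsub>\<Gamma>\<^esub> inv\<^bsub>\<Gamma>\<^esub> \<gamma> \<otimes>\<^bsub>\<Gamma>\<^esub> \<gamma>)" using assms by (simp add: \<Gamma>.m_assoc)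
  then show "\<iota> \<gamma> \<star> \<iota> \<delta> = \<iota> (\<gamma> \<otimes>\<^bsub>\<Gamma>\<^esub> \<delta> \<otimes>\<^bsub>\<Gamma>\<^esub> inv\<^bsub>\<Gamma>\<^esub> \<gamma>) \<star> \<iota> \<gamma>"
    using assms \<iota>_mult[of \<gamma> \<delta>] \<iota>_mult[of "\<gamma> \<otimes>\<^bsub>\<Gamma>\<^esub> \<delta> \<otimes>\<^bsub>\<Gamma>\<^esub> inv\<^bsub>\<Gamma>\<^esub> \<gamma>" \<gamma>] by simp
qed (use assms \<iota>_closed in auto)

text \<open>Obtained by applying \<Theta> to the equation that defines
  \<open>cj E \<gamma>\<close>.\<close>

lemma cj_\<theta>:
  assumes E: "E \<in> M" and \<gamma>: "\<gamma> \<in> carrier \<Gamma>" and a: "a \<in> carrier A"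
  shows "\<theta> (cj E \<gamma>) (\<Theta> E a) = \<Theta> E (\<theta> \<gamma> a)"
proof -
  have "\<Theta> (E \<star> \<iota> \<gamma>) a = \<Theta> (\<iota> (cj E \<gamma>) \<star> E) a" using cj(2)[OF E \<gamma>] by simp
  then show ?thesis
    using E \<gamma> a cj(1)[OF E \<gamma>] by (simp add: \<Theta>_mult \<iota>_closed \<Theta>_\<iota> ring_autD(4)[OF \<Theta>_aut])
qed

lemma aut_exists:
  assumes E: "E \<in> M"
  shows "\<exists>\<beta>\<in>ring_aut C. \<forall>\<gamma>\<in>carrier \<Gamma>. \<forall>a\<in>carrier A.
    \<beta> (emb a \<otimes>\<^bsub>C\<^esub> v \<gamma>) = emb (\<Theta> E a) \<otimes>\<^bsub>C\<^esub> v (cj E \<gamma>)"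
proof (rule induced_aut[where d = "dj E"])
  show "cj E (dj E \<gamma>) = \<gamma>" if "\<gamma> \<in> carrier \<Gamma>" for \<gamma>
    using dj[OF E that] that by (intro cj_eqI[OF E]) auto
  show "dj E (cj E \<gamma>) = \<gamma>" if "\<gamma> \<in> carrier \<Gamma>" for \<gamma>
    using rcancel[OF E dj(1)[OF E cj(1)[OF E that]] that] dj(2)[OF E cj(1)[OF E that]] cj(2)[OF E that] by simp
  show "cj E (j y) = j (\<Theta> E y)" if "y \<in> Units A" for y
    using move_\<iota>_j[OF E that] ring_aut_unit(1)[OF ring_axioms \<Theta>_aut[OF E] that] that E
    by (intro cj_eqI) (auto simp: j_closed)
qed (simp_all add: E \<Theta>_aut cj(1) dj(1) cj_mult cj_\<theta>)

text \<open>The automorphism is determined by its values on generators, by \<open>C_aut_eqI\<close>;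
  the choice operator only names it.\<close>

definition \<beta> where
  "\<beta> E = (SOME \<beta>. \<beta> \<in> ring_aut C \<and> (\<forall>\<gamma>\<in>carrier \<Gamma>. \<forall>a\<in>carrier A.
    \<beta> (emb a \<otimes>\<^bsub>C\<^esub> v \<gamma>) = emb (\<Theta> E a) \<otimes>\<^bsub>C\<^esub> v (cj E \<gamma>)))"

lemma \<beta>:
  assumes "E \<in> M"
  shows "\<beta> E \<in> ring_aut C"
    "\<gamma> \<in> carrier \<Gamma> \<Longrightarrow> a \<in> carrier A \<Longrightarrow> \<beta> E (emb a \<otimes>\<^bsub>C\<^esub> v \<gamma>) = emb (\<Theta> E a) \<otimes>\<^bsub>C\<^esub> v (cj E \<gamma>)"
  using someI_ex[OF aut_exists[OF assms, unfolded Bex_def]] unfolding \<beta>_def by blast+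

lemma \<beta>_emb:
  assumes "E \<in> M" "a \<in> carrier A"
  shows "\<beta> E (emb a) = emb (\<Theta> E a)"
proof -
  have "cj E \<one>\<^bsub>\<Gamma>\<^esub> = \<one>\<^bsub>\<Gamma>\<^esub>"
    using cj_mult[OF assms(1), of "\<one>\<^bsub>\<Gamma>\<^esub>" "\<one>\<^bsub>\<Gamma>\<^esub>"] cj(1)[OF assms(1), of "\<one>\<^bsub>\<Gamma>\<^esub>"] by (simp add: \<Gamma>.r_cancel_one')
  then show ?thesis using \<beta>(2)[OF assms(1) \<Gamma>.one_closed assms(2)] assms
    by (simp add: v_one emb_closed ring_autD(4)[OF \<Theta>_aut])
qed

lemma \<beta>_v:
  assumes "E \<in> M" "\<gamma> \<in> carrier \<Gamma>"
  shows "\<beta> E (v \<gamma>) = v (cj E \<gamma>)"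
  using \<beta>(2)[OF assms one_closed] assms
  by (simp add: emb_simps v_closed cj(1) ring_autD(7)[OF \<Theta>_aut])

text \<open>Multiplicativity is exact although \<open>M\<close> is associative only up to
  \<open>f\<close>: both bracketings of a triple product act on \<open>C\<close> in the same way, in
  accordance with the associator being central there.\<close>

lemma \<beta>_mult:
  assumes E: "E \<in> M" and F: "F \<in> M"
  shows "\<beta> (E \<star> F) = compose (carrier C) (\<beta> E) (\<beta> F)"
proof (rule C_aut_eqI)
  show "compose (carrier C) (\<beta> E) (\<beta> F) \<in> ring_aut C"
    by (rule compose_ring_aut[OF \<beta>(1)[OF E] \<beta>(1)[OF F] C.ring_axioms])
  show "\<beta> (E \<star> F) \<in> ring_aut C" by (rule \<beta>(1)[OF mul_closed[OF E F]])
  fix \<gamma> a assume \<gamma>: "\<gamma> \<in> carrier \<Gamma>" and a: "a \<in> carrier A"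
  have c: "emb a \<otimes>\<^bsub>C\<^esub> v \<gamma> \<in> carrier C" using \<gamma> a by (simp add: emb_closed v_closed)
  show "\<beta> (E \<star> F) (emb a \<otimes>\<^bsub>C\<^esub> v \<gamma>) = compose (carrier C) (\<beta> E) (\<beta> F) (emb a \<otimes>\<^bsub>C\<^esub> v \<gamma>)"
    unfolding compose_eq[OF c] \<beta>(2)[OF mul_closed[OF E F] \<gamma> a] \<beta>(2)[OF F \<gamma> a]
      \<beta>(2)[OF E cj(1)[OF F \<gamma>] ring_autD(4)[OF \<Theta>_aut[OF F] a]]
    using E F \<gamma> a by (simp add: \<Theta>_mult cj_comp)
qed

text \<open>Elements of \<Gamma> are present in \<open>C\<close> as units, and v(\<gamma>) a
  v(\<delta>) = \<theta>_\<gamma>(a) v(\<gamma>\<delta>\<gamma>^-1) v(\<gamma>). This makes the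
  action of \<Gamma> trivial in Out(C).\<close>

lemma \<beta>_\<iota>:
  assumes \<gamma>: "\<gamma> \<in> carrier \<Gamma>"
  shows "\<beta> (\<iota> \<gamma>) = conj_by C (v \<gamma>)"
proof (rule C_aut_eqI)
  fix \<delta> a assume \<delta>: "\<delta> \<in> carrier \<Gamma>" and a: "a \<in> carrier A"
  let ?w = "v (\<gamma> \<otimes>\<^bsub>\<Gamma>\<^esub> \<delta> \<otimes>\<^bsub>\<Gamma>\<^esub> inv\<^bsub>\<Gamma>\<^esub> \<gamma>)"
  note cl = v_closed[OF \<gamma>] v_closed[OF \<delta>] emb_closed[OF a] v_closed[of "\<gamma> \<otimes>\<^bsub>\<Gamma>\<^esub> \<delta> \<otimes>\<^bsub>\<Gamma>\<^esub> inv\<^bsub>\<Gamma>\<^esub> \<gamma>"]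
    emb_closed[OF \<theta>_simps(1)[OF \<gamma> a]]
  have w: "?w \<in> carrier C" using \<gamma> \<delta> cl by simp
  have "v \<gamma> \<otimes>\<^bsub>C\<^esub> (emb a \<otimes>\<^bsub>C\<^esub> v \<delta>) = emb (\<theta> \<gamma> a) \<otimes>\<^bsub>C\<^esub> v (\<gamma> \<otimes>\<^bsub>\<Gamma>\<^esub> \<delta>)"
    using cl v_emb[OF \<gamma> a] v_mult[OF \<gamma> \<delta>] by (simp flip: C.m_assoc)
  also have "\<gamma> \<otimes>\<^bsub>\<Gamma>\<^esub> \<delta> = (\<gamma> \<otimes>\<^bsub>\<Gamma>\<^esub> \<delta> \<otimes>\<^bsub>\<Gamma>\<^esub> inv\<^bsub>\<Gamma>\<^esub> \<gamma>) \<otimes>\<^bsub>\<Gamma>\<^esub> \<gamma>" using \<gamma> \<delta> by (simp add: \<Gamma>.m_assoc)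
  also have "v \<dots> = ?w \<otimes>\<^bsub>C\<^esub> v \<gamma>" by (rule v_mult) (use \<gamma> \<delta> in auto)
  finally have "v \<gamma> \<otimes>\<^bsub>C\<^esub> (emb a \<otimes>\<^bsub>C\<^esub> v \<delta>) \<otimes>\<^bsub>C\<^esub> inv\<^bsub>C\<^esub> (v \<gamma>) = emb (\<theta> \<gamma> a) \<otimes>\<^bsub>C\<^esub> (?w \<otimes>\<^bsub>C\<^esub> v \<gamma>) \<otimes>\<^bsub>C\<^esub> inv\<^bsub>C\<^esub> (v \<gamma>)"
    by simp
  also have "\<dots> = emb (\<theta> \<gamma> a) \<otimes>\<^bsub>C\<^esub> ?w"
    using cl w v_unit[OF \<gamma>] by (simp add: C.m_assoc)
  finally show "\<beta> (\<iota> \<gamma>) (emb a \<otimes>\<^bsub>C\<^esub> v \<delta>) = conj_by C (v \<gamma>) (emb a \<otimes>\<^bsub>C\<^esub> v \<delta>)"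
    using \<beta>(2)[OF \<iota>_closed[OF \<gamma>] \<delta> a] cl by (simp add: C.conj_by_app cj_\<iota> \<gamma> \<delta> a \<Theta>_\<iota>)
qed (use \<gamma> \<beta>(1) \<iota>_closed v_unit C.conj_by_aut in auto)

lemma \<beta>_\<iota>_mult:
  assumes "\<gamma> \<in> carrier \<Gamma>" "E \<in> M"
  shows "\<beta> (\<iota> \<gamma> \<star> E) = compose (carrier C) (conj_by C (v \<gamma>)) (\<beta> E)"
  using assms by (simp add: \<beta>_mult \<iota>_closed \<beta>_\<iota>)

section \<open>The outer actions of \<open>Q\<close> and of \<open>G\<close> on the crossed
  product\<close>

abbreviation B where "B \<equiv> emb ` carrier A"
abbreviation Inn where "Inn \<equiv> conj_by C ` Units C"
abbreviation InnA where "InnA \<equiv> conj_by C ` emb ` Units A"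
abbreviation RelAut where "RelAut \<equiv> (aut_group C)\<lparr>carrier := rel_aut C B\<rparr>"

text \<open>Arbitrary set-theoretic sections of \<open>M\<close> over \<open>Q\<close> and over
  \<open>G\<close>. The cosets in \<open>sQ\<close> and \<open>chi\<close> do not depend on them:
  over \<open>Q\<close> all of \<Gamma> is divided out, over \<open>G\<close> only the units of
  \<open>A\<close>, whence the two different subgroups of conjugations.\<close>

definition sec where "sec r = (SOME E. E \<in> M \<and> \<pi> (pr E) = r)"
definition lift where "lift g = (SOME E. E \<in> M \<and> pr E = g)"
definition sQ where "sQ r = Inn #>\<^bsub>aut_group C\<^esub> \<beta> (sec r)"
definition chi where "chi g = InnA #>\<^bsub>RelAut\<^esub> \<beta> (lift g)"

lemma sec: "r \<in> carrier Q \<Longrightarrow> sec r \<in> M" "r \<in> carrier Q \<Longrightarrow> \<pi> (pr (sec r)) = r"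
proof -
  have "\<exists>E. E \<in> M \<and> \<pi> (pr E) = r" if "r \<in> carrier Q" using \<pi>_surj[OF that] pr_surj by blast
  from someI_ex[OF this] show "r \<in> carrier Q \<Longrightarrow> sec r \<in> M" "r \<in> carrier Q \<Longrightarrow> \<pi> (pr (sec r)) = r"
    unfolding sec_def by blast+
qed

lemma lift: "g \<in> carrier G \<Longrightarrow> lift g \<in> M" "g \<in> carrier G \<Longrightarrow> pr (lift g) = g"
proof -
  have "\<exists>E. E \<in> M \<and> pr E = g" if "g \<in> carrier G" using pr_surj[OF that] by blast
  from someI_ex[OF this] show "g \<in> carrier G \<Longrightarrow> lift g \<in> M" "g \<in> carrier G \<Longrightarrow> pr (lift g) = g"
    unfolding lift_def by blast+
qed

lemma \<beta>_rel:
  assumes E: "E \<in> M"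
  shows "\<beta> E \<in> rel_aut C B"
proof -
  have "\<beta> E ` B = emb ` \<Theta> E ` carrier A"
    by (auto simp: image_image \<beta>_emb[OF E])
  moreover have "\<Theta> E ` carrier A = carrier A"
    using ring_autD(2)[OF \<Theta>_aut[OF E]] by (simp add: bij_betw_def)
  ultimately show ?thesis using \<beta>(1)[OF E] by (simp add: rel_aut_def)
qed

lemma B_subset: "B \<subseteq> carrier C"
  using emb_closed by auto

text \<open>An automorphism preserving the image of \<open>A\<close> carries units of
  \<open>A\<close> to units of \<open>A\<close>: the image of the inverse lies in \<open>A\<close>
  as well and is inverse there, because the embedding is injective.\<close>

lemma InnA_normal: "normal InnA RelAut"
proof (rule C.conj_by_normal)
  show "subgroup (rel_aut C B) (aut_group C)" by (rule C.rel_aut_subgroup[OF B_subset])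
  interpret UC: group "units_of C" by (rule C.units_group)
  show "subgroup (emb ` Units A) (units_of C)"
  proof (rule UC.subgroupI)
    fix x assume "x \<in> emb ` Units A"
    then obtain a where a: "a \<in> Units A" "x = emb a" by auto
    show "inv\<^bsub>units_of C\<^esub> x \<in> emb ` Units A"
      unfolding a(2) C.units_of_inv[OF emb_unit(1)[OF a(1)]] emb_unit(2)[OF a(1)]
      by (rule imageI[OF Units_inv_Units[OF a(1)]])
    fix y assume "y \<in> emb ` Units A"
    then obtain b where b: "b \<in> Units A" "y = emb b" by auto
    show "x \<otimes>\<^bsub>units_of C\<^esub> y \<in> emb ` Units A"
      unfolding units_of_mult a(2) b(2) emb_simps(1)[OF Units_closed[OF a(1)] Units_closed[OF b(1)], symmetric]
      by (rule imageI[OF Units_m_closed[OF a(1) b(1)]])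
  next
    show "emb ` Units A \<subseteq> carrier (units_of C)" using emb_unit(1) by (simp add: units_of_def image_subset_iff)
    show "emb ` Units A \<noteq> {}" using Units_one_closed by blast
  qed
  show "InnA \<subseteq> rel_aut C B"
  proof
    fix x assume "x \<in> InnA"
    then obtain a where a: "a \<in> Units A" "x = conj_by C (emb a)" by auto
    then have "x = \<beta> (\<iota> (j a))" by (simp add: \<beta>_\<iota> j_closed v_j)
    then show "x \<in> rel_aut C B" using \<beta>_rel \<iota>_closed j_closed a(1) by simp
  qed
  fix \<phi> u assume \<phi>: "\<phi> \<in> rel_aut C B" and "u \<in> emb ` Units A"
  then obtain a where a: "a \<in> Units A" "u = emb a" by auto
  have aut: "\<phi> \<in> ring_aut C" and im: "\<phi> ` B = B" using \<phi> by (auto simp: rel_aut_def)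
  have ac: "a \<in> carrier A" "inv a \<in> carrier A" using a(1) by auto
  have \<phi>B: "\<phi> (emb y) \<in> B" if "y \<in> carrier A" for y
    using imageI[OF imageI[OF that], of \<phi> emb] unfolding im .
  obtain b where b: "\<phi> (emb a) = emb b" "b \<in> carrier A" using \<phi>B[OF ac(1)] by (rule imageE)
  obtain c where c: "\<phi> (emb (inv a)) = emb c" "c \<in> carrier A" using \<phi>B[OF ac(2)] by (rule imageE)
  have "\<phi> (emb (a \<otimes> inv a)) = emb b \<otimes>\<^bsub>C\<^esub> emb c" "\<phi> (emb (inv a \<otimes> a)) = emb c \<otimes>\<^bsub>C\<^esub> emb b"
    unfolding emb_simps(1)[OF ac] emb_simps(1)[OF ac(2,1)]
      ring_autD(5)[OF aut emb_closed[OF ac(1)] emb_closed[OF ac(2)]]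
      ring_autD(5)[OF aut emb_closed[OF ac(2)] emb_closed[OF ac(1)]] b(1) c(1) by simp_all
  then have "emb (b \<otimes> c) = emb \<one>" "emb (c \<otimes> b) = emb \<one>"
    using a(1) b(2) c(2) ring_autD(7)[OF aut] by (simp_all add: emb_simps)
  then have "b \<otimes> c = \<one>" "c \<otimes> b = \<one>" using inj_onD[OF emb_inj] b(2) c(2) by simp_all
  then have "b \<in> Units A" using b(2) c(2) unfolding Units_def by blast
  then show "\<phi> u \<in> emb ` Units A" using a b by auto
qed

text \<open>Two elements over the same point of \<open>Q\<close> differ by some \<gamma>, which acts
  as conjugation by \<open>v \<gamma>\<close>. The freedom to take any \<open>E\<close> turns
  multiplicativity of \<beta> into that of \<open>sQ\<close>.\<close>

lemma sQ_eq:
  assumes E: "E \<in> M"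
  shows "sQ (\<pi> (pr E)) = Inn #>\<^bsub>aut_group C\<^esub> \<beta> E"
proof -
  let ?r = "\<pi> (pr E)"
  have r: "?r \<in> carrier Q" using E by (simp add: pr_simps)
  obtain \<gamma> where \<gamma>: "\<gamma> \<in> carrier \<Gamma>" "E = \<iota> \<gamma> \<star> sec ?r" using ldiv[OF sec(1)[OF r] E sec(2)[OF r]] by blast
  have "\<beta> E = conj_by C (v \<gamma>) \<otimes>\<^bsub>aut_group C\<^esub> \<beta> (sec ?r)"
    using arg_cong[OF \<gamma>(2), of \<beta>] \<beta>_\<iota>_mult[OF \<gamma>(1) sec(1)[OF r]] by (simp add: aut_group_def)
  then show ?thesis
    unfolding sQ_def using rcoset_absorb[OF C.inner_normal, of "\<beta> (sec ?r)" "conj_by C (v \<gamma>)"]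
      \<beta>(1)[OF sec(1)[OF r]] v_unit[OF \<gamma>(1)] by (simp add: aut_group_def)
qed

text \<open>Over the same point of \<open>G\<close> the difference is j(y) with y a unit of
  \<open>A\<close>, acting as conjugation by the image of y. So already the finer coset is well
  defined.\<close>

lemma chi_eq:
  assumes E: "E \<in> M"
  shows "chi (pr E) = InnA #>\<^bsub>RelAut\<^esub> \<beta> E"
proof -
  let ?g = "pr E"
  have g: "?g \<in> carrier G" using E by (simp add: pr_simps)
  obtain y where y: "y \<in> Units A" "E = \<iota> (j y) \<star> lift ?g" using pr_eq[OF lift(1)[OF g] E lift(2)[OF g]] by blast
  have "\<beta> E = conj_by C (emb y) \<otimes>\<^bsub>RelAut\<^esub> \<beta> (lift ?g)"
    using arg_cong[OF y(2), of \<beta>] \<beta>_\<iota>_mult[OF j_closed[OF y(1)] lift(1)[OF g]] v_j[OF y(1)] by (simp add: aut_group_def)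
  then show ?thesis
    unfolding chi_def using rcoset_absorb[OF InnA_normal, of "\<beta> (lift ?g)" "conj_by C (emb y)"]
      \<beta>_rel[OF lift(1)[OF g]] y(1) by simp
qed

lemma sQ_hom: "sQ \<in> hom Q (out_group C)"
proof (rule homI)
  interpret n: normal Inn "aut_group C" by (rule C.inner_normal)
  have \<beta>c: "\<beta> (sec r) \<in> carrier (aut_group C)" if "r \<in> carrier Q" for r
    using \<beta>(1)[OF sec(1)[OF that]] by (simp add: aut_group_def)
  fix r s assume r: "r \<in> carrier Q" and s: "s \<in> carrier Q"
  show "sQ r \<in> carrier (out_group C)"
    unfolding out_group_def sQ_def FactGroup_def RCOSETS_def using \<beta>c[OF r] by auto
  have E: "sec r \<star> sec s \<in> M" "\<pi> (pr (sec r \<star> sec s)) = r \<otimes>\<^bsub>Q\<^esub> s"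
    using r s sec by (simp_all add: pr_simps)
  have "sQ (r \<otimes>\<^bsub>Q\<^esub> s) = Inn #>\<^bsub>aut_group C\<^esub> (\<beta> (sec r) \<otimes>\<^bsub>aut_group C\<^esub> \<beta> (sec s))"
    using sQ_eq[OF E(1)] E(2) \<beta>_mult[OF sec(1)[OF r] sec(1)[OF s]] by (simp add: aut_group_def)
  also have "\<dots> = sQ r <#>\<^bsub>aut_group C\<^esub> sQ s"
    unfolding sQ_def by (rule n.rcos_sum[OF \<beta>c[OF r] \<beta>c[OF s], symmetric])
  finally show "sQ (r \<otimes>\<^bsub>Q\<^esub> s) = sQ r \<otimes>\<^bsub>out_group C\<^esub> sQ s"
    by (simp add: out_group_def FactGroup_def)
qed

lemma chi_hom: "chi \<in> hom G (out_rel_group C B (emb ` Units A))"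
proof (rule homI)
  interpret n: normal InnA RelAut by (rule InnA_normal)
  have \<beta>c: "\<beta> (lift g) \<in> carrier RelAut" if "g \<in> carrier G" for g
    using \<beta>_rel[OF lift(1)[OF that]] by simp
  fix g h assume g: "g \<in> carrier G" and h: "h \<in> carrier G"
  show "chi g \<in> carrier (out_rel_group C B (emb ` Units A))"
    unfolding out_rel_group_def chi_def FactGroup_def RCOSETS_def using \<beta>c[OF g] by auto
  have E: "lift g \<star> lift h \<in> M" "pr (lift g \<star> lift h) = g \<otimes>\<^bsub>G\<^esub> h"
    using g h lift by (simp_all add: pr_simps)
  have "chi (g \<otimes>\<^bsub>G\<^esub> h) = InnA #>\<^bsub>RelAut\<^esub> (\<beta> (lift g) \<otimes>\<^bsub>RelAut\<^esub> \<beta> (lift h))"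
    using chi_eq[OF E(1)] E(2) \<beta>_mult[OF lift(1)[OF g] lift(1)[OF h]] by (simp add: aut_group_def)
  also have "\<dots> = chi g <#>\<^bsub>RelAut\<^esub> chi h"
    unfolding chi_def by (rule n.rcos_sum[OF \<beta>c[OF g] \<beta>c[OF h], symmetric])
  finally show "chi (g \<otimes>\<^bsub>G\<^esub> h) = chi g \<otimes>\<^bsub>out_rel_group C B (emb ` Units A)\<^esub> chi h"
    by (simp add: out_rel_group_def FactGroup_def)
qed

lemma sQ_elem:
  assumes "E \<in> M" "\<phi> \<in> sQ (\<pi> (pr E))"
  shows "\<exists>w\<in>Units C. \<phi> = compose (carrier C) (conj_by C w) (\<beta> E)"
  using assms unfolding sQ_eq[OF assms(1)] r_coset_def by (auto simp: aut_group_def)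

lemma chi_elem:
  assumes "E \<in> M" "\<phi> \<in> chi (pr E)"
  shows "\<exists>u\<in>Units A. \<phi> = compose (carrier C) (conj_by C (emb u)) (\<beta> E)"
  using assms unfolding chi_eq[OF assms(1)] r_coset_def by (auto simp: aut_group_def)

text \<open>On \<open>A\<close>, a member of the coset is \<Theta> E up to conjugation by a unit of
  \<open>A\<close>. Both the action on \<open>T\<close> and the restriction to Out(A) are read off
  from this.\<close>

lemma chi_elem_emb:
  assumes E: "E \<in> M" and \<phi>: "\<phi> \<in> chi (pr E)"
  shows "\<exists>u\<in>Units A. \<forall>a\<in>carrier A. \<phi> (emb a) = emb (u \<otimes> \<Theta> E a \<otimes> inv u)"
proof -
  obtain u where u: "u \<in> Units A" "\<phi> = compose (carrier C) (conj_by C (emb u)) (\<beta> E)"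
    using chi_elem[OF assms] by blast
  have "\<phi> (emb a) = emb (u \<otimes> \<Theta> E a \<otimes> inv u)" if a: "a \<in> carrier A" for a
    unfolding u(2) compose_eq[OF emb_closed[OF a]] \<beta>_emb[OF E a]
    using u(1) ring_autD(4)[OF \<Theta>_aut[OF E] a] emb_unit(2)[OF u(1)]
    by (simp add: C.conj_by_app emb_closed emb_simps Units_closed)
  then show ?thesis using u(1) by blast
qed

text \<open>Inclusion of cosets expresses that every representative of \<open>chi g\<close> has
  class \<open>sQ (\<pi> g)\<close> in Out(C); units of \<open>A\<close> are units of
  \<open>C\<close>.\<close>

lemma chi_subset_sQ:
  assumes g: "g \<in> carrier G"
  shows "chi g \<subseteq> sQ (\<pi> g)"
proof
  fix \<phi> assume "\<phi> \<in> chi g"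
  then obtain u where u: "u \<in> Units A" "\<phi> = compose (carrier C) (conj_by C (emb u)) (\<beta> (lift g))"
    using chi_elem[OF lift(1)[OF g]] lift(2)[OF g] by auto
  then have "\<phi> \<in> Inn #>\<^bsub>aut_group C\<^esub> \<beta> (lift g)"
    using emb_unit(1)[OF u(1)] unfolding r_coset_def by (auto simp: aut_group_def)
  then show "\<phi> \<in> sQ (\<pi> g)" using sQ_eq[OF lift(1)[OF g]] lift(2)[OF g] by simp
qed

text \<open>A member of the coset over \<delta> is induced by some j(u)\<delta>, again in \<Gamma>,
  so it is conjugation by a unit of \<open>C\<close>. This unit normalizes \<open>A\<close> because
  every \<beta> E preserves the image of \<open>A\<close>.\<close>

lemma chi_\<iota>_subset:
  assumes \<delta>: "\<delta> \<in> carrier \<Gamma>"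
  shows "chi (pr (\<iota> \<delta>)) \<subseteq> conj_by C ` unit_normalizer C B"
proof
  fix \<phi> assume "\<phi> \<in> chi (pr (\<iota> \<delta>))"
  then obtain u where u: "u \<in> Units A" "\<phi> = compose (carrier C) (conj_by C (emb u)) (\<beta> (\<iota> \<delta>))"
    using chi_elem[OF \<iota>_closed[OF \<delta>]] by auto
  let ?\<gamma> = "j u \<otimes>\<^bsub>\<Gamma>\<^esub> \<delta>"
  have \<gamma>: "?\<gamma> \<in> carrier \<Gamma>" using u(1) \<delta> by (simp add: j_closed)
  have "\<phi> = \<beta> (\<iota> ?\<gamma>)"
    using u \<delta> by (simp add: \<iota>_mult j_closed \<beta>_\<iota>_mult \<iota>_closed v_j)
  then have e: "\<phi> = conj_by C (v ?\<gamma>)" "\<phi> ` B = B"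
    using \<beta>_\<iota>[OF \<gamma>] \<beta>_rel[OF \<iota>_closed[OF \<gamma>]] by (simp_all add: rel_aut_def)
  then have "v ?\<gamma> \<in> unit_normalizer C B"
    using v_unit[OF \<gamma>] by (simp add: unit_normalizer_def)
  then show "\<phi> \<in> conj_by C ` unit_normalizer C B" using e(1) by blast
qed

text \<open>The section multiplies up to elements U(r,s) of \<Gamma>, and the v(U(r,s)) serve as the
  units. Both bracketings of a product of three section values are written as an element of \<Gamma>
  times the section value over abc; comparing them leaves exactly the associator.\<close>

lemma teich_data_C:
  shows "\<exists>u. C.teich_data Q (\<lambda>r. \<beta> (sec r)) u (restrict (emb \<circ> f) (triples Q))"
proof -
  have "\<exists>\<gamma>\<in>carrier \<Gamma>. sec r \<star> sec s = \<iota> \<gamma> \<star> sec (r \<otimes>\<^bsub>Q\<^esub> s)" if "r \<in> carrier Q" "s \<in> carrier Q" for r s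
    by (rule ldiv) (use that sec in \<open>simp_all add: pr_simps\<close>)
  then obtain U where U: "\<And>r s. r \<in> carrier Q \<Longrightarrow> s \<in> carrier Q \<Longrightarrow> U r s \<in> carrier \<Gamma>"
    and Ueq: "\<And>r s. r \<in> carrier Q \<Longrightarrow> s \<in> carrier Q \<Longrightarrow> sec r \<star> sec s = \<iota> (U r s) \<star> sec (r \<otimes>\<^bsub>Q\<^esub> s)"
    by metis
  have "C.teich_data Q (\<lambda>r. \<beta> (sec r)) (\<lambda>(r, s). v (U r s)) (restrict (emb \<circ> f) (triples Q))"
    unfolding C.teich_data_def
  proof (intro conjI ballI, goal_cases)
    case (1 r s)
    then show ?case using v_unit[OF U] by simp
  next
    case (2 r s x)
    have "\<beta> (sec r) (\<beta> (sec s) x) = \<beta> (sec r \<star> sec s) x"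
      unfolding \<beta>_mult[OF sec(1)[OF 2(1)] sec(1)[OF 2(2)]] using 2(3) by (simp add: compose_eq)
    also have "\<dots> = conj_by C (v (U r s)) (\<beta> (sec (r \<otimes>\<^bsub>Q\<^esub> s)) x)"
      unfolding Ueq[OF 2(1,2)] using 2 by (simp add: \<beta>_\<iota>_mult U sec compose_eq)
    finally show ?case using ring_autD(4)[OF \<beta>(1)[OF sec(1)], of "r \<otimes>\<^bsub>Q\<^esub> s" x] 2 by (simp add: C.conj_by_app)
  next
    case (3 a b c)
    let ?ab = "a \<otimes>\<^bsub>Q\<^esub> b" and ?bc = "b \<otimes>\<^bsub>Q\<^esub> c"
    have q: "?ab \<in> carrier Q" "?bc \<in> carrier Q" using 3 by auto
    note m = sec(1)[OF 3(1)] sec(1)[OF 3(2)] sec(1)[OF 3(3)] sec(1)[OF q(1)] sec(1)[OF q(2)]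
    have t: "(a, b, c) \<in> triples Q" using 3 by (simp add: triples_def)
    have fU: "f (a, b, c) \<in> Units A" using f_unit t by blast
    let ?w = "cj (sec a) (U b c)"
    have w: "?w \<in> carrier \<Gamma>" using cj(1)[OF m(1) U[OF 3(2,3)]] .
    have abc: "sec (?ab \<otimes>\<^bsub>Q\<^esub> c) \<in> M" "a \<otimes>\<^bsub>Q\<^esub> ?bc = ?ab \<otimes>\<^bsub>Q\<^esub> c"
      using 3 sec(1) by (simp_all add: Q.m_assoc)
    \<comment> \<open>Pushing U(b,c) to the left past the section value over a replaces it by its
      conjugate, which is also what \<beta> of that value does to v(U(b,c)).\<close>
    have "sec a \<star> (sec b \<star> sec c) = sec a \<star> \<iota> (U b c) \<star> sec ?bc"
      unfolding Ueq[OF 3(2,3)] using m U 3 by (simp add: assoc2)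
    also have "\<dots> = \<iota> ?w \<star> sec a \<star> sec ?bc" unfolding cj(2)[OF m(1) U[OF 3(2,3)]] ..
    also have "\<dots> = \<iota> ?w \<star> (sec a \<star> sec ?bc)" using m w by (simp add: assoc1)
    also have "\<dots> = \<iota> ?w \<star> (\<iota> (U a ?bc) \<star> sec (?ab \<otimes>\<^bsub>Q\<^esub> c))" unfolding Ueq[OF 3(1) q(2)] abc(2) ..
    also have "\<dots> = \<iota> (?w \<otimes>\<^bsub>\<Gamma>\<^esub> U a ?bc) \<star> sec (?ab \<otimes>\<^bsub>Q\<^esub> c)"
      using w U[OF 3(1) q(2)] abc(1) by (simp add: \<iota>_mult assoc1 \<iota>_closed)
    finally have L: "sec a \<star> (sec b \<star> sec c) = \<iota> (?w \<otimes>\<^bsub>\<Gamma>\<^esub> U a ?bc) \<star> sec (?ab \<otimes>\<^bsub>Q\<^esub> c)" .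
    have "sec a \<star> sec b \<star> sec c = \<iota> (U a b) \<star> (sec ?ab \<star> sec c)"
      unfolding Ueq[OF 3(1,2)] using m U[OF 3(1,2)] by (simp add: assoc1)
    also have "\<dots> = \<iota> (U a b \<otimes>\<^bsub>\<Gamma>\<^esub> U ?ab c) \<star> sec (?ab \<otimes>\<^bsub>Q\<^esub> c)"
      unfolding Ueq[OF q(1) 3(3)] using U[OF 3(1,2)] U[OF q(1) 3(3)] abc(1) by (simp add: \<iota>_mult assoc1 \<iota>_closed)
    finally have R: "sec a \<star> sec b \<star> sec c = \<iota> (U a b \<otimes>\<^bsub>\<Gamma>\<^esub> U ?ab c) \<star> sec (?ab \<otimes>\<^bsub>Q\<^esub> c)" .
    have cl: "U a b \<otimes>\<^bsub>\<Gamma>\<^esub> U ?ab c \<in> carrier \<Gamma>" using U 3 q by simp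
    have "\<iota> (?w \<otimes>\<^bsub>\<Gamma>\<^esub> U a ?bc) \<star> sec (?ab \<otimes>\<^bsub>Q\<^esub> c)
        = \<iota> (j (f (a, b, c)) \<otimes>\<^bsub>\<Gamma>\<^esub> (U a b \<otimes>\<^bsub>\<Gamma>\<^esub> U ?ab c)) \<star> sec (?ab \<otimes>\<^bsub>Q\<^esub> c)"
      using associator[OF m(1-3)] unfolding L R sec(2)[OF 3(1)] sec(2)[OF 3(2)] sec(2)[OF 3(3)]
        \<iota>_mult[OF j_closed[OF fU] cl] assoc1[OF j_closed[OF fU] \<iota>_closed[OF cl] abc(1)] .
    \<comment> \<open>Cancelling the common right factor in \<open>M\<close> gives an identity
      inside the group \<Gamma>, where \<open>v\<close> is multiplicative.\<close>
    then have "?w \<otimes>\<^bsub>\<Gamma>\<^esub> U a ?bc = j (f (a, b, c)) \<otimes>\<^bsub>\<Gamma>\<^esub> (U a b \<otimes>\<^bsub>\<Gamma>\<^esub> U ?ab c)"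
      using lcancel[OF abc(1)] w U[OF 3(1) q(2)] cl j_closed[OF fU] by simp
    then have "v (?w \<otimes>\<^bsub>\<Gamma>\<^esub> U a ?bc) = v (j (f (a, b, c)) \<otimes>\<^bsub>\<Gamma>\<^esub> (U a b \<otimes>\<^bsub>\<Gamma>\<^esub> U ?ab c))" by simp
    then have "v ?w \<otimes>\<^bsub>C\<^esub> v (U a ?bc) = emb (f (a, b, c)) \<otimes>\<^bsub>C\<^esub> (v (U a b) \<otimes>\<^bsub>C\<^esub> v (U ?ab c))"
      using w U[OF 3(1) q(2)] U[OF 3(1,2)] U[OF q(1) 3(3)] j_closed[OF fU] v_j[OF fU] by (simp add: v_mult)
    then show ?case using t \<beta>_v[OF m(1) U[OF 3(2,3)]] U[OF 3(1,2)] U[OF q(1) 3(3)] fU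
      by (simp add: C.m_assoc emb_closed Units_closed v_closed)
  qed
  then show ?thesis by blast
qed

text \<open>Transport along the embedding: central units of \<open>C\<close> are units of
  \<open>S\<close>, and the chosen automorphisms act on them through \<kappa>, so 2-cochains and
  their coboundaries correspond.\<close>

lemma teich_class_C:
  assumes S: "S \<subseteq> carrier A" and center: "ring_center C = emb ` S"
    and \<kappa>: "\<And>E s. E \<in> M \<Longrightarrow> s \<in> S \<Longrightarrow> \<Theta> E s = \<kappa> (\<pi> (pr E)) s"
    and \<kappa>_closed: "\<And>r s. r \<in> carrier Q \<Longrightarrow> s \<in> S \<Longrightarrow> \<kappa> r s \<in> S"
    and fS: "\<And>x. x \<in> triples Q \<Longrightarrow> f x \<in> S"
  shows "teich_class C Q sQ = (\<lambda>f. restrict (emb \<circ> f) (triples Q)) ` cohom_class3 A Q (Units (A\<lparr>carrier := S\<rparr>)) \<kappa> f"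
proof -
  let ?SU = "Units (A\<lparr>carrier := S\<rparr>)" and ?\<alpha> = "\<lambda>r. \<beta> (sec r)" and ?f = "restrict (emb \<circ> f) (triples Q)"
  obtain u where u: "C.teich_data Q ?\<alpha> u ?f" using teich_data_C by blast
  have "teich_class C Q sQ = cohom_class3 C Q (Units C \<inter> ring_center C) ?\<alpha> ?f"
  proof (rule C.teich_class_eq_cohom_class[OF Q.group_axioms u])
    show "?f \<in> triples Q \<rightarrow>\<^sub>E ring_center C" unfolding center using fS by auto
  qed (simp_all add: sQ_def \<beta>(1) sec(1))
  also have "\<dots> = (\<lambda>f. restrict (emb \<circ> f) (triples Q)) ` cohom_class3 A Q ?SU \<kappa> f"
  proof -
    have SU: "s \<in> Units A" "s \<in> S" if "s \<in> ?SU" for s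
      using that S unfolding Units_def by auto
    have unitC: "Units C \<inter> ring_center C = emb ` ?SU"
    proof (rule equalityI; rule subsetI)
      fix z assume "z \<in> emb ` ?SU"
      then show "z \<in> Units C \<inter> ring_center C" unfolding center using SU emb_unit(1) by blast
    next
      fix z assume z: "z \<in> Units C \<inter> ring_center C"
      then obtain s where s: "s \<in> S" "z = emb s" unfolding center by blast
      \<comment> \<open>A central unit must come from a unit of \<open>S\<close>, not just from an
        element of \<open>S\<close>; its inverse is central too and therefore also comes from
        \<open>S\<close>.\<close>
      have "inv\<^bsub>C\<^esub> z \<in> ring_center C" using C.ring_center_inv z by blast
      then obtain t where t: "t \<in> S" "inv\<^bsub>C\<^esub> z = emb t" unfolding center by blast
      have c: "s \<in> carrier A" "t \<in> carrier A" using s t S by auto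
      have "emb s \<otimes>\<^bsub>C\<^esub> emb t = \<one>\<^bsub>C\<^esub>" "emb t \<otimes>\<^bsub>C\<^esub> emb s = \<one>\<^bsub>C\<^esub>"
        using C.Units_r_inv[of z] C.Units_l_inv[of z] z unfolding s(2)[symmetric] t(2)[symmetric] by simp_all
      then have "emb (s \<otimes> t) = emb \<one>" "emb (t \<otimes> s) = emb \<one>" using c by (simp_all add: emb_simps)
      then have "s \<otimes> t = \<one>" "t \<otimes> s = \<one>" using inj_onD[OF emb_inj] c by simp_all
      then have "s \<in> ?SU" using s t unfolding Units_def by auto
      then show "z \<in> emb ` ?SU" using s by blast
    qed
    have cob: "restrict (\<lambda>x. ?f x \<otimes>\<^bsub>C\<^esub> coboundary2 C Q ?\<alpha> h' x) (triples Q)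
        = restrict (emb \<circ> restrict (\<lambda>x. f x \<otimes> coboundary2 A Q \<kappa> h x) (triples Q)) (triples Q)"
      if h: "h \<in> carrier Q \<times> carrier Q \<rightarrow> ?SU" and hh: "\<And>r s. r \<in> carrier Q \<Longrightarrow> s \<in> carrier Q \<Longrightarrow> h' (r, s) = emb (h (r, s))"
      for h h'
    proof (rule restrict_ext)
      fix x assume x: "x \<in> triples Q"
      then obtain a b c where abc: "x = (a, b, c)" "a \<in> carrier Q" "b \<in> carrier Q" "c \<in> carrier Q"
        by (auto simp: triples_def)
      have hU: "h (r, s) \<in> Units A" "h (r, s) \<in> S" "h (r, s) \<in> carrier A" if "r \<in> carrier Q" "s \<in> carrier Q" for r s
        using h that SU Units_closed by blast+
      have k: "\<beta> (sec a) (emb (h (b, c))) = emb (\<kappa> a (h (b, c)))" "\<kappa> a (h (b, c)) \<in> carrier A"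
        using \<beta>_emb[OF sec(1)[OF abc(2)] hU(3)[OF abc(3,4)]] \<kappa>[OF sec(1)[OF abc(2)] hU(2)[OF abc(3,4)]]
          sec(2)[OF abc(2)] \<kappa>_closed[OF abc(2) hU(2)[OF abc(3,4)]] S by auto
      have fx: "f (a, b, c) \<in> carrier A" using fS[OF x] S abc by auto
      show "?f x \<otimes>\<^bsub>C\<^esub> coboundary2 C Q ?\<alpha> h' x
          = (emb \<circ> restrict (\<lambda>x. f x \<otimes> coboundary2 A Q \<kappa> h x) (triples Q)) x"
        using x abc(2-4) hU k fx unfolding abc(1)
        by (simp add: coboundary2_def hh emb_simps emb_unit(2))
    qed
    show ?thesis
    proof (rule equalityI; rule subsetI)
      fix F assume "F \<in> cohom_class3 C Q (Units C \<inter> ring_center C) ?\<alpha> ?f"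
      then obtain h' where h': "h' \<in> carrier Q \<times> carrier Q \<rightarrow>\<^sub>E Units C \<inter> ring_center C"
        and F: "F = restrict (\<lambda>x. ?f x \<otimes>\<^bsub>C\<^esub> coboundary2 C Q ?\<alpha> h' x) (triples Q)"
        unfolding cohom_class3_def by blast
      have "\<forall>x\<in>carrier Q \<times> carrier Q. \<exists>s\<in>?SU. h' x = emb s"
        using h' unfolding unitC by (auto simp: PiE_def Pi_def image_iff)
      then obtain h where h: "\<And>x. x \<in> carrier Q \<times> carrier Q \<Longrightarrow> h x \<in> ?SU \<and> h' x = emb (h x)" by metis
      let ?h = "restrict h (carrier Q \<times> carrier Q)"
      have hE: "?h \<in> carrier Q \<times> carrier Q \<rightarrow>\<^sub>E ?SU" using h by auto
      have "F = restrict (emb \<circ> restrict (\<lambda>x. f x \<otimes> coboundary2 A Q \<kappa> ?h x) (triples Q)) (triples Q)"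
        unfolding F by (rule cob) (use h in auto)
      then show "F \<in> (\<lambda>f. restrict (emb \<circ> f) (triples Q)) ` cohom_class3 A Q ?SU \<kappa> f"
        unfolding cohom_class3_def using hE by blast
    next
      fix F assume "F \<in> (\<lambda>f. restrict (emb \<circ> f) (triples Q)) ` cohom_class3 A Q ?SU \<kappa> f"
      then obtain h where h: "h \<in> carrier Q \<times> carrier Q \<rightarrow>\<^sub>E ?SU"
        and F: "F = restrict (emb \<circ> restrict (\<lambda>x. f x \<otimes> coboundary2 A Q \<kappa> h x) (triples Q)) (triples Q)"
        unfolding cohom_class3_def by blast
      let ?h = "restrict (emb \<circ> h) (carrier Q \<times> carrier Q)"
      have hP: "h \<in> carrier Q \<times> carrier Q \<rightarrow> ?SU" using h by (simp add: PiE_def)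
      have "F = restrict (\<lambda>x. ?f x \<otimes>\<^bsub>C\<^esub> coboundary2 C Q ?\<alpha> ?h x) (triples Q)"
        unfolding F by (rule cob[OF hP, symmetric]) simp
      moreover have "?h \<in> carrier Q \<times> carrier Q \<rightarrow>\<^sub>E Units C \<inter> ring_center C"
        unfolding unitC using hP by (auto simp: Pi_def)
      ultimately show "F \<in> cohom_class3 C Q (Units C \<inter> ring_center C) ?\<alpha> ?f"
        unfolding cohom_class3_def by blast
    qed
  qed
  finally show ?thesis .
qed

end

section \<open>The quasigroup of a factor system\<close>

text \<open>\<open>N\<close> is an abstract group with an embedding \<open>e\<close> onto the kernel
  of \<pi>: in the application \<open>N\<close> consists of automorphisms of \<open>T\<close>, the
  kernel of pairs with trivial second entry. The obstruction is pulled back from \<open>Q\<close>,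
  and its normalization there makes the kernel nuclear.\<close>

locale factor_system = ring A + G: group G + Q: group Q + N: group N
  for A :: "('a,'b) ring_scheme" (structure) and G :: "('g,'c) monoid_scheme"
    and Q :: "('q,'d) monoid_scheme" and N :: "('n,'e) monoid_scheme" +
  fixes \<alpha> :: "'g \<Rightarrow> 'a \<Rightarrow> 'a" and u :: "'g \<times> 'g \<Rightarrow> 'a" and f :: "'q \<times> 'q \<times> 'q \<Rightarrow> 'a"
    and \<pi> :: "'g \<Rightarrow> 'q" and e :: "'n \<Rightarrow> 'g"
  assumes \<alpha>_aut: "g \<in> carrier G \<Longrightarrow> \<alpha> g \<in> ring_aut A"
    and data: "teich_data G \<alpha> u (\<lambda>(a, b, c). f (\<pi> a, \<pi> b, \<pi> c))"
    and f_units: "f \<in> triples Q \<rightarrow>\<^sub>E Units A"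
    and f_center: "x \<in> triples Q \<Longrightarrow> f x \<in> ring_center A"
    and f_normalized: "r \<in> carrier Q \<Longrightarrow> s \<in> carrier Q \<Longrightarrow> f (\<one>\<^bsub>Q\<^esub>, r, s) = \<one>"
      "r \<in> carrier Q \<Longrightarrow> s \<in> carrier Q \<Longrightarrow> f (r, \<one>\<^bsub>Q\<^esub>, s) = \<one>"
      "r \<in> carrier Q \<Longrightarrow> s \<in> carrier Q \<Longrightarrow> f (r, s, \<one>\<^bsub>Q\<^esub>) = \<one>"
    and \<pi>_hom': "\<pi> \<in> hom G Q"
    and \<pi>_surj': "r \<in> carrier Q \<Longrightarrow> \<exists>g\<in>carrier G. \<pi> g = r"
    and e_hom: "e \<in> hom N G" and e_inj: "inj_on e (carrier N)"
    and e_img: "e ` carrier N = {g \<in> carrier G. \<pi> g = \<one>\<^bsub>Q\<^esub>}"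
begin

definition mul :: "'a \<times> 'g \<Rightarrow> 'a \<times> 'g \<Rightarrow> 'a \<times> 'g" (infixl \<open>\<star>\<close> 70) where
  "E \<star> F = (fst E \<otimes> \<alpha> (snd E) (fst F) \<otimes> u (snd E, snd F), snd E \<otimes>\<^bsub>G\<^esub> snd F)"

definition M where "M = Units A \<times> carrier G"

definition \<iota> :: "'a \<times> 'n \<Rightarrow> 'a \<times> 'g" where "\<iota> \<gamma> = (fst \<gamma>, e (snd \<gamma>))"

text \<open>Section and units are not normalized over the neutral element of \<open>G\<close>:
  \<alpha>_1 is conjugation by \<open>u1\<close>. The neutral element of \<Gamma> and the embedding
  of U(A) therefore carry the factor \<open>inv u1\<close>.\<close>

abbreviation u1 where "u1 \<equiv> u (\<one>\<^bsub>G\<^esub>, \<one>\<^bsub>G\<^esub>)"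

definition \<Gamma> :: "('a \<times> 'n) monoid" where
  "\<Gamma> = \<lparr>carrier = Units A \<times> carrier N,
    monoid.mult = (\<lambda>\<gamma> \<delta>. (fst (\<iota> \<gamma> \<star> \<iota> \<delta>), snd \<gamma> \<otimes>\<^bsub>N\<^esub> snd \<delta>)),
    one = (inv u1, \<one>\<^bsub>N\<^esub>)\<rparr>"

definition \<Theta> where "\<Theta> E = compose (carrier A) (conj_by A (fst E)) (\<alpha> (snd E))"
definition \<theta> where "\<theta> \<gamma> = \<Theta> (\<iota> \<gamma>)"
definition j where "j t = (t \<otimes> inv u1, \<one>\<^bsub>N\<^esub>)"

lemmas \<alpha>_simps = ring_autD(4,5,7)[OF \<alpha>_aut]
lemmas \<alpha>_unit = ring_aut_unit[OF ring_axioms \<alpha>_aut]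
lemmas u_unit = teich_dataD(1)[OF data]
lemmas \<alpha>\<alpha> = teich_dataD(2)[OF data]

lemma \<pi>_closed': "g \<in> carrier G \<Longrightarrow> \<pi> g \<in> carrier Q"
  using \<pi>_hom' by (auto simp: hom_def)

lemma \<pi>_mult': "g \<in> carrier G \<Longrightarrow> h \<in> carrier G \<Longrightarrow> \<pi> (g \<otimes>\<^bsub>G\<^esub> h) = \<pi> g \<otimes>\<^bsub>Q\<^esub> \<pi> h"
  using \<pi>_hom' by (auto simp: hom_def)

lemma \<pi>_one': "\<pi> \<one>\<^bsub>G\<^esub> = \<one>\<^bsub>Q\<^esub>"
  using \<pi>_hom' G.group_axioms Q.group_axioms by (rule hom_one)

lemma \<pi>_inv':
  assumes "g \<in> carrier G"
  shows "\<pi> (inv\<^bsub>G\<^esub> g) = inv\<^bsub>Q\<^esub> (\<pi> g)"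
proof (rule Q.inv_equality[symmetric])
  have "\<pi> (inv\<^bsub>G\<^esub> g) \<otimes>\<^bsub>Q\<^esub> \<pi> g = \<pi> (inv\<^bsub>G\<^esub> g \<otimes>\<^bsub>G\<^esub> g)" using assms by (simp only: \<pi>_mult' G.inv_closed)
  then show "\<pi> (inv\<^bsub>G\<^esub> g) \<otimes>\<^bsub>Q\<^esub> \<pi> g = \<one>\<^bsub>Q\<^esub>" using assms by (simp add: \<pi>_one')
qed (use assms in \<open>simp_all add: \<pi>_closed'\<close>)

lemma f_closed: "a \<in> carrier G \<Longrightarrow> b \<in> carrier G \<Longrightarrow> c \<in> carrier G \<Longrightarrow> f (\<pi> a, \<pi> b, \<pi> c) \<in> Units A"
  using f_units \<pi>_closed' by (auto simp: triples_def PiE_def Pi_def)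

lemma u_cocycle:
  "a \<in> carrier G \<Longrightarrow> b \<in> carrier G \<Longrightarrow> c \<in> carrier G \<Longrightarrow>
    \<alpha> a (u (b, c)) \<otimes> u (a, b \<otimes>\<^bsub>G\<^esub> c) = f (\<pi> a, \<pi> b, \<pi> c) \<otimes> u (a, b) \<otimes> u (a \<otimes>\<^bsub>G\<^esub> b, c)"
  using teich_dataD(3)[OF data] by simp

lemma e_closed: "n \<in> carrier N \<Longrightarrow> e n \<in> carrier G"
  using e_hom by (auto simp: hom_def)

lemma e_mult: "n \<in> carrier N \<Longrightarrow> m \<in> carrier N \<Longrightarrow> e (n \<otimes>\<^bsub>N\<^esub> m) = e n \<otimes>\<^bsub>G\<^esub> e m"
  using e_hom by (auto simp: hom_def)

lemma e_one: "e \<one>\<^bsub>N\<^esub> = \<one>\<^bsub>G\<^esub>"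
  using e_hom N.group_axioms G.group_axioms by (rule hom_one)

lemma \<pi>_e: "n \<in> carrier N \<Longrightarrow> \<pi> (e n) = \<one>\<^bsub>Q\<^esub>"
  using e_img by blast

lemma \<pi>_ker:
  assumes "g \<in> carrier G" "\<pi> g = \<one>\<^bsub>Q\<^esub>"
  shows "\<exists>n\<in>carrier N. e n = g"
proof -
  have "g \<in> e ` carrier N" unfolding e_img using assms by simp
  then show ?thesis by blast
qed

lemma u1: "u1 \<in> Units A" "u1 \<in> carrier A" "inv u1 \<in> Units A" "inv u1 \<in> carrier A"
  using u_unit[OF G.one_closed G.one_closed] by auto

text \<open>Cancel \<alpha>_1 in \<alpha>_1 \<alpha>_1 = \<partial>(u(1,1)) \<alpha>_1, using that
  it is surjective.\<close>

lemma \<alpha>_one: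
  assumes "x \<in> carrier A"
  shows "\<alpha> \<one>\<^bsub>G\<^esub> x = u1 \<otimes> x \<otimes> inv u1"
proof -
  obtain y where y: "y \<in> carrier A" "\<alpha> \<one>\<^bsub>G\<^esub> y = x" using ring_aut_surj[OF \<alpha>_aut[OF G.one_closed] assms] .
  then show ?thesis using \<alpha>\<alpha>[OF G.one_closed G.one_closed y(1)] by simp
qed

lemma unit_r_cancel:
  "z \<in> Units A \<Longrightarrow> x \<in> carrier A \<Longrightarrow> y \<in> carrier A \<Longrightarrow> x \<otimes> z = y \<otimes> z \<longleftrightarrow> x = y"
proof
  assume z: "z \<in> Units A" and x: "x \<in> carrier A" and y: "y \<in> carrier A" and "x \<otimes> z = y \<otimes> z"
  then have "x \<otimes> z \<otimes> inv z = y \<otimes> z \<otimes> inv z" by simp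
  then show "x = y" using x y z by (simp add: m_assoc Units_closed)
qed auto

text \<open>The cocycle relation at (1, 1, a), where the normalized \<open>f\<close> is 1, combined
  with the formula for \<alpha>_1.\<close>

lemma u_one_left:
  assumes a: "a \<in> carrier G"
  shows "u (\<one>\<^bsub>G\<^esub>, a) = u1"
proof -
  let ?w = "u (\<one>\<^bsub>G\<^esub>, a)"
  have w: "?w \<in> Units A" "?w \<in> carrier A" using u_unit[OF G.one_closed a] by auto
  have "\<alpha> \<one>\<^bsub>G\<^esub> ?w \<otimes> ?w = u1 \<otimes> ?w"
    using u_cocycle[OF G.one_closed G.one_closed a] a u1 by (simp add: \<pi>_one' f_normalized \<pi>_closed')
  then have "u1 \<otimes> ?w \<otimes> inv u1 = u1"
    using unit_r_cancel[OF w(1)] u1 w by (simp add: \<alpha>_one)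
  then have "u1 \<otimes> ?w = u1 \<otimes> u1" using unit_r_cancel[OF u1(3), of "u1 \<otimes> ?w" "u1 \<otimes> u1"] u1 w by (simp add: m_assoc)
  then have "inv u1 \<otimes> (u1 \<otimes> ?w) = inv u1 \<otimes> (u1 \<otimes> u1)" by simp
  then show ?thesis using u1 w by (simp add: inv_cancel)
qed

text \<open>The cocycle relation at (a, 1, 1), where u(a,1) cancels on the right.\<close>

lemma u_one_right:
  assumes a: "a \<in> carrier G"
  shows "u (a, \<one>\<^bsub>G\<^esub>) = \<alpha> a u1"
proof -
  let ?w = "u (a, \<one>\<^bsub>G\<^esub>)"
  have w: "?w \<in> Units A" "?w \<in> carrier A" using u_unit[OF a G.one_closed] by auto
  have "\<alpha> a u1 \<otimes> ?w = ?w \<otimes> ?w"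
    using u_cocycle[OF a G.one_closed G.one_closed] a w by (simp add: \<pi>_one' f_normalized \<pi>_closed')
  then show ?thesis using unit_r_cancel[OF w(1), of "\<alpha> a u1" ?w] w \<alpha>_simps(1)[OF a u1(2)] by simp
qed

section \<open>The product on \<open>M\<close>, its associator and the group over the kernel\<close>

lemma mul_closed: "E \<in> M \<Longrightarrow> F \<in> M \<Longrightarrow> E \<star> F \<in> M"
  by (auto simp: M_def mul_def u_unit \<alpha>_unit)

lemma \<iota>_closed: "\<gamma> \<in> carrier \<Gamma> \<Longrightarrow> \<iota> \<gamma> \<in> M"
  by (auto simp: \<Gamma>_def M_def \<iota>_def e_closed)

lemma \<iota>_mult: "\<gamma> \<in> carrier \<Gamma> \<Longrightarrow> \<delta> \<in> carrier \<Gamma> \<Longrightarrow> \<iota> (\<gamma> \<otimes>\<^bsub>\<Gamma>\<^esub> \<delta>) = \<iota> \<gamma> \<star> \<iota> \<delta>"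
  by (auto simp: \<Gamma>_def \<iota>_def mul_def e_mult)

lemma \<iota>_inj: "\<gamma> \<in> carrier \<Gamma> \<Longrightarrow> \<delta> \<in> carrier \<Gamma> \<Longrightarrow> \<iota> \<gamma> = \<iota> \<delta> \<Longrightarrow> \<gamma> = \<delta>"
  using inj_onD[OF e_inj] by (auto simp: \<Gamma>_def \<iota>_def)

text \<open>After expansion the two sides differ by \<alpha>_a(u(b,c)) u(a,bc) against u(a,b)
  u(ab,c), which is the obstruction; being central, it moves to the front.\<close>

lemma mul_assoc:
  assumes E: "E \<in> M" and F: "F \<in> M" and H: "H \<in> M"
  shows "E \<star> (F \<star> H) = (f (\<pi> (snd E), \<pi> (snd F), \<pi> (snd H)) \<otimes> fst (E \<star> F \<star> H), snd (E \<star> F \<star> H))"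
proof -
  obtain x a y b z c where eq: "E = (x, a)" "F = (y, b)" "H = (z, c)" by (metis surj_pair)
  have x: "x \<in> Units A" "y \<in> Units A" "z \<in> Units A" and g: "a \<in> carrier G" "b \<in> carrier G" "c \<in> carrier G"
    using assms by (auto simp: eq M_def)
  let ?ab = "a \<otimes>\<^bsub>G\<^esub> b" and ?bc = "b \<otimes>\<^bsub>G\<^esub> c" and ?f = "f (\<pi> a, \<pi> b, \<pi> c)"
  have q: "?ab \<in> carrier G" "?bc \<in> carrier G" using g by auto
  note xc = Units_closed[OF x(1)] Units_closed[OF x(2)] Units_closed[OF x(3)]
  have fC: "?f \<in> ring_center A" using f_center g \<pi>_closed' by (simp add: triples_def)
  note fc = ring_centerD(1)[OF fC]
  note uc = u_unit[OF g(1,2)] u_unit[OF g(2,3)] u_unit[OF g(1) q(2)] u_unit[OF q(1) g(3)]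
  note ac = \<alpha>_simps(1)[OF g(1) xc(2)] \<alpha>_simps(1)[OF g(2) xc(3)] \<alpha>_simps(1)[OF q(1) xc(3)]
    \<alpha>_simps(1)[OF g(1) Units_closed[OF uc(2)]] \<alpha>_simps(1)[OF g(1) \<alpha>_simps(1)[OF g(2) xc(3)]]
  have "x \<otimes> \<alpha> a (y \<otimes> \<alpha> b z \<otimes> u (b, c)) \<otimes> u (a, ?bc)
      = x \<otimes> \<alpha> a y \<otimes> \<alpha> a (\<alpha> b z) \<otimes> (\<alpha> a (u (b, c)) \<otimes> u (a, ?bc))"
    using xc ac uc g by (simp add: \<alpha>_simps m_assoc Units_closed)
  also have "\<dots> = x \<otimes> \<alpha> a y \<otimes> (u (a, b) \<otimes> \<alpha> ?ab z \<otimes> inv (u (a, b))) \<otimes> (?f \<otimes> u (a, b) \<otimes> u (?ab, c))"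
    unfolding \<alpha>\<alpha>[OF g(1,2) xc(3)] u_cocycle[OF g] ..
  also have "\<dots> = (x \<otimes> \<alpha> a y \<otimes> (u (a, b) \<otimes> \<alpha> ?ab z \<otimes> inv (u (a, b))) \<otimes> ?f) \<otimes> (u (a, b) \<otimes> u (?ab, c))"
    using xc ac uc fc by (simp add: m_assoc Units_closed)
  also have "\<dots> = (?f \<otimes> (x \<otimes> \<alpha> a y \<otimes> (u (a, b) \<otimes> \<alpha> ?ab z \<otimes> inv (u (a, b))))) \<otimes> (u (a, b) \<otimes> u (?ab, c))"
    using xc ac uc by (subst ring_centerD(2)[OF fC]) (simp_all add: Units_closed)
  also have "\<dots> = ?f \<otimes> (x \<otimes> \<alpha> a y \<otimes> u (a, b) \<otimes> \<alpha> ?ab z \<otimes> u (?ab, c))"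
    using xc ac uc fc by (simp add: m_assoc Units_closed inv_cancel)
  finally show ?thesis using g by (simp add: eq mul_def G.m_assoc)
qed

text \<open>Normalization of \<open>f\<close> at work: once a factor lies over the kernel of \<pi>,
  the associator is 1.\<close>

lemma mul_assoc_normalized:
  assumes E: "E \<in> M" and F: "F \<in> M" and H: "H \<in> M"
    and "\<pi> (snd E) = \<one>\<^bsub>Q\<^esub> \<or> \<pi> (snd F) = \<one>\<^bsub>Q\<^esub> \<or> \<pi> (snd H) = \<one>\<^bsub>Q\<^esub>"
  shows "E \<star> (F \<star> H) = E \<star> F \<star> H"
proof -
  have "f (\<pi> (snd E), \<pi> (snd F), \<pi> (snd H)) = \<one>"
    using assms f_normalized \<pi>_closed' by (auto simp: M_def)
  moreover have "fst (E \<star> F \<star> H) \<in> carrier A"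
    using mul_closed[OF mul_closed[OF E F] H] by (auto simp: M_def Units_closed)
  ultimately show ?thesis unfolding mul_assoc[OF E F H] by simp
qed

lemma j_closed': "t \<in> Units A \<Longrightarrow> j t \<in> carrier \<Gamma>"
  using u1 by (simp add: j_def \<Gamma>_def)

text \<open>The correction in \<open>j\<close> cancels against \<alpha>_1 and u(1,a) =
  u(1,1).\<close>

lemma \<iota>_j_mul:
  assumes t: "t \<in> Units A" and E: "E \<in> M"
  shows "\<iota> (j t) \<star> E = (t \<otimes> fst E, snd E)"
proof -
  obtain x a where eq: "E = (x, a)" by (metis surj_pair)
  have x: "x \<in> carrier A" "a \<in> carrier G" using E by (auto simp: eq M_def Units_closed)
  show ?thesis using x t u1
    by (simp add: eq \<iota>_def j_def mul_def e_one \<alpha>_one u_one_left[OF x(2)] m_assoc inv_cancel Units_closed)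
qed

text \<open>On this side u(a,1) = \<alpha>_a(u(1,1)) cancels the correction.\<close>

lemma mul_\<iota>_j:
  assumes t: "t \<in> Units A" and E: "E \<in> M"
  shows "E \<star> \<iota> (j t) = (fst E \<otimes> \<alpha> (snd E) t, snd E)"
proof -
  obtain x a where eq: "E = (x, a)" by (metis surj_pair)
  have x: "x \<in> carrier A" "a \<in> carrier G" using E by (auto simp: eq M_def Units_closed)
  have "\<alpha> a (t \<otimes> inv u1) \<otimes> \<alpha> a u1 = \<alpha> a t"
    using \<alpha>_simps(2)[OF x(2), of "t \<otimes> inv u1" u1, symmetric] t u1 by (simp add: m_assoc Units_closed)
  then show ?thesis using x t u1 \<alpha>_simps(1)[OF x(2)]
    by (simp add: eq \<iota>_def j_def mul_def e_one u_one_right[OF x(2)] m_assoc Units_closed)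
qed

text \<open>Associativity is tested in \<open>M\<close> after the injection \<iota>, where it holds
  over the kernel.\<close>

lemma \<Gamma>_group: "group \<Gamma>"
proof (rule groupI)
  have cl: "\<gamma> \<otimes>\<^bsub>\<Gamma>\<^esub> \<delta> \<in> carrier \<Gamma>" if "\<gamma> \<in> carrier \<Gamma>" "\<delta> \<in> carrier \<Gamma>" for \<gamma> \<delta>
    using mul_closed[OF \<iota>_closed[OF that(1)] \<iota>_closed[OF that(2)]] that by (auto simp: \<Gamma>_def M_def)
  then show "\<And>\<gamma> \<delta>. \<gamma> \<in> carrier \<Gamma> \<Longrightarrow> \<delta> \<in> carrier \<Gamma> \<Longrightarrow> \<gamma> \<otimes>\<^bsub>\<Gamma>\<^esub> \<delta> \<in> carrier \<Gamma>" .
  show o: "\<one>\<^bsub>\<Gamma>\<^esub> \<in> carrier \<Gamma>" using u1 by (simp add: \<Gamma>_def)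
  have oj: "\<one>\<^bsub>\<Gamma>\<^esub> = j \<one>" using u1 by (simp add: \<Gamma>_def j_def)
  have snd_\<iota>: "\<pi> (snd (\<iota> \<gamma>)) = \<one>\<^bsub>Q\<^esub>" if "\<gamma> \<in> carrier \<Gamma>" for \<gamma> using that by (auto simp: \<Gamma>_def \<iota>_def \<pi>_e)
  fix \<gamma> assume \<gamma>: "\<gamma> \<in> carrier \<Gamma>"
  show "\<one>\<^bsub>\<Gamma>\<^esub> \<otimes>\<^bsub>\<Gamma>\<^esub> \<gamma> = \<gamma>"
  proof (rule \<iota>_inj[OF cl[OF o \<gamma>] \<gamma>])
    have "fst (\<iota> \<gamma>) \<in> carrier A" using \<gamma> by (auto simp: \<Gamma>_def \<iota>_def Units_closed)
    then show "\<iota> (\<one>\<^bsub>\<Gamma>\<^esub> \<otimes>\<^bsub>\<Gamma>\<^esub> \<gamma>) = \<iota> \<gamma>"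
      using \<iota>_j_mul[OF Units_one_closed \<iota>_closed[OF \<gamma>]] unfolding \<iota>_mult[OF o \<gamma>] unfolding oj by simp
  qed
  show "\<exists>\<delta>\<in>carrier \<Gamma>. \<delta> \<otimes>\<^bsub>\<Gamma>\<^esub> \<gamma> = \<one>\<^bsub>\<Gamma>\<^esub>"
  proof -
    obtain x n where eq: "\<gamma> = (x, n)" by (metis surj_pair)
    have x: "x \<in> Units A" "n \<in> carrier N" using \<gamma> by (auto simp: eq \<Gamma>_def)
    let ?m = "inv\<^bsub>N\<^esub> n"
    have m: "?m \<in> carrier N" using x by simp
    let ?p = "\<alpha> (e ?m) x" and ?r = "u (e ?m, e n)"
    have p: "?p \<in> Units A" "?r \<in> Units A" using \<alpha>_unit(1)[OF e_closed[OF m] x(1)] u_unit e_closed m x(2) by auto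
    \<comment> \<open>Solves y p r = inv u(1,1), the first component of the neutral element; a left
      inverse is enough.\<close>
    let ?y = "inv u1 \<otimes> inv ?r \<otimes> inv ?p"
    have y: "(?y, ?m) \<in> carrier \<Gamma>" using u1 p m by (simp add: \<Gamma>_def)
    have "(?y, ?m) \<otimes>\<^bsub>\<Gamma>\<^esub> \<gamma> = \<one>\<^bsub>\<Gamma>\<^esub>"
      using u1 p x(2) by (simp add: eq \<Gamma>_def mul_def \<iota>_def m_assoc Units_closed inv_cancel)
    then show ?thesis using y by blast
  qed
  fix \<delta> \<epsilon> assume \<delta>: "\<delta> \<in> carrier \<Gamma>" and \<epsilon>: "\<epsilon> \<in> carrier \<Gamma>"
  show "\<gamma> \<otimes>\<^bsub>\<Gamma>\<^esub> \<delta> \<otimes>\<^bsub>\<Gamma>\<^esub> \<epsilon> = \<gamma> \<otimes>\<^bsub>\<Gamma>\<^esub> (\<delta> \<otimes>\<^bsub>\<Gamma>\<^esub> \<epsilon>)"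
  proof (rule \<iota>_inj[OF cl[OF cl[OF \<gamma> \<delta>] \<epsilon>] cl[OF \<gamma> cl[OF \<delta> \<epsilon>]]])
    show "\<iota> (\<gamma> \<otimes>\<^bsub>\<Gamma>\<^esub> \<delta> \<otimes>\<^bsub>\<Gamma>\<^esub> \<epsilon>) = \<iota> (\<gamma> \<otimes>\<^bsub>\<Gamma>\<^esub> (\<delta> \<otimes>\<^bsub>\<Gamma>\<^esub> \<epsilon>))"
      unfolding \<iota>_mult[OF cl[OF \<gamma> \<delta>] \<epsilon>] \<iota>_mult[OF \<gamma> \<delta>] \<iota>_mult[OF \<gamma> cl[OF \<delta> \<epsilon>]] \<iota>_mult[OF \<delta> \<epsilon>]
      by (rule mul_assoc_normalized[symmetric]) (use \<gamma> \<delta> \<epsilon> \<iota>_closed snd_\<iota> in auto)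
  qed
qed

lemma \<Theta>_app: "E \<in> M \<Longrightarrow> a \<in> carrier A \<Longrightarrow> \<Theta> E a = fst E \<otimes> \<alpha> (snd E) a \<otimes> inv (fst E)"
  by (auto simp: M_def \<Theta>_def compose_eq conj_by_app \<alpha>_simps)

lemma \<Theta>_aut: "E \<in> M \<Longrightarrow> \<Theta> E \<in> ring_aut A"
  unfolding \<Theta>_def M_def by (rule compose_ring_aut) (auto simp: conj_by_aut \<alpha>_aut ring_axioms)

text \<open>The unit u(a,b) in the product is the one by which \<alpha>_a \<alpha>_b differs from
  the lift of ab, so \<Theta> is multiplicative without error even where \<open>M\<close> is not
  associative.\<close>

lemma \<Theta>_mult:
  assumes E: "E \<in> M" and F: "F \<in> M" and t: "t \<in> carrier A"
  shows "\<Theta> (E \<star> F) t = \<Theta> E (\<Theta> F t)"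
proof -
  obtain x a y b where eq: "E = (x, a)" "F = (y, b)" by (metis surj_pair)
  have x: "x \<in> Units A" "y \<in> Units A" and g: "a \<in> carrier G" "b \<in> carrier G"
    using assms by (auto simp: eq M_def)
  have q: "a \<otimes>\<^bsub>G\<^esub> b \<in> carrier G" using g by auto
  have Ft: "\<Theta> F t \<in> carrier A" using ring_autD(4)[OF \<Theta>_aut[OF F] t] .
  have y': "inv y \<in> carrier A" "y \<in> carrier A" "x \<in> carrier A" using x by auto
  show ?thesis
    unfolding \<Theta>_app[OF mul_closed[OF E F] t] \<Theta>_app[OF E Ft] unfolding \<Theta>_app[OF F t]
    using x y' g q t u_unit[OF g] \<alpha>_unit(1)[OF g(1) x(2)] \<alpha>_unit(2)[OF g(1) x(2)]
      \<alpha>_simps(1)[OF q t] \<alpha>_simps(1)[OF g(2) t] \<alpha>_simps(1)[OF g(1)]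
    by (simp add: eq mul_def \<alpha>_simps(2) \<alpha>\<alpha> inv_mult_units m_assoc Units_closed)
qed

lemma move_j':
  assumes E: "E \<in> M" and t: "t \<in> Units A"
  shows "E \<star> \<iota> (j t) = \<iota> (j (\<Theta> E t)) \<star> E"
proof -
  obtain x a where eq: "E = (x, a)" by (metis surj_pair)
  have x: "x \<in> Units A" "a \<in> carrier G" using E by (auto simp: eq M_def)
  have T: "\<Theta> E t \<in> Units A" by (rule ring_aut_unit(1)[OF ring_axioms \<Theta>_aut[OF E] t])
  show ?thesis
    unfolding mul_\<iota>_j[OF t E] \<iota>_j_mul[OF T E] unfolding \<Theta>_app[OF E Units_closed[OF t]]
    using x \<alpha>_simps(1)[OF x(2) Units_closed[OF t]] by (simp add: eq m_assoc Units_closed)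
qed

sublocale crossed A \<Gamma> \<theta> j
proof -
  interpret \<Gamma>: group \<Gamma> by (rule \<Gamma>_group)
  show "crossed A \<Gamma> \<theta> j"
  proof (unfold_locales)
    show "\<theta> \<in> hom \<Gamma> (aut_group A)"
    proof (rule homI)
      fix \<gamma> \<delta> assume \<gamma>: "\<gamma> \<in> carrier \<Gamma>" and \<delta>: "\<delta> \<in> carrier \<Gamma>"
      note m = \<iota>_closed[OF \<gamma>] \<iota>_closed[OF \<delta>]
      show "\<theta> \<gamma> \<in> carrier (aut_group A)" using \<Theta>_aut[OF m(1)] by (simp add: \<theta>_def aut_group_def)
      have "\<Theta> (\<iota> \<gamma> \<star> \<iota> \<delta>) = compose (carrier A) (\<Theta> (\<iota> \<gamma>)) (\<Theta> (\<iota> \<delta>))"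
        by (rule ring_aut_eqI[OF \<Theta>_aut[OF mul_closed[OF m]] compose_ring_aut[OF \<Theta>_aut[OF m(1)] \<Theta>_aut[OF m(2)] ring_axioms]])
          (simp add: \<Theta>_mult[OF m] compose_eq)
      then show "\<theta> (\<gamma> \<otimes>\<^bsub>\<Gamma>\<^esub> \<delta>) = \<theta> \<gamma> \<otimes>\<^bsub>aut_group A\<^esub> \<theta> \<delta>"
        by (simp add: \<theta>_def \<iota>_mult[OF \<gamma> \<delta>] aut_group_def)
    qed
    show "j \<in> hom (units_of A) \<Gamma>"
    proof (rule homI)
      fix s t assume "s \<in> carrier (units_of A)" "t \<in> carrier (units_of A)"
      then have st: "s \<in> Units A" "t \<in> Units A" by (simp_all add: units_of_def)
      show "j s \<in> carrier \<Gamma>" using j_closed'[OF st(1)] .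
      have "j (s \<otimes> t) = j s \<otimes>\<^bsub>\<Gamma>\<^esub> j t"
      proof (rule \<iota>_inj)
        have "\<iota> (j (s \<otimes> t)) = (s \<otimes> fst (\<iota> (j t)), snd (\<iota> (j t)))"
          using st u1 by (simp add: \<iota>_def j_def m_assoc Units_closed)
        then show "\<iota> (j (s \<otimes> t)) = \<iota> (j s \<otimes>\<^bsub>\<Gamma>\<^esub> j t)"
          unfolding \<iota>_mult[OF j_closed'[OF st(1)] j_closed'[OF st(2)]] \<iota>_j_mul[OF st(1) \<iota>_closed[OF j_closed'[OF st(2)]]] .
      qed (use st j_closed' in auto)
      then show "j (s \<otimes>\<^bsub>units_of A\<^esub> t) = j s \<otimes>\<^bsub>\<Gamma>\<^esub> j t" by (simp add: units_of_def)
    qed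
    show "inj_on j (Units A)"
      using unit_r_cancel[OF u1(3)] by (auto intro!: inj_onI simp: j_def Units_closed)
    fix t assume t: "t \<in> Units A"
    show "\<theta> (j t) = conj_by A t"
    proof (rule ring_aut_eqI)
      show "\<theta> (j t) \<in> ring_aut A" unfolding \<theta>_def by (rule \<Theta>_aut[OF \<iota>_closed[OF j_closed'[OF t]]])
      show "conj_by A t \<in> ring_aut A" by (rule conj_by_aut[OF t])
      fix x assume x: "x \<in> carrier A"
      show "\<theta> (j t) x = conj_by A t x"
        unfolding \<theta>_def \<Theta>_app[OF \<iota>_closed[OF j_closed'[OF t]] x] using x t u1
        by (simp add: \<iota>_def j_def e_one \<alpha>_one conj_by_app m_assoc Units_closed inv_cancel inv_mult_units)
    qed
    fix \<gamma> assume \<gamma>: "\<gamma> \<in> carrier \<Gamma>"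
    have T: "\<theta> \<gamma> t \<in> Units A"
      unfolding \<theta>_def by (rule ring_aut_unit(1)[OF ring_axioms \<Theta>_aut[OF \<iota>_closed[OF \<gamma>]] t])
    have "\<iota> (\<gamma> \<otimes>\<^bsub>\<Gamma>\<^esub> j t) = \<iota> (j (\<theta> \<gamma> t) \<otimes>\<^bsub>\<Gamma>\<^esub> \<gamma>)"
      unfolding \<iota>_mult[OF \<gamma> j_closed'[OF t]] \<iota>_mult[OF j_closed'[OF T] \<gamma>]
      using move_j'[OF \<iota>_closed[OF \<gamma>] t] by (simp add: \<theta>_def)
    then have "\<gamma> \<otimes>\<^bsub>\<Gamma>\<^esub> j t = j (\<theta> \<gamma> t) \<otimes>\<^bsub>\<Gamma>\<^esub> \<gamma>"
      by (intro \<iota>_inj) (simp_all add: \<gamma> j_closed' t T)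
    then show "j (\<theta> \<gamma> t) = \<gamma> \<otimes>\<^bsub>\<Gamma>\<^esub> j t \<otimes>\<^bsub>\<Gamma>\<^esub> inv\<^bsub>\<Gamma>\<^esub> \<gamma>"
      using \<gamma> j_closed'[OF T] by (simp add: \<Gamma>.m_assoc)
  qed
qed

text \<open>With g = ba^-1, which lies in the kernel and so comes from \<open>N\<close>, the unit is
  found by solving z \<alpha>_g(x) u(g,a) = y for z.\<close>

lemma ldiv':
  assumes E: "E \<in> M" and F: "F \<in> M" and eq\<pi>: "\<pi> (snd E) = \<pi> (snd F)"
  shows "\<exists>\<gamma>\<in>carrier \<Gamma>. F = \<iota> \<gamma> \<star> E"
proof -
  obtain x a y b where eq: "E = (x, a)" "F = (y, b)" by (metis surj_pair)
  have x: "x \<in> Units A" "y \<in> Units A" and g: "a \<in> carrier G" "b \<in> carrier G"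
    using assms by (auto simp: eq M_def)
  let ?g = "b \<otimes>\<^bsub>G\<^esub> inv\<^bsub>G\<^esub> a"
  have gg: "?g \<in> carrier G" using g by simp
  have "\<pi> ?g = \<one>\<^bsub>Q\<^esub>" using g eq\<pi> \<pi>_closed' by (simp add: eq \<pi>_mult' \<pi>_inv')
  then obtain n where n: "n \<in> carrier N" "e n = ?g" using \<pi>_ker[OF gg] by blast
  let ?p = "\<alpha> ?g x" and ?r = "u (?g, a)"
  have p: "?p \<in> Units A" "?r \<in> Units A" using \<alpha>_unit(1)[OF gg x(1)] u_unit[OF gg g(1)] by auto
  let ?\<gamma> = "(y \<otimes> inv ?r \<otimes> inv ?p, n)"
  have "?\<gamma> \<in> carrier \<Gamma>" using p x n by (simp add: \<Gamma>_def)
  moreover have "F = \<iota> ?\<gamma> \<star> E"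
    using x p g by (simp add: eq \<iota>_def mul_def n m_assoc G.m_assoc Units_closed inv_cancel)
  ultimately show ?thesis by blast
qed

text \<open>As on the left, with g = a^-1 b. The unknown now stands inside \<alpha>_a, so the
  inverse automorphism is needed to solve x \<alpha>_a(z) u(a,g) = y.\<close>

lemma rdiv':
  assumes E: "E \<in> M" and F: "F \<in> M" and eq\<pi>: "\<pi> (snd E) = \<pi> (snd F)"
  shows "\<exists>\<gamma>\<in>carrier \<Gamma>. F = E \<star> \<iota> \<gamma>"
proof -
  obtain x a y b where eq: "E = (x, a)" "F = (y, b)" by (metis surj_pair)
  have x: "x \<in> Units A" "y \<in> Units A" and g: "a \<in> carrier G" "b \<in> carrier G"
    using assms by (auto simp: eq M_def)
  let ?g = "inv\<^bsub>G\<^esub> a \<otimes>\<^bsub>G\<^esub> b"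
  have gg: "?g \<in> carrier G" using g by simp
  have "\<pi> ?g = \<one>\<^bsub>Q\<^esub>" using g eq\<pi> \<pi>_closed' by (simp add: eq \<pi>_mult' \<pi>_inv')
  then obtain n where n: "n \<in> carrier N" "e n = ?g" using \<pi>_ker[OF gg] by blast
  have r: "u (a, ?g) \<in> Units A" using u_unit[OF g(1) gg] .
  obtain \<alpha>' where \<alpha>': "\<alpha>' \<in> ring_aut A" "\<And>t. t \<in> carrier A \<Longrightarrow> \<alpha> a (\<alpha>' t) = t"
    using ring_aut_inverse[OF ring_axioms \<alpha>_aut[OF g(1)]] by metis
  let ?t = "inv x \<otimes> y \<otimes> inv (u (a, ?g))"
  have t: "?t \<in> Units A" using x r by simp
  have z: "\<alpha>' ?t \<in> Units A" by (rule ring_aut_unit(1)[OF ring_axioms \<alpha>'(1) t])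
  have "(\<alpha>' ?t, n) \<in> carrier \<Gamma>" using z n by (simp add: \<Gamma>_def)
  moreover have "F = E \<star> \<iota> (\<alpha>' ?t, n)"
    unfolding eq \<iota>_def mul_def fst_conv snd_conv n(2) \<alpha>'(2)[OF Units_closed[OF t]]
    using x r g by (simp add: m_assoc Units_closed inv_cancel flip: G.m_assoc)
  ultimately show ?thesis by blast
qed

lemma lcancel':
  assumes E: "E \<in> M" and \<gamma>: "\<gamma> \<in> carrier \<Gamma>" and \<delta>: "\<delta> \<in> carrier \<Gamma>" and eq: "\<iota> \<gamma> \<star> E = \<iota> \<delta> \<star> E"
  shows "\<gamma> = \<delta>"
proof -
  have c: "snd E \<in> carrier G" "fst E \<in> Units A" "e (snd \<gamma>) \<in> carrier G" "e (snd \<delta>) \<in> carrier G"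
    "fst \<gamma> \<in> carrier A" "fst \<delta> \<in> carrier A"
    using E \<gamma> \<delta> by (auto simp: M_def \<Gamma>_def e_closed Units_closed)
  have e: "e (snd \<gamma>) = e (snd \<delta>)" using eq c by (simp add: mul_def \<iota>_def)
  let ?p = "\<alpha> (e (snd \<delta>)) (fst E) \<otimes> u (e (snd \<delta>), snd E)"
  have p: "?p \<in> Units A" "\<alpha> (e (snd \<delta>)) (fst E) \<in> Units A" "u (e (snd \<delta>), snd E) \<in> Units A"
    using \<alpha>_unit(1)[OF c(4,2)] u_unit[OF c(4,1)] by auto
  have "fst \<gamma> \<otimes> ?p = fst \<delta> \<otimes> ?p" using eq c p e by (simp add: mul_def \<iota>_def m_assoc Units_closed)
  then have "fst \<gamma> = fst \<delta>" using unit_r_cancel[OF p(1) c(5,6)] by simp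
  then show ?thesis using e \<iota>_inj[OF \<gamma> \<delta>] by (simp add: \<iota>_def)
qed

lemma rcancel':
  assumes E: "E \<in> M" and \<gamma>: "\<gamma> \<in> carrier \<Gamma>" and \<delta>: "\<delta> \<in> carrier \<Gamma>" and eq: "E \<star> \<iota> \<gamma> = E \<star> \<iota> \<delta>"
  shows "\<gamma> = \<delta>"
proof -
  have c: "snd E \<in> carrier G" "fst E \<in> Units A" "e (snd \<gamma>) \<in> carrier G" "e (snd \<delta>) \<in> carrier G"
    "fst \<gamma> \<in> carrier A" "fst \<delta> \<in> carrier A"
    using E \<gamma> \<delta> by (auto simp: M_def \<Gamma>_def e_closed Units_closed)
  have e: "e (snd \<gamma>) = e (snd \<delta>)" using eq c by (simp add: mul_def \<iota>_def)
  note a = \<alpha>_simps(1)[OF c(1,5)] \<alpha>_simps(1)[OF c(1,6)] u_unit[OF c(1,4)]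
  have "fst E \<otimes> \<alpha> (snd E) (fst \<gamma>) = fst E \<otimes> \<alpha> (snd E) (fst \<delta>)"
    using eq e c a unit_r_cancel[OF a(3)] by (simp add: mul_def \<iota>_def Units_closed)
  then have "inv (fst E) \<otimes> (fst E \<otimes> \<alpha> (snd E) (fst \<gamma>)) = inv (fst E) \<otimes> (fst E \<otimes> \<alpha> (snd E) (fst \<delta>))" by simp
  then have "\<alpha> (snd E) (fst \<gamma>) = \<alpha> (snd E) (fst \<delta>)" using c a by (simp add: inv_cancel)
  then have "fst \<gamma> = fst \<delta>" using ring_aut_inj[OF \<alpha>_aut[OF c(1)] c(5,6)] by simp
  then show ?thesis using e \<iota>_inj[OF \<gamma> \<delta>] by (simp add: \<iota>_def)
qed

lemma \<pi>_snd_\<iota>: "\<gamma> \<in> carrier \<Gamma> \<Longrightarrow> \<pi> (snd (\<iota> \<gamma>)) = \<one>\<^bsub>Q\<^esub>"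
  by (auto simp: \<Gamma>_def \<iota>_def \<pi>_e)

sublocale nuc: nuclear A \<Gamma> \<theta> j G Q M mul \<iota> \<Theta> snd \<pi> f
proof (unfold_locales, goal_cases)
  case (4 \<gamma> E F)
  then show ?case by (intro mul_assoc_normalized) (simp_all add: \<iota>_closed \<pi>_snd_\<iota>)
next
  case (5 \<gamma> E F)
  then show ?case by (intro mul_assoc_normalized) (simp_all add: \<iota>_closed \<pi>_snd_\<iota>)
next
  case (6 \<gamma> E F)
  then show ?case by (intro mul_assoc_normalized) (simp_all add: \<iota>_closed \<pi>_snd_\<iota>)
next
  case (7 E F H)
  have "f (\<pi> (snd E), \<pi> (snd F), \<pi> (snd H)) \<in> Units A" using 7 f_closed by (auto simp: M_def)
  then show ?case using mul_assoc[OF 7] \<iota>_j_mul mul_closed[OF mul_closed[OF 7(1,2)] 7(3)] by simp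
next
  case (11 E \<gamma> \<delta>)
  then show ?case by (rule lcancel')
next
  case (12 E \<gamma> \<delta>)
  then show ?case by (rule rcancel')
next
  case (17 E)
  then show ?case by (auto simp: M_def)
next
  case (18 E F)
  then show ?case by (simp add: mul_def)
next
  case (19 g)
  then show ?case by (intro bexI[of _ "(\<one>, g)"]) (auto simp: M_def)
next
  case (20 E F)
  then have u: "fst F \<otimes> inv (fst E) \<in> Units A" by (auto simp: M_def)
  have "F = \<iota> (j (fst F \<otimes> inv (fst E))) \<star> E"
    unfolding \<iota>_j_mul[OF u 20(1)] using 20 by (auto simp: M_def m_assoc Units_closed prod_eq_iff)
  then show ?case using u by blast
qed (simp_all only: mul_closed \<iota>_closed \<iota>_mult \<pi>_snd_\<iota> f_units \<Theta>_aut \<Theta>_mult \<theta>_def move_j' \<pi>_hom' \<pi>_surj' ldiv' rdiv')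

end

section \<open>Normalized cocycles\<close>

text \<open>An abelian group of units inside a possibly noncommutative ring, so that cochain
  formulas written with the ring product and inverse apply. The instances are U(S) under
  \<open>Q\<close> and U(T) under \<open>G\<close>, both computed in \<open>A\<close>.\<close>

locale unit_module = ring R + G: group G
  for R :: "('a,'b) ring_scheme" (structure) and G :: "('g,'c) monoid_scheme" +
  fixes M :: "'a set" and act :: "'g \<Rightarrow> 'a \<Rightarrow> 'a"
  assumes M_units: "M \<subseteq> Units R" and M_one: "\<one> \<in> M"
    and M_mult: "x \<in> M \<Longrightarrow> y \<in> M \<Longrightarrow> x \<otimes> y \<in> M"
    and M_inv: "x \<in> M \<Longrightarrow> inv x \<in> M"
    and M_comm: "x \<in> M \<Longrightarrow> y \<in> M \<Longrightarrow> x \<otimes> y = y \<otimes> x"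
    and act_closed: "g \<in> carrier G \<Longrightarrow> x \<in> M \<Longrightarrow> act g x \<in> M"
    and act_mult: "g \<in> carrier G \<Longrightarrow> x \<in> M \<Longrightarrow> y \<in> M \<Longrightarrow> act g (x \<otimes> y) = act g x \<otimes> act g y"
    and act_id: "x \<in> M \<Longrightarrow> act \<one>\<^bsub>G\<^esub> x = x"
begin

section \<open>Coboundaries with values in a group of units\<close>

lemma M_unit: "x \<in> M \<Longrightarrow> x \<in> Units R"
  using M_units by blast

lemma M_carrier: "x \<in> M \<Longrightarrow> x \<in> carrier R"
  using M_units Units_closed by blast

lemma M_lcomm: "x \<in> M \<Longrightarrow> y \<in> M \<Longrightarrow> z \<in> M \<Longrightarrow> x \<otimes> (y \<otimes> z) = y \<otimes> (x \<otimes> z)"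
  by (metis M_carrier M_comm m_assoc)

lemma M_inv_mult: "x \<in> M \<Longrightarrow> y \<in> M \<Longrightarrow> inv (x \<otimes> y) = inv x \<otimes> inv y"
  by (simp add: inv_mult_units M_unit M_comm M_inv)

lemma act_one:
  assumes g: "g \<in> carrier G"
  shows "act g \<one> = \<one>"
proof -
  let ?x = "act g \<one>"
  have x: "?x \<in> M" using act_closed[OF g M_one] .
  have "?x \<otimes> ?x = ?x \<otimes> \<one>" using act_mult[OF g M_one M_one] M_carrier[OF x] by simp
  then show ?thesis using Units_l_cancel[OF M_unit[OF x] M_carrier[OF x] one_closed] by simp
qed

lemma act_inv:
  assumes g: "g \<in> carrier G" and x: "x \<in> M"
  shows "act g (inv x) = inv (act g x)"
proof (rule inv_unique')
  show "act g x \<otimes> act g (inv x) = \<one>"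
    unfolding act_mult[OF g x M_inv[OF x], symmetric] using x g by (simp add: M_unit act_one)
  show "act g (inv x) \<otimes> act g x = \<one>"
    unfolding act_mult[OF g M_inv[OF x] x, symmetric] using x g by (simp add: M_unit act_one)
qed (use g x in \<open>auto intro!: M_carrier act_closed M_inv\<close>)

lemma coboundary2_closed:
  assumes h: "h \<in> carrier G \<times> carrier G \<rightarrow> M" and x: "x \<in> triples G"
  shows "coboundary2 R G act h x \<in> M"
proof -
  obtain a b c where abc: "x = (a, b, c)" "a \<in> carrier G" "b \<in> carrier G" "c \<in> carrier G"
    using x by (auto simp: triples_def)
  have hM: "h (r, s) \<in> M" if "r \<in> carrier G" "s \<in> carrier G" for r s using h that by blast
  show ?thesis using x abc by (simp add: coboundary2_def hM M_mult M_inv act_closed)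
qed

lemma coboundary2_mult:
  assumes h: "h \<in> carrier G \<times> carrier G \<rightarrow> M" and g: "g \<in> carrier G \<times> carrier G \<rightarrow> M" and x: "x \<in> triples G"
    and k: "\<And>r s. r \<in> carrier G \<Longrightarrow> s \<in> carrier G \<Longrightarrow> k (r, s) = h (r, s) \<otimes> g (r, s)"
  shows "coboundary2 R G act k x = coboundary2 R G act h x \<otimes> coboundary2 R G act g x"
proof -
  obtain a b c where abc: "x = (a, b, c)" "a \<in> carrier G" "b \<in> carrier G" "c \<in> carrier G"
    using x by (auto simp: triples_def)
  have hM: "h (r, s) \<in> M" "g (r, s) \<in> M" if "r \<in> carrier G" "s \<in> carrier G" for r s using h g that by blast+
  show ?thesis using x abc
    by (simp add: coboundary2_def hM k M_mult M_inv act_closed act_mult M_inv_mult m_assoc M_carrier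
        M_comm M_lcomm)
qed

lemma coboundary2_one:
  assumes x: "x \<in> triples G" and h: "\<And>r s. r \<in> carrier G \<Longrightarrow> s \<in> carrier G \<Longrightarrow> h (r, s) = \<one>"
  shows "coboundary2 R G act h x = \<one>"
proof -
  obtain a b c where abc: "x = (a, b, c)" "a \<in> carrier G" "b \<in> carrier G" "c \<in> carrier G"
    using x by (auto simp: triples_def)
  show ?thesis using x abc by (simp add: coboundary2_def h act_one)
qed

text \<open>The constant cochain 1 is the witness.\<close>

lemma cohom_class3_self:
  assumes f: "f \<in> triples G \<rightarrow>\<^sub>E carrier R"
  shows "f \<in> cohom_class3 R G M act f"
proof -
  let ?h = "restrict (\<lambda>_. \<one>) (carrier G \<times> carrier G)"
  have "f = restrict (\<lambda>x. f x \<otimes> coboundary2 R G act ?h x) (triples G)"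
  proof (rule extensionalityI[of _ "triples G"])
    fix x assume x: "x \<in> triples G"
    have "f x \<in> carrier R" using f x by blast
    then show "f x = restrict (\<lambda>x. f x \<otimes> coboundary2 R G act ?h x) (triples G) x"
      using x coboundary2_one[OF x, of ?h] by simp
  qed (use f in \<open>auto simp: PiE_def\<close>)
  moreover have "?h \<in> carrier G \<times> carrier G \<rightarrow>\<^sub>E M" using M_one by auto
  ultimately show ?thesis unfolding cohom_class3_def by blast
qed

text \<open>Coboundaries are multiplicative in the cochain, so shifting by \<open>h\<close> and by
  its inverse identifies the two sets.\<close>

lemma cohom_class3_eq:
  assumes f: "f \<in> triples G \<rightarrow>\<^sub>E M" and h: "h \<in> carrier G \<times> carrier G \<rightarrow>\<^sub>E M"
    and f': "f' = restrict (\<lambda>x. f x \<otimes> coboundary2 R G act h x) (triples G)"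
  shows "cohom_class3 R G M act f' = cohom_class3 R G M act f"
proof -
  have hP: "h \<in> carrier G \<times> carrier G \<rightarrow> M" using h by (simp add: PiE_def)
  have fM: "f x \<in> M" if "x \<in> triples G" for x using f that by blast
  show ?thesis
  proof (rule equalityI; rule subsetI)
    fix F assume "F \<in> cohom_class3 R G M act f'"
    then obtain g where g: "g \<in> carrier G \<times> carrier G \<rightarrow>\<^sub>E M"
      and F: "F = restrict (\<lambda>x. f' x \<otimes> coboundary2 R G act g x) (triples G)"
      unfolding cohom_class3_def by blast
    have gP: "g \<in> carrier G \<times> carrier G \<rightarrow> M" using g by (simp add: PiE_def)
    let ?k = "restrict (\<lambda>x. h x \<otimes> g x) (carrier G \<times> carrier G)"
    have "F = restrict (\<lambda>x. f x \<otimes> coboundary2 R G act ?k x) (triples G)"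
      unfolding F f'
    proof (rule restrict_ext)
      fix x assume x: "x \<in> triples G"
      have "coboundary2 R G act ?k x = coboundary2 R G act h x \<otimes> coboundary2 R G act g x"
        by (rule coboundary2_mult[OF hP gP x]) simp
      then show "restrict (\<lambda>x. f x \<otimes> coboundary2 R G act h x) (triples G) x \<otimes> coboundary2 R G act g x
          = f x \<otimes> coboundary2 R G act ?k x"
        using x fM[OF x] coboundary2_closed[OF hP x] coboundary2_closed[OF gP x] by (simp add: m_assoc M_carrier)
    qed
    moreover have "?k \<in> carrier G \<times> carrier G \<rightarrow>\<^sub>E M" using hP gP M_mult by (auto simp: Pi_def)
    ultimately show "F \<in> cohom_class3 R G M act f" unfolding cohom_class3_def by blast
  next
    fix F assume "F \<in> cohom_class3 R G M act f"
    then obtain g where g: "g \<in> carrier G \<times> carrier G \<rightarrow>\<^sub>E M"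
      and F: "F = restrict (\<lambda>x. f x \<otimes> coboundary2 R G act g x) (triples G)"
      unfolding cohom_class3_def by blast
    have gP: "g \<in> carrier G \<times> carrier G \<rightarrow> M" using g by (simp add: PiE_def)
    let ?k = "restrict (\<lambda>x. inv (h x) \<otimes> g x) (carrier G \<times> carrier G)"
    have kE: "?k \<in> carrier G \<times> carrier G \<rightarrow>\<^sub>E M" using hP gP M_mult M_inv by (auto simp: Pi_def)
    have kP: "?k \<in> carrier G \<times> carrier G \<rightarrow> M" using kE by (simp add: PiE_def)
    have "F = restrict (\<lambda>x. f' x \<otimes> coboundary2 R G act ?k x) (triples G)"
      unfolding F f'
    proof (rule restrict_ext)
      fix x assume x: "x \<in> triples G"
      have hM: "h (r, s) \<in> M" "g (r, s) \<in> M" if "r \<in> carrier G" "s \<in> carrier G" for r s using hP gP that by blast+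
      have "coboundary2 R G act g x = coboundary2 R G act h x \<otimes> coboundary2 R G act ?k x"
        by (rule coboundary2_mult[OF hP kP x]) (simp add: hM M_unit M_carrier inv_cancel)
      then show "f x \<otimes> coboundary2 R G act g x
          = restrict (\<lambda>x. f x \<otimes> coboundary2 R G act h x) (triples G) x \<otimes> coboundary2 R G act ?k x"
        using x fM[OF x] coboundary2_closed[OF hP x] coboundary2_closed[OF kP x] by (simp add: m_assoc M_carrier)
    qed
    then show "F \<in> cohom_class3 R G M act f'" unfolding cohom_class3_def using kE by blast
  qed
qed

text \<open>The correcting cochain is read off from the cocycle identity at \<open>(1, 1, b, c)\<close>,
  \<open>(a, 1, 1, c)\<close> and \<open>(a, b, 1, 1)\<close>.\<close>

lemma cocycle3_normalize:
  assumes f: "cocycle3 R G M act f"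
  shows "\<exists>f'\<in>triples G \<rightarrow>\<^sub>E M. cohom_class3 R G M act f' = cohom_class3 R G M act f \<and>
    (\<forall>a\<in>carrier G. \<forall>b\<in>carrier G. f' (\<one>\<^bsub>G\<^esub>, a, b) = \<one> \<and> f' (a, \<one>\<^bsub>G\<^esub>, b) = \<one> \<and> f' (a, b, \<one>\<^bsub>G\<^esub>) = \<one>)"
proof -
  let ?e = "\<one>\<^bsub>G\<^esub>"
  have fE: "f \<in> triples G \<rightarrow>\<^sub>E M"
    and coc: "\<And>a b c d. a \<in> carrier G \<Longrightarrow> b \<in> carrier G \<Longrightarrow> c \<in> carrier G \<Longrightarrow> d \<in> carrier G \<Longrightarrow>
      act a (f (b, c, d)) \<otimes> f (a, b \<otimes>\<^bsub>G\<^esub> c, d) \<otimes> f (a, b, c) = f (a \<otimes>\<^bsub>G\<^esub> b, c, d) \<otimes> f (a, b, c \<otimes>\<^bsub>G\<^esub> d)"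
    using f unfolding cocycle3_def by blast+
  have fM: "f (a, b, c) \<in> M" if "a \<in> carrier G" "b \<in> carrier G" "c \<in> carrier G" for a b c
    using fE that by (auto simp: triples_def PiE_def Pi_def)
  have lc: "y = z" if "x \<in> M" "y \<in> M" "z \<in> M" "x \<otimes> y = x \<otimes> z" for x y z
    using that Units_l_cancel[OF M_unit M_carrier M_carrier] by blast
  have c1: "f (?e, b, c) \<otimes> f (?e, ?e, b) = f (?e, ?e, b \<otimes>\<^bsub>G\<^esub> c)" if bc: "b \<in> carrier G" "c \<in> carrier G" for b c
  proof (rule lc[of "f (?e, b, c)"])
    show "f (?e, b, c) \<otimes> (f (?e, b, c) \<otimes> f (?e, ?e, b)) = f (?e, b, c) \<otimes> f (?e, ?e, b \<otimes>\<^bsub>G\<^esub> c)"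
      using coc[of ?e ?e b c] bc by (simp add: act_id fM m_assoc M_carrier)
  qed (use bc in \<open>simp_all add: fM M_mult\<close>)
  have c2: "act a (f (?e, ?e, c)) \<otimes> f (a, ?e, ?e) = f (a, ?e, c)" if ac: "a \<in> carrier G" "c \<in> carrier G" for a c
  proof (rule lc[of "f (a, ?e, c)"])
    let ?K = "act a (f (?e, ?e, c))"
    have K: "?K \<in> M" using ac by (simp add: act_closed fM)
    have "?K \<otimes> f (a, ?e, c) \<otimes> f (a, ?e, ?e) = f (a, ?e, c) \<otimes> f (a, ?e, c)"
      using coc[of a ?e ?e c] ac by simp
    then show "f (a, ?e, c) \<otimes> (?K \<otimes> f (a, ?e, ?e)) = f (a, ?e, c) \<otimes> f (a, ?e, c)"
      using M_comm[OF K, of "f (a, ?e, c)"] ac K by (simp add: fM m_assoc M_carrier M_lcomm[of "f (a, ?e, c)" ?K])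
  qed (use ac in \<open>simp_all add: fM M_mult act_closed\<close>)
  have c3: "act a (f (b, ?e, ?e)) \<otimes> f (a, b, ?e) = f (a \<otimes>\<^bsub>G\<^esub> b, ?e, ?e)" if ab: "a \<in> carrier G" "b \<in> carrier G" for a b
  proof (rule lc[of "f (a, b, ?e)"])
    let ?K = "act a (f (b, ?e, ?e))"
    have K: "?K \<in> M" using ab by (simp add: act_closed fM)
    have F: "f (a, b, ?e) \<in> M" and D: "f (a \<otimes>\<^bsub>G\<^esub> b, ?e, ?e) \<in> M" using ab by (simp_all add: fM)
    have "?K \<otimes> f (a, b, ?e) \<otimes> f (a, b, ?e) = f (a \<otimes>\<^bsub>G\<^esub> b, ?e, ?e) \<otimes> f (a, b, ?e)"
      using coc[of a b ?e ?e] ab by simp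
    then show "f (a, b, ?e) \<otimes> (?K \<otimes> f (a, b, ?e)) = f (a, b, ?e) \<otimes> f (a \<otimes>\<^bsub>G\<^esub> b, ?e, ?e)"
      unfolding M_comm[OF F M_mult[OF K F]] M_comm[OF F D] .
  qed (use ab in \<open>simp_all add: fM M_mult act_closed\<close>)
  \<comment> \<open>Makes the two prescriptions for the correcting cochain agree at (1, 1).\<close>
  have f1: "f (?e, ?e, ?e) = \<one>"
    using c1[of ?e ?e] lc[of "f (?e, ?e, ?e)" "f (?e, ?e, ?e)" \<one>] by (simp add: fM M_one M_carrier)
  \<comment> \<open>Off the axes the value 1 will do: the three identities to be achieved involve
    other values of \<open>h\<close> only in cancelling pairs.\<close>
  define h where "h = restrict (\<lambda>(a, b). if a = ?e then inv (f (?e, ?e, b)) else if b = ?e then f (a, ?e, ?e) else \<one>)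
    (carrier G \<times> carrier G)"
  have hE: "h \<in> carrier G \<times> carrier G \<rightarrow>\<^sub>E M" by (auto simp: h_def fM M_inv M_one)
  have hM: "h (a, b) \<in> M" if "a \<in> carrier G" "b \<in> carrier G" for a b using hE that by blast
  have h1: "h (?e, b) = inv (f (?e, ?e, b))" if "b \<in> carrier G" for b using that by (simp add: h_def)
  have h2: "h (a, ?e) = f (a, ?e, ?e)" if "a \<in> carrier G" for a using that f1 by (simp add: h_def)
  define f' where "f' = restrict (\<lambda>x. f x \<otimes> coboundary2 R G act h x) (triples G)"
  have hP: "h \<in> carrier G \<times> carrier G \<rightarrow> M" using hE by (simp add: PiE_def)
  have f'E: "f' \<in> triples G \<rightarrow>\<^sub>E M"
    unfolding f'_def using M_mult[OF _ coboundary2_closed[OF hP]] fE by (auto simp: PiE_def Pi_def)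
  have f'app: "f' (a, b, c) = f (a, b, c) \<otimes> (act a (h (b, c)) \<otimes> inv (h (a \<otimes>\<^bsub>G\<^esub> b, c)) \<otimes> h (a, b \<otimes>\<^bsub>G\<^esub> c) \<otimes> inv (h (a, b)))"
    if "a \<in> carrier G" "b \<in> carrier G" "c \<in> carrier G" for a b c
    using that by (simp add: f'_def coboundary2_def triples_def)
  \<comment> \<open>The factors h(b,c) cancel since 1 acts trivially; what remains is f(1,b,c)
    f(1,1,bc)^-1 f(1,1,b), which is 1 by \<open>c1\<close>.\<close>
  have n1: "f' (?e, b, c) = \<one>" if bc: "b \<in> carrier G" "c \<in> carrier G" for b c
  proof -
    let ?F = "f (?e, b, c)" and ?B = "f (?e, ?e, b)"
    have M: "?F \<in> M" "?B \<in> M" "h (b, c) \<in> M" using bc by (simp_all add: fM hM)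
    have D: "f (?e, ?e, b \<otimes>\<^bsub>G\<^esub> c) = ?F \<otimes> ?B" using c1[OF bc] by simp
    have "f' (?e, b, c) = ?F \<otimes> (inv (?F \<otimes> ?B) \<otimes> ?B)"
      using bc M by (simp add: f'app act_id h1 D M_unit M_carrier M_mult M_inv Units_inv_inv)
    also have "\<dots> = ?F \<otimes> (?B \<otimes> inv (?F \<otimes> ?B))" using M_comm[OF M_inv[OF M_mult[OF M(1,2)]] M(2)] by simp
    also have "\<dots> = (?F \<otimes> ?B) \<otimes> inv (?F \<otimes> ?B)" using M by (simp add: m_assoc M_carrier M_mult M_inv)
    also have "\<dots> = \<one>" using M_unit[OF M_mult[OF M(1,2)]] by simp
    finally show ?thesis .
  qed
  have n2: "f' (a, ?e, c) = \<one>" if ac: "a \<in> carrier G" "c \<in> carrier G" for a c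
  proof -
    let ?K = "act a (f (?e, ?e, c))" and ?B = "f (a, ?e, ?e)"
    have M: "?K \<in> M" "?B \<in> M" "h (a, c) \<in> M" using ac by (simp_all add: fM hM act_closed)
    have "f' (a, ?e, c) = (?K \<otimes> ?B) \<otimes> (inv ?K \<otimes> inv ?B)"
      using ac M by (simp add: f'app h1 h2 act_inv fM M_unit M_carrier M_mult M_inv m_assoc inv_cancel c2[OF ac, symmetric])
    also have "\<dots> = (?K \<otimes> ?B) \<otimes> inv (?K \<otimes> ?B)" using M_inv_mult[OF M(1,2)] by simp
    also have "\<dots> = \<one>" using M_unit[OF M_mult[OF M(1,2)]] by simp
    finally show ?thesis .
  qed
  have n3: "f' (a, b, ?e) = \<one>" if ab: "a \<in> carrier G" "b \<in> carrier G" for a b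
  proof -
    let ?K = "act a (f (b, ?e, ?e))" and ?F = "f (a, b, ?e)"
    have M: "?K \<in> M" "?F \<in> M" "h (a, b) \<in> M" using ab by (simp_all add: fM hM act_closed)
    have "f' (a, b, ?e) = ?F \<otimes> (?K \<otimes> inv (?K \<otimes> ?F))"
      using ab M by (simp add: f'app h2 c3[symmetric] M_unit M_carrier M_mult M_inv m_assoc)
    also have "\<dots> = (?F \<otimes> ?K) \<otimes> inv (?K \<otimes> ?F)" using M by (simp add: m_assoc M_carrier M_mult M_inv)
    also have "\<dots> = (?K \<otimes> ?F) \<otimes> inv (?K \<otimes> ?F)" using M_comm[OF M(2,1)] by simp
    also have "\<dots> = \<one>" using M_unit[OF M_mult[OF M(1,2)]] by simp
    finally show ?thesis .
  qed
  show ?thesis using f'E cohom_class3_eq[OF fE hE f'_def] n1 n2 n3 by blast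
qed

end

section \<open>The structure group\<close>

lemma (in ring) ring_center_subring: "subring (ring_center R) R"
proof (rule subringI)
  have I: "z \<in> ring_center R" if "z \<in> carrier R" "\<And>x. x \<in> carrier R \<Longrightarrow> z \<otimes> x = x \<otimes> z" for z
    using that unfolding ring_center_def by blast
  show "ring_center R \<subseteq> carrier R" using ring_centerD(1) by blast
  show "\<one> \<in> ring_center R" by (rule I) simp_all
  fix y assume y: "y \<in> ring_center R"
  note yc = ring_centerD(1)[OF y]
  show "\<ominus> y \<in> ring_center R"
    by (rule I) (simp_all add: yc l_minus r_minus ring_centerD(2)[OF y])
  fix z assume z: "z \<in> ring_center R"
  note zc = ring_centerD(1)[OF z]
  show "y \<oplus> z \<in> ring_center R"
    by (rule I) (simp_all add: yc zc l_distr r_distr ring_centerD(2)[OF y] ring_centerD(2)[OF z])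
  show "y \<otimes> z \<in> ring_center R"
  proof (rule I)
    fix x assume x: "x \<in> carrier R"
    have "y \<otimes> z \<otimes> x = y \<otimes> (x \<otimes> z)" using x yc zc ring_centerD(2)[OF z x] by (simp add: m_assoc)
    also have "\<dots> = (y \<otimes> x) \<otimes> z" using x yc zc by (simp add: m_assoc)
    also have "\<dots> = x \<otimes> (y \<otimes> z)" using x yc zc ring_centerD(2)[OF y x] by (simp add: m_assoc)
    finally show "y \<otimes> z \<otimes> x = x \<otimes> (y \<otimes> z)" .
  qed (use yc zc in simp)
qed

text \<open>The Galois sums are formed in \<open>T\<close>, whereas the computation of the center
  takes place in \<open>A\<close>.\<close>

lemma (in ring) finsum_subring:
  assumes H: "subring H R" and "finite I" "\<And>i. i \<in> I \<Longrightarrow> g i \<in> H"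
  shows "finsum (R\<lparr>carrier := H\<rparr>) g I = finsum R g I"
proof -
  interpret H: ring "R\<lparr>carrier := H\<rparr>" by (rule subring_is_ring[OF H])
  have Hc: "H \<subseteq> carrier R" using subringE(1)[OF H] .
  show ?thesis
    using assms(2,3)
  proof (induction I rule: finite_induct)
    case empty
    then show ?case using H.finsum_empty finsum_empty by simp
  next
    case (insert x I)
    have gI: "g \<in> I \<rightarrow> H" "g x \<in> H" using insert.prems by auto
    have "finsum (R\<lparr>carrier := H\<rparr>) g (insert x I) = g x \<oplus> finsum (R\<lparr>carrier := H\<rparr>) g I"
      using H.finsum_insert[OF insert.hyps(1,2), of g] gI by simp
    also have "\<dots> = finsum R g (insert x I)"
      using finsum_insert[OF insert.hyps(1,2), of g] gI Hc insert.IH insert.prems by (simp add: Pi_def subset_iff)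
    finally show ?case .
  qed
qed

lemma galois_group_subgroup:
  assumes R: "ring R" and S: "S \<subseteq> carrier R"
  shows "subgroup (galois_group R S) (aut_group R)"
proof -
  interpret Aut: group "aut_group R" by (rule aut_group_group[OF R])
  have aut: "\<phi> \<in> carrier (aut_group R) \<longleftrightarrow> \<phi> \<in> ring_aut R" for \<phi> by (simp add: aut_group_def)
  have mult: "\<phi> \<otimes>\<^bsub>aut_group R\<^esub> \<psi> = compose (carrier R) \<phi> \<psi>" for \<phi> \<psi> by (simp add: aut_group_def)
  have one: "\<one>\<^bsub>aut_group R\<^esub> = restrict id (carrier R)" by (simp add: aut_group_def)
  show ?thesis
  proof (rule Aut.subgroupI)
    have "\<one>\<^bsub>aut_group R\<^esub> \<in> galois_group R S"
      using Aut.one_closed S unfolding aut galois_group_def one by auto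
    then show "galois_group R S \<noteq> {}" by blast
    fix \<phi> assume \<phi>: "\<phi> \<in> galois_group R S"
    then have \<phi>a: "\<phi> \<in> ring_aut R" and \<phi>S: "\<And>s. s \<in> S \<Longrightarrow> \<phi> s = s" by (auto simp: galois_group_def)
    have "(inv\<^bsub>aut_group R\<^esub> \<phi>) s = s" if s: "s \<in> S" for s
    proof -
      have "compose (carrier R) (inv\<^bsub>aut_group R\<^esub> \<phi>) \<phi> s = restrict id (carrier R) s"
        using Aut.l_inv[of \<phi>] \<phi>a unfolding aut mult one by simp
      then show ?thesis using s S \<phi>S[OF s] by (auto simp: compose_eq subset_iff)
    qed
    then show "inv\<^bsub>aut_group R\<^esub> \<phi> \<in> galois_group R S"
      using Aut.inv_closed[of \<phi>] \<phi>a unfolding aut galois_group_def by simp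
    fix \<psi> assume \<psi>: "\<psi> \<in> galois_group R S"
    then show "\<phi> \<otimes>\<^bsub>aut_group R\<^esub> \<psi> \<in> galois_group R S"
      using \<phi> S unfolding mult galois_group_def by (auto simp: compose_ring_aut[OF _ _ R] compose_eq subset_iff)
  qed (auto simp: galois_group_def aut)
qed

text \<open>The fibre product is realized as a subgroup of the direct product of Aut(R) and
  \<open>Q\<close>. For inverses, the inverse of \<phi> agrees on \<open>S\<close> with \<kappa> at
  the inverse of q, because \<kappa> is an action there.\<close>

lemma struct_group_group:
  assumes R: "ring R" and S: "S \<subseteq> carrier R" and Q: "group Q"
    and \<kappa>: "\<And>q s. q \<in> carrier Q \<Longrightarrow> s \<in> S \<Longrightarrow> \<kappa> q s \<in> S"
    and \<kappa>_mult: "\<And>q r s. q \<in> carrier Q \<Longrightarrow> r \<in> carrier Q \<Longrightarrow> s \<in> S \<Longrightarrow> \<kappa> (q \<otimes>\<^bsub>Q\<^esub> r) s = \<kappa> q (\<kappa> r s)"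
    and \<kappa>_one: "\<And>s. s \<in> S \<Longrightarrow> \<kappa> \<one>\<^bsub>Q\<^esub> s = s"
  shows "group (struct_group R S Q \<kappa>)"
proof -
  interpret Aut: group "aut_group R" by (rule aut_group_group[OF R])
  interpret Q: group Q by fact
  interpret D: group "aut_group R \<times>\<times> Q" by (rule DirProd_group) unfold_locales
  define K where "K = {(\<phi>, q). \<phi> \<in> ring_aut R \<and> \<phi> ` S = S \<and> q \<in> carrier Q \<and> (\<forall>s \<in> S. \<phi> s = \<kappa> q s)}"
  have aut: "\<phi> \<in> carrier (aut_group R) \<longleftrightarrow> \<phi> \<in> ring_aut R" for \<phi> by (simp add: aut_group_def)
  have mult: "\<phi> \<otimes>\<^bsub>aut_group R\<^esub> \<psi> = compose (carrier R) \<phi> \<psi>" for \<phi> \<psi> by (simp add: aut_group_def)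
  have one: "\<one>\<^bsub>aut_group R\<^esub> = restrict id (carrier R)" by (simp add: aut_group_def)
  have K: "(\<phi>, q) \<in> K \<longleftrightarrow> \<phi> \<in> ring_aut R \<and> \<phi> ` S = S \<and> q \<in> carrier Q \<and> (\<forall>s \<in> S. \<phi> s = \<kappa> q s)" for \<phi> q
    by (simp add: K_def)
  have "subgroup K (aut_group R \<times>\<times> Q)"
  proof (rule D.subgroupI)
    show "K \<subseteq> carrier (aut_group R \<times>\<times> Q)" by (auto simp: K_def aut)
    have "restrict id (carrier R) ` S = S" using S by force
    then have "(\<one>\<^bsub>aut_group R\<^esub>, \<one>\<^bsub>Q\<^esub>) \<in> K"
      using Aut.one_closed S \<kappa>_one unfolding K aut one by (simp add: subset_iff)
    then show "K \<noteq> {}" by blast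
    fix x assume "x \<in> K"
    then obtain \<phi> q where x: "x = (\<phi>, q)" and xK: "(\<phi>, q) \<in> K" by (cases x) auto
    then have \<phi>: "\<phi> \<in> ring_aut R" "\<phi> ` S = S" and q: "q \<in> carrier Q" and \<phi>S: "\<And>s. s \<in> S \<Longrightarrow> \<phi> s = \<kappa> q s"
      unfolding K by blast+
    let ?\<psi> = "inv\<^bsub>aut_group R\<^esub> \<phi>"
    have \<psi>: "?\<psi> \<in> ring_aut R" using Aut.inv_closed[of \<phi>] \<phi>(1) unfolding aut by simp
    have l: "?\<psi> (\<phi> s) = s" if s: "s \<in> S" for s
    proof -
      have "compose (carrier R) ?\<psi> \<phi> s = restrict id (carrier R) s"
        using Aut.l_inv[of \<phi>] \<phi>(1) unfolding aut mult one by simp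
      then show ?thesis using s S by (auto simp: compose_eq subset_iff)
    qed
    have "?\<psi> ` S = S"
    proof -
      have "?\<psi> ` \<phi> ` S = S" using l by (force simp: image_image)
      then show ?thesis unfolding \<phi>(2) .
    qed
    moreover have "?\<psi> s = \<kappa> (inv\<^bsub>Q\<^esub> q) s" if s: "s \<in> S" for s
    proof -
      have "s \<in> \<phi> ` S" unfolding \<phi>(2) by (rule s)
      then obtain t where t: "t \<in> S" "s = \<phi> t" by blast
      have "\<kappa> (inv\<^bsub>Q\<^esub> q) s = \<kappa> (inv\<^bsub>Q\<^esub> q) (\<kappa> q t)" using t \<phi>S by simp
      also have "\<dots> = t" using \<kappa>_mult[of "inv\<^bsub>Q\<^esub> q" q t] \<kappa>_one t q by simp
      finally show ?thesis using l[OF t(1)] t(2) by simp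
    qed
    ultimately have "(?\<psi>, inv\<^bsub>Q\<^esub> q) \<in> K" unfolding K using \<psi> q by simp
    then show "inv\<^bsub>aut_group R \<times>\<times> Q\<^esub> x \<in> K"
      unfolding x using inv_DirProd[OF Aut.group_axioms Q, of \<phi> q] \<phi>(1) q by (simp add: aut)
    fix y assume "y \<in> K"
    then obtain \<psi> r where y: "y = (\<psi>, r)" and yK: "(\<psi>, r) \<in> K" by (cases y) auto
    then have \<psi>: "\<psi> \<in> ring_aut R" "\<psi> ` S = S" and r: "r \<in> carrier Q" and \<psi>S: "\<And>s. s \<in> S \<Longrightarrow> \<psi> s = \<kappa> r s"
      unfolding K by blast+
    have c: "compose (carrier R) \<phi> \<psi> s = \<phi> (\<psi> s)" if "s \<in> S" for s using that S by (auto simp: compose_eq)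
    have "compose (carrier R) \<phi> \<psi> ` S = \<phi> ` \<psi> ` S" using c by (force simp: image_image)
    then have "compose (carrier R) \<phi> \<psi> ` S = S" unfolding \<psi>(2) \<phi>(2) .
    moreover have "\<forall>s\<in>S. compose (carrier R) \<phi> \<psi> s = \<kappa> (q \<otimes>\<^bsub>Q\<^esub> r) s"
      using c \<phi>S \<psi>S \<kappa>_mult[OF q r] \<kappa>[OF r] by simp
    ultimately have "(compose (carrier R) \<phi> \<psi>, q \<otimes>\<^bsub>Q\<^esub> r) \<in> K"
      unfolding K using compose_ring_aut[OF \<phi>(1) \<psi>(1) R] q r by simp
    then show "x \<otimes>\<^bsub>aut_group R \<times>\<times> Q\<^esub> y \<in> K" unfolding x y by (simp add: mult)
  qed
  from D.subgroup_imp_group[OF this]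
  have "group ((aut_group R \<times>\<times> Q)\<lparr>carrier := K\<rparr>)" .
  moreover have "struct_group R S Q \<kappa> = (aut_group R \<times>\<times> Q)\<lparr>carrier := K\<rparr>"
    unfolding struct_group_def DirProd_def K_def aut_group_def by simp
  ultimately show ?thesis by simp
qed

text \<open>Outer automorphisms are cosets, so a condition on one is stated for all its members.
  \<open>N\<close> sits in \<open>G\<close> as the pairs with second entry 1, and \<Gamma> will
  consist of pairs of a unit of \<open>A\<close> and a member of \<open>N\<close>, with the second
  projection as the map onto \<open>N\<close>.\<close>

theorem theorem2p4p10:
  fixes A :: "'a ring" and T S :: "'a set"
    and Q :: "'q monoid" and \<kappa>Q :: "'q \<Rightarrow> 'a \<Rightarrow> 'a"
    and k :: "('q \<times> 'q \<times> 'q \<Rightarrow> 'a) set"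
    and \<sigma>G :: "('a \<Rightarrow> 'a) \<times> 'q \<Rightarrow> ('a \<Rightarrow> 'a) set"
  defines "TR \<equiv> A\<lparr>carrier := T\<rparr>"
    and "SR \<equiv> A\<lparr>carrier := S\<rparr>"
    and "N \<equiv> galois_group (A\<lparr>carrier := T\<rparr>) S"
    and "G \<equiv> struct_group (A\<lparr>carrier := T\<rparr>) S Q \<kappa>Q"
  assumes A_ring: "ring A"
    and A_central: "T = ring_center A"
    and S_sub: "subring S TR"
    and Q_group: "group Q"
    and \<kappa>Q_hom: "\<kappa>Q \<in> hom Q (aut_group SR)"
    and galois: "galois_ext TR S N"
    and Q_normal: "\<forall>q \<in> carrier Q. \<exists>\<phi>. (\<phi>, q) \<in> carrier G"
    and k_H3: "k \<in> H3 A Q (Units SR) \<kappa>Q"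
    and \<sigma>G_hom: "\<sigma>G \<in> hom G (out_group A)"
    and \<sigma>G_normal: "\<forall>g \<in> carrier G. \<forall>\<alpha> \<in> \<sigma>G g. \<forall>t \<in> T. \<alpha> t = fst g t"
    and teich_A: "inflation3 A G (Units TR) (\<lambda>g. fst g) snd k = teich_class A G \<sigma>G"
  shows "\<exists>(\<Gamma> :: ('a \<times> ('a \<Rightarrow> 'a)) monoid) j p \<theta> \<sigma>Q \<chi>G.
     \<comment> \<open>group extension \<open>e : 1 \<rightarrow> U(A) \<rightarrow> \<Gamma> \<rightarrow> N \<rightarrow> 1\<close>\<close>
     group \<Gamma> \<and> j \<in> hom (units_of A) \<Gamma> \<and> inj_on j (Units A) \<and>
     p \<in> hom \<Gamma> ((aut_group TR)\<lparr>carrier := N\<rparr>) \<and> p ` carrier \<Gamma> = N \<and>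
     {x \<in> carrier \<Gamma>. p x = restrict id T} = j ` Units A \<and>
     \<comment> \<open>\<open>(id, \<theta>)\<close> is a morphism of crossed modules\<close>
     \<theta> \<in> hom \<Gamma> (aut_group A) \<and>
     (\<forall>u \<in> Units A. \<theta> (j u) = conj_by A u) \<and>
     (\<forall>x \<in> carrier \<Gamma>. \<forall>u \<in> Units A.
         j (\<theta> x u) = x \<otimes>\<^bsub>\<Gamma>\<^esub> j u \<otimes>\<^bsub>\<Gamma>\<^esub> inv\<^bsub>\<Gamma>\<^esub> x) \<and>
     (let C = crossed_product A \<Gamma> \<theta> j; emb = cp_emb A \<Gamma> \<theta> j; B = emb ` carrier A in
       \<comment> \<open>\<open>C\<close> is a central \<open>S\<close>-algebra\<close>
       ring_center C = emb ` S \<and>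
       \<comment> \<open>\<open>\<sigma>Q\<close> is a \<open>Q\<close>-normal structure on \<open>C\<close>\<close>
       \<sigma>Q \<in> hom Q (out_group C) \<and>
       (\<forall>q \<in> carrier Q. \<forall>\<gamma> \<in> \<sigma>Q q. \<forall>s \<in> S. \<gamma> (emb s) = emb (\<kappa>Q q s)) \<and>
       \<comment> \<open>Teichmueller class of \<open>(C, \<sigma>Q)\<close> is \<open>k\<close>\<close>
       teich_class C Q \<sigma>Q = (\<lambda>f. restrict (emb \<circ> f) (triples Q)) ` k \<and>
       \<comment> \<open>strong \<open>Q\<close>-normal Deuring embedding\<close>
       \<chi>G \<in> hom G (out_rel_group C B (emb ` Units A)) \<and>
       (\<forall>n \<in> N. \<chi>G (n, \<one>\<^bsub>Q\<^esub>) \<subseteq> conj_by C ` unit_normalizer C B \<and>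
                (\<forall>\<gamma> \<in> \<chi>G (n, \<one>\<^bsub>Q\<^esub>). \<forall>t \<in> T. \<gamma> (emb t) = emb (n t))) \<and>
       (\<forall>g \<in> carrier G. \<chi>G g \<subseteq> \<sigma>Q (snd g)) \<and>
       (\<forall>g \<in> carrier G. \<forall>\<gamma> \<in> \<chi>G g. \<forall>t \<in> T. \<gamma> (emb t) = emb (fst g t)) \<and>
       \<comment> \<open>\<open>res \<circ> \<chi>G = \<sigma>G\<close>\<close>
       (\<forall>g \<in> carrier G. \<forall>\<gamma> \<in> \<chi>G g.
          restrict (\<lambda>a. the_inv_into (carrier A) emb (\<gamma> (emb a))) (carrier A) \<in> \<sigma>G g))"
proof -
  interpret ring A by (rule A_ring)
  have subT: "subring T A" unfolding A_central by (rule ring_center_subring)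
  interpret TR: ring TR unfolding TR_def by (rule subring_is_ring[OF subT])
  interpret Q: group Q by (rule Q_group)
  have TR_simps: "carrier TR = T" "\<And>x y. x \<otimes>\<^bsub>TR\<^esub> y = x \<otimes>\<^bsub>A\<^esub> y" "\<one>\<^bsub>TR\<^esub> = \<one>\<^bsub>A\<^esub>" "\<zero>\<^bsub>TR\<^esub> = \<zero>\<^bsub>A\<^esub>"
    by (simp_all add: TR_def)
  have T_sub: "T \<subseteq> carrier A" using subringE(1)[OF subT] .
  have S_T: "S \<subseteq> T" using subringE(1)[OF S_sub] by (simp add: TR_simps)
  have S_c: "S \<subseteq> carrier A" using S_T T_sub by blast
  have S_one: "\<one>\<^bsub>A\<^esub> \<in> S" using subringE(3)[OF S_sub] by (simp add: TR_simps)
  have S_mult: "x \<otimes>\<^bsub>A\<^esub> y \<in> S" if "x \<in> S" "y \<in> S" for x y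
    using subringE(6)[OF S_sub that] by (simp add: TR_simps)
  have T_center: "t \<in> ring_center A" if "t \<in> T" for t using that A_central by simp
  have T_comm: "t \<otimes>\<^bsub>A\<^esub> x = x \<otimes>\<^bsub>A\<^esub> t" if "t \<in> T" "x \<in> carrier A" for t x
    using ring_centerD(2)[OF T_center[OF that(1)] that(2)] .
  \<comment> \<open>Inner automorphisms of \<open>A\<close> are trivial on \<open>T\<close>, so all
    members of a coset in Out(A) act alike on \<open>T\<close>.\<close>
  have conj_T: "w \<otimes>\<^bsub>A\<^esub> t \<otimes>\<^bsub>A\<^esub> inv\<^bsub>A\<^esub> w = t" if t: "t \<in> T" and w: "w \<in> Units A" for t w
    unfolding T_comm[OF t Units_closed[OF w], symmetric] using w T_sub t by (simp add: m_assoc subset_iff Units_closed)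
  have TR_aut_closed: "\<phi> t \<in> T" if "\<phi> \<in> ring_aut TR" "t \<in> T" for \<phi> t
    using ring_autD(4)[OF that(1), of t] that(2) by (simp add: TR_simps)

  have \<kappa>_aut: "\<kappa>Q r \<in> ring_aut SR" if "r \<in> carrier Q" for r
    using \<kappa>Q_hom that by (auto simp: hom_def aut_group_def)
  have \<kappa>_closed: "\<kappa>Q r s \<in> S" if "r \<in> carrier Q" "s \<in> S" for r s
    using ring_autD(4)[OF \<kappa>_aut[OF that(1)], of s] that(2) by (simp add: SR_def)
  have \<kappa>_mult: "\<kappa>Q r (x \<otimes>\<^bsub>A\<^esub> y) = \<kappa>Q r x \<otimes>\<^bsub>A\<^esub> \<kappa>Q r y" if "r \<in> carrier Q" "x \<in> S" "y \<in> S" for r x y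
    using ring_autD(5)[OF \<kappa>_aut[OF that(1)], of x y] that(2,3) by (simp add: SR_def)
  have \<kappa>_one: "\<kappa>Q r \<one>\<^bsub>A\<^esub> = \<one>\<^bsub>A\<^esub>" if "r \<in> carrier Q" for r
    using ring_autD(7)[OF \<kappa>_aut[OF that]] by (simp add: SR_def)
  have \<kappa>_comp: "\<kappa>Q (q \<otimes>\<^bsub>Q\<^esub> r) s = \<kappa>Q q (\<kappa>Q r s)" if "q \<in> carrier Q" "r \<in> carrier Q" "s \<in> S" for q r s
    using \<kappa>Q_hom that by (simp add: hom_def aut_group_def compose_eq SR_def)
  have \<kappa>_id: "\<kappa>Q \<one>\<^bsub>Q\<^esub> s = s" if s: "s \<in> S" for s
  proof (rule ring_aut_inj[OF \<kappa>_aut[OF Q.one_closed]])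
    show "\<kappa>Q \<one>\<^bsub>Q\<^esub> (\<kappa>Q \<one>\<^bsub>Q\<^esub> s) = \<kappa>Q \<one>\<^bsub>Q\<^esub> s"
      unfolding \<kappa>_comp[OF Q.one_closed Q.one_closed s, symmetric] by simp
  qed (use s \<kappa>_closed in \<open>simp_all add: SR_def\<close>)

  have SU: "s \<in> Units A" "s \<in> S" "inv\<^bsub>A\<^esub> s \<in> Units SR" if s: "s \<in> Units SR" for s
  proof -
    obtain t where t: "t \<in> S" "t \<otimes>\<^bsub>A\<^esub> s = \<one>\<^bsub>A\<^esub>" "s \<otimes>\<^bsub>A\<^esub> t = \<one>\<^bsub>A\<^esub>" and sS: "s \<in> S"
      using s unfolding Units_def SR_def by auto
    show "s \<in> Units A" using t sS S_c unfolding Units_def by blast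
    show "s \<in> S" by (rule sS)
    have "inv\<^bsub>A\<^esub> s = t" using inv_unique'[of s t] t sS S_c by (auto simp: subset_iff)
    then show "inv\<^bsub>A\<^esub> s \<in> Units SR" using t sS unfolding Units_def SR_def by auto
  qed
  interpret um: unit_module A Q "Units SR" \<kappa>Q
  proof (unfold_locales)
    show "Units SR \<subseteq> Units A" using SU(1) by blast
    show "\<one>\<^bsub>A\<^esub> \<in> Units SR" using S_one unfolding Units_def SR_def by (auto intro!: bexI[OF _ S_one])
    fix x assume x: "x \<in> Units SR"
    show "inv\<^bsub>A\<^esub> x \<in> Units SR" by (rule SU(3)[OF x])
    show "\<kappa>Q \<one>\<^bsub>Q\<^esub> x = x" by (rule \<kappa>_id[OF SU(2)[OF x]])
    show "\<kappa>Q g x \<in> Units SR" if g: "g \<in> carrier Q" for g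
    proof -
      obtain t where t: "t \<in> S" "t \<otimes>\<^bsub>A\<^esub> x = \<one>\<^bsub>A\<^esub>" "x \<otimes>\<^bsub>A\<^esub> t = \<one>\<^bsub>A\<^esub>" and xS: "x \<in> S"
        using x unfolding Units_def SR_def by auto
      have "\<kappa>Q g t \<otimes>\<^bsub>A\<^esub> \<kappa>Q g x = \<one>\<^bsub>A\<^esub>" "\<kappa>Q g x \<otimes>\<^bsub>A\<^esub> \<kappa>Q g t = \<one>\<^bsub>A\<^esub>"
        using \<kappa>_mult[OF g t(1) xS] \<kappa>_mult[OF g xS t(1)] t \<kappa>_one[OF g] by simp_all
      then show ?thesis using \<kappa>_closed[OF g t(1)] \<kappa>_closed[OF g xS] unfolding Units_def SR_def by auto
    qed
    fix y assume y: "y \<in> Units SR"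
    show "x \<otimes>\<^bsub>A\<^esub> y = y \<otimes>\<^bsub>A\<^esub> x" using T_comm[of x y] SU(2)[OF x] SU(2)[OF y] S_T S_c by blast
    show "\<kappa>Q g (x \<otimes>\<^bsub>A\<^esub> y) = \<kappa>Q g x \<otimes>\<^bsub>A\<^esub> \<kappa>Q g y" if "g \<in> carrier Q" for g
      by (rule \<kappa>_mult[OF that SU(2)[OF x] SU(2)[OF y]])
    show "x \<otimes>\<^bsub>A\<^esub> y \<in> Units SR"
    proof -
      have xy: "x \<in> Units A" "y \<in> Units A" using SU(1) x y by auto
      have "inv\<^bsub>A\<^esub> y \<otimes>\<^bsub>A\<^esub> inv\<^bsub>A\<^esub> x \<in> S" using S_mult SU(2)[OF SU(3)] x y by blast
      moreover have "inv\<^bsub>A\<^esub> y \<otimes>\<^bsub>A\<^esub> inv\<^bsub>A\<^esub> x \<otimes>\<^bsub>A\<^esub> (x \<otimes>\<^bsub>A\<^esub> y) = \<one>\<^bsub>A\<^esub>" "x \<otimes>\<^bsub>A\<^esub> y \<otimes>\<^bsub>A\<^esub> (inv\<^bsub>A\<^esub> y \<otimes>\<^bsub>A\<^esub> inv\<^bsub>A\<^esub> x) = \<one>\<^bsub>A\<^esub>"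
        using xy by (simp_all add: m_assoc Units_closed inv_cancel)
      ultimately show ?thesis using S_mult[OF SU(2)[OF x] SU(2)[OF y]] unfolding Units_def SR_def by auto
    qed
  qed
  obtain f0 where f0: "cocycle3 A Q (Units SR) \<kappa>Q f0" "k = cohom_class3 A Q (Units SR) \<kappa>Q f0"
    using k_H3 unfolding H3_def by blast
  obtain f where f: "f \<in> triples Q \<rightarrow>\<^sub>E Units SR" and kf: "k = cohom_class3 A Q (Units SR) \<kappa>Q f"
    and f_norm: "\<And>a b. a \<in> carrier Q \<Longrightarrow> b \<in> carrier Q \<Longrightarrow> f (\<one>\<^bsub>Q\<^esub>, a, b) = \<one>\<^bsub>A\<^esub> \<and> f (a, \<one>\<^bsub>Q\<^esub>, b) = \<one>\<^bsub>A\<^esub> \<and> f (a, b, \<one>\<^bsub>Q\<^esub>) = \<one>\<^bsub>A\<^esub>"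
    using um.cocycle3_normalize[OF f0(1)] f0(2) by metis
  have fU: "f x \<in> Units A" "f x \<in> S" if "x \<in> triples Q" for x using PiE_mem[OF f that] SU by auto

  interpret G: group G
    unfolding G_def TR_def[symmetric]
    by (rule struct_group_group[OF TR.ring_axioms _ Q_group \<kappa>_closed \<kappa>_comp \<kappa>_id]) (simp_all add: TR_simps S_T)
  have G_iff: "(\<phi>, r) \<in> carrier G \<longleftrightarrow> \<phi> \<in> ring_aut TR \<and> \<phi> ` S = S \<and> r \<in> carrier Q \<and> (\<forall>s\<in>S. \<phi> s = \<kappa>Q r s)" for \<phi> r
    by (simp add: G_def struct_group_def TR_def)
  have G_D: "fst g \<in> ring_aut TR" "snd g \<in> carrier Q" "\<And>s. s \<in> S \<Longrightarrow> fst g s = \<kappa>Q (snd g) s" if "g \<in> carrier G" for g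
    using that G_iff[of "fst g" "snd g"] by auto
  have G_mult: "g \<otimes>\<^bsub>G\<^esub> h = (compose T (fst g) (fst h), snd g \<otimes>\<^bsub>Q\<^esub> snd h)" for g h
    by (simp add: G_def struct_group_def split_beta)
  have G_one: "\<one>\<^bsub>G\<^esub> = (restrict id T, \<one>\<^bsub>Q\<^esub>)" by (simp add: G_def struct_group_def)
  interpret Aut: group "aut_group TR" by (rule aut_group_group[OF TR.ring_axioms])
  define NN where "NN = (aut_group TR)\<lparr>carrier := N\<rparr>"
  have N_eq: "N = galois_group TR S" by (simp add: N_def TR_def)
  interpret NN: group NN
    unfolding NN_def N_eq by (rule Aut.subgroup_imp_group[OF galois_group_subgroup[OF TR.ring_axioms]]) (simp add: TR_simps S_T)
  have NN_simps: "carrier NN = N" "\<And>m n. m \<otimes>\<^bsub>NN\<^esub> n = compose T m n" "\<one>\<^bsub>NN\<^esub> = restrict id T"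
    by (simp_all add: NN_def aut_group_def TR_simps)
  have N_iff: "n \<in> N \<longleftrightarrow> n \<in> ring_aut TR \<and> (\<forall>s\<in>S. n s = s)" for n
    by (simp add: N_eq galois_group_def)
  have N_G: "(n, \<one>\<^bsub>Q\<^esub>) \<in> carrier G \<longleftrightarrow> n \<in> N" for n
  proof -
    have "n ` S = S" if "\<forall>s\<in>S. n s = s" using that by force
    then show ?thesis unfolding G_iff N_iff using \<kappa>_id by auto
  qed

  let ?infl = "restrict (\<lambda>(a, b, c). f (snd a, snd b, snd c)) (triples G)"
  have infl_closed: "?infl \<in> triples G \<rightarrow>\<^sub>E carrier A"
  proof (rule PiE_I)
    fix x assume "x \<in> triples G"
    then obtain a b c where x: "x = (a, b, c)" "a \<in> carrier G" "b \<in> carrier G" "c \<in> carrier G"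
      by (auto simp: triples_def)
    then have "(snd a, snd b, snd c) \<in> triples Q" using G_D(2) by (simp add: triples_def)
    then show "?infl x \<in> carrier A" using x fU(1) Units_closed by (simp add: triples_def)
  qed simp
  have TU: "t \<in> Units A" "t \<in> T" "inv\<^bsub>A\<^esub> t \<in> Units TR" if t: "t \<in> Units TR" for t
  proof -
    obtain s where s: "s \<in> T" "s \<otimes>\<^bsub>A\<^esub> t = \<one>\<^bsub>A\<^esub>" "t \<otimes>\<^bsub>A\<^esub> s = \<one>\<^bsub>A\<^esub>" and tT: "t \<in> T"
      using t unfolding Units_def TR_simps by auto
    show "t \<in> Units A" using s tT T_sub unfolding Units_def by blast
    show "t \<in> T" by (rule tT)
    have "inv\<^bsub>A\<^esub> t = s" using inv_unique'[of t s] s tT T_sub by (auto simp: subset_iff)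
    then show "inv\<^bsub>A\<^esub> t \<in> Units TR" using s tT unfolding Units_def TR_simps by auto
  qed
  interpret umT: unit_module A G "Units TR" "\<lambda>g. fst g"
  proof (unfold_locales)
    show "Units TR \<subseteq> Units A" using TU(1) by blast
    show "\<one>\<^bsub>A\<^esub> \<in> Units TR" using TR.Units_one_closed by (simp add: TR_simps)
    fix x assume x: "x \<in> Units TR"
    show "inv\<^bsub>A\<^esub> x \<in> Units TR" by (rule TU(3)[OF x])
    show "fst \<one>\<^bsub>G\<^esub> x = x" using TU(2)[OF x] by (simp add: G_one)
    show "fst g x \<in> Units TR" if g: "g \<in> carrier G" for g
      by (rule ring_aut_unit(1)[OF TR.ring_axioms G_D(1)[OF g] x])
    fix y assume y: "y \<in> Units TR"
    show "x \<otimes>\<^bsub>A\<^esub> y = y \<otimes>\<^bsub>A\<^esub> x" using T_comm[of x y] TU(2)[OF x] TU(2)[OF y] T_sub by blast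
    show "fst g (x \<otimes>\<^bsub>A\<^esub> y) = fst g x \<otimes>\<^bsub>A\<^esub> fst g y" if g: "g \<in> carrier G" for g
      using ring_autD(5)[OF G_D(1)[OF g], of x y] TU(2)[OF x] TU(2)[OF y] by (simp add: TR_simps)
    show "x \<otimes>\<^bsub>A\<^esub> y \<in> Units TR" using TR.Units_m_closed[OF x y] by (simp add: TR_simps)
  qed
  \<comment> \<open>With the constant cochain 1 the inflated cocycle itself lies in the inflated
    class, hence in the Teichmueller class. This yields a section and units whose obstruction is
    exactly \<open>?infl\<close>.\<close>
  have "f \<in> k" unfolding kf
    by (rule um.cohom_class3_self) (use f um.M_carrier in \<open>auto simp: PiE_def Pi_def\<close>)
  then have "?infl \<in> inflation3 A G (Units TR) (\<lambda>g. fst g) snd k"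
    unfolding inflation3_def using umT.cohom_class3_self[OF infl_closed] by blast
  then have "?infl \<in> teich_class A G \<sigma>G" using teich_A by simp
  then obtain \<alpha> u where \<alpha>\<sigma>: "\<And>g. g \<in> carrier G \<Longrightarrow> \<alpha> g \<in> \<sigma>G g" and d: "teich_data G \<alpha> u ?infl"
    unfolding teich_class_alt by blast
  have d': "teich_data G \<alpha> u (\<lambda>(a, b, c). f (snd a, snd b, snd c))"
    using d unfolding teich_data_def by (simp add: triples_def)
  interpret AA: group "aut_group A" by (rule aut_group_group[OF A_ring])
  \<comment> \<open>Any member represents its coset, so \<open>\<alpha> g\<close> can replace the
    representative hidden in \<open>\<sigma>G g\<close>.\<close>
  have \<sigma>_coset: "\<sigma>G g = conj_by A ` Units A #>\<^bsub>aut_group A\<^esub> \<alpha> g \<and> \<alpha> g \<in> ring_aut A" if g: "g \<in> carrier G" for g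
  proof -
    have "\<sigma>G g \<in> rcosets\<^bsub>aut_group A\<^esub> (conj_by A ` Units A)"
      using \<sigma>G_hom g by (auto simp: hom_def out_group_def FactGroup_def)
    then obtain \<psi> where \<psi>: "\<psi> \<in> carrier (aut_group A)" "\<sigma>G g = conj_by A ` Units A #>\<^bsub>aut_group A\<^esub> \<psi>"
      unfolding RCOSETS_def by blast
    have sub: "subgroup (conj_by A ` Units A) (aut_group A)" by (rule normal_imp_subgroup[OF inner_normal])
    have mem: "\<alpha> g \<in> conj_by A ` Units A #>\<^bsub>aut_group A\<^esub> \<psi>" using \<alpha>\<sigma>[OF g] \<psi>(2) by simp
    have "\<alpha> g \<in> carrier (aut_group A)"
      using AA.r_coset_subset_G[OF subgroup.subset[OF sub] \<psi>(1)] mem by blast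
    then show ?thesis using AA.repr_independence[OF mem \<psi>(1) sub] \<psi>(2) by (simp add: aut_group_def)
  qed
  have \<alpha>_T: "\<alpha> g t = fst g t" if "g \<in> carrier G" "t \<in> T" for g t
    using \<sigma>G_normal \<alpha>\<sigma> that by blast
  define e where "e n = (n, \<one>\<^bsub>Q\<^esub>)" for n :: "'a \<Rightarrow> 'a"
  interpret fs: factor_system A G Q NN \<alpha> u f snd e
  proof (unfold_locales)
    show "teich_data G \<alpha> u (\<lambda>(a, b, c). f (snd a, snd b, snd c))" by (rule d')
    show "\<alpha> g \<in> ring_aut A" if "g \<in> carrier G" for g using \<sigma>_coset[OF that] by simp
    show "f \<in> triples Q \<rightarrow>\<^sub>E Units A" using f fU(1) by (auto simp: PiE_def Pi_def)
    show "f x \<in> ring_center A" if "x \<in> triples Q" for x using T_center fU(2)[OF that] S_T by blast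
    show "snd \<in> hom G Q" by (rule homI) (simp_all add: G_D(2) G_mult)
    show "\<exists>g\<in>carrier G. snd g = r" if r: "r \<in> carrier Q" for r
    proof -
      obtain \<phi> where "(\<phi>, r) \<in> carrier G" using Q_normal r by blast
      then show ?thesis by (intro bexI[of _ "(\<phi>, r)"]) simp_all
    qed
    show "e \<in> hom NN G" by (rule homI) (simp_all add: NN_simps e_def N_G G_mult)
    show "inj_on e (carrier NN)" by (rule inj_onI) (simp add: e_def)
    show "e ` carrier NN = {g \<in> carrier G. snd g = \<one>\<^bsub>Q\<^esub>}"
    proof (rule equalityI; rule subsetI)
      fix g assume "g \<in> e ` carrier NN"
      then show "g \<in> {g \<in> carrier G. snd g = \<one>\<^bsub>Q\<^esub>}" using N_G by (auto simp: NN_simps e_def)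
    next
      fix g assume "g \<in> {g \<in> carrier G. snd g = \<one>\<^bsub>Q\<^esub>}"
      then have gG: "g \<in> carrier G" and g: "g = (fst g, \<one>\<^bsub>Q\<^esub>)" by (simp_all add: prod_eq_iff)
      have "fst g \<in> N" using gG N_G[of "fst g"] unfolding g[symmetric] by simp
      then show "g \<in> e ` carrier NN" unfolding NN_simps e_def using g by (intro image_eqI)
    qed
  qed (use f_norm in auto)

  \<comment> \<open>The conjugation part of \<Theta> is invisible on the center, which leaves the
    action of the \<open>G\<close>-component.\<close>
  have \<Theta>_T: "fs.\<Theta> E t = fst (snd E) t" if E: "E \<in> fs.M" and t: "t \<in> T" for E t
  proof -
    have m: "fst E \<in> Units A" "snd E \<in> carrier G" using E by (auto simp: fs.M_def)
    have "fst (snd E) t \<in> T" by (rule TR_aut_closed[OF G_D(1)[OF m(2)] t])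
    then show ?thesis using fs.\<Theta>_app[OF E] t T_sub \<alpha>_T[OF m(2) t] conj_T[OF _ m(1)] by (simp add: subset_iff)
  qed
  have \<theta>_T: "fs.\<theta> \<gamma> t = snd \<gamma> t" if "\<gamma> \<in> carrier fs.\<Gamma>" "t \<in> T" for \<gamma> t
    using \<Theta>_T[OF fs.\<iota>_closed[OF that(1)] that(2)] by (simp add: fs.\<theta>_def fs.\<iota>_def e_def)
  have \<Gamma>_carrier: "carrier fs.\<Gamma> = Units A \<times> N" by (simp add: fs.\<Gamma>_def NN_simps)
  have ker: "{x \<in> carrier fs.\<Gamma>. snd x = restrict id T} = fs.j ` Units A"
  proof (rule equalityI; rule subsetI)
    fix x assume "x \<in> {x \<in> carrier fs.\<Gamma>. snd x = restrict id T}"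
    then have x: "fst x \<in> Units A" "snd x = restrict id T" by (auto simp: \<Gamma>_carrier)
    \<comment> \<open>The factor \<open>fs.u1\<close> undoes the correction built into
      \<open>fs.j\<close>.\<close>
    have "x = fs.j (fst x \<otimes>\<^bsub>A\<^esub> fs.u1)"
      using x fs.u1 by (simp add: fs.j_def NN_simps prod_eq_iff m_assoc Units_closed)
    then show "x \<in> fs.j ` Units A" using x(1) fs.u1(1) by blast
  next
    fix x assume "x \<in> fs.j ` Units A"
    then show "x \<in> {x \<in> carrier fs.\<Gamma>. snd x = restrict id T}"
      using fs.j_closed' by (auto simp: fs.j_def NN_simps)
  qed
  have id_N: "restrict id T \<in> N" using NN.one_closed by (simp add: NN_simps)
  have center: "ring_center fs.C = fs.emb ` S"
  proof (rule fs.center_crossed_product[OF A_central])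
    have "S = {t \<in> T. \<forall>n\<in>N. n t = t}" using galois by (simp add: galois_ext_def TR_simps)
    also have "\<dots> = {t \<in> T. \<forall>\<gamma>\<in>carrier fs.\<Gamma>. fs.\<theta> \<gamma> t = t}"
    proof -
      have "(\<forall>n\<in>N. n t = t) \<longleftrightarrow> (\<forall>\<gamma>\<in>carrier fs.\<Gamma>. fs.\<theta> \<gamma> t = t)" if t: "t \<in> T" for t
      proof
        assume "\<forall>n\<in>N. n t = t"
        then show "\<forall>\<gamma>\<in>carrier fs.\<Gamma>. fs.\<theta> \<gamma> t = t" using \<theta>_T[OF _ t] by (auto simp: \<Gamma>_carrier)
      next
        assume a: "\<forall>\<gamma>\<in>carrier fs.\<Gamma>. fs.\<theta> \<gamma> t = t"
        show "\<forall>n\<in>N. n t = t"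
        proof
          fix n assume "n \<in> N"
          then have "(\<one>\<^bsub>A\<^esub>, n) \<in> carrier fs.\<Gamma>" by (simp add: \<Gamma>_carrier)
          then show "n t = t" using \<theta>_T[OF _ t] a by fastforce
        qed
      qed
      then show ?thesis by blast
    qed
    finally show "S = {t \<in> T. \<forall>\<gamma>\<in>carrier fs.\<Gamma>. fs.\<theta> \<gamma> t = t}" .
    fix \<gamma> assume \<gamma>: "\<gamma> \<in> carrier fs.\<Gamma>" "\<gamma> \<notin> fs.j ` Units A"
    have n: "snd \<gamma> \<in> N" using \<gamma>(1) by (auto simp: \<Gamma>_carrier)
    \<comment> \<open>Outside j(U(A)) the component in \<open>N\<close> is not the identity, so its
      Galois sum is 0, while the sum at the identity is 1.\<close>
    have nid: "snd \<gamma> \<noteq> restrict id T" using \<gamma> ker by blast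
    obtain m :: nat and x y where xy: "\<And>i. i < m \<Longrightarrow> x i \<in> T \<and> y i \<in> T"
      and sum: "\<And>\<tau>. \<tau> \<in> N \<Longrightarrow> (\<Oplus>\<^bsub>TR\<^esub> i \<in> {..<m}. x i \<otimes>\<^bsub>A\<^esub> \<tau> (y i)) = (if \<tau> = restrict id T then \<one>\<^bsub>A\<^esub> else \<zero>\<^bsub>A\<^esub>)"
      using galois unfolding galois_ext_def TR_simps by blast
    have Tm: "x i \<otimes>\<^bsub>A\<^esub> \<tau> (y i) \<in> T" if "\<tau> \<in> N" "i < m" for \<tau> i
      using subringE(6)[OF subT] xy[OF that(2)] TR_aut_closed[of \<tau> "y i"] that(1) N_iff by blast
    have fin: "(\<Oplus>\<^bsub>TR\<^esub> i \<in> {..<m}. x i \<otimes>\<^bsub>A\<^esub> \<tau> (y i)) = (\<Oplus>\<^bsub>A\<^esub> i \<in> {..<m}. x i \<otimes>\<^bsub>A\<^esub> \<tau> (y i))" if "\<tau> \<in> N" for \<tau>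
      unfolding TR_def by (rule finsum_subring[OF subT]) (use Tm[OF that] in auto)
    have cl: "(\<lambda>i. x i \<otimes>\<^bsub>A\<^esub> \<tau> (y i)) \<in> {..<m} \<rightarrow> carrier A" if "\<tau> \<in> N" for \<tau>
      using Tm[OF that] T_sub by blast
    have "(\<Oplus>\<^bsub>A\<^esub> i \<in> {..<m}. x i \<otimes>\<^bsub>A\<^esub> y i) = (\<Oplus>\<^bsub>A\<^esub> i \<in> {..<m}. x i \<otimes>\<^bsub>A\<^esub> (restrict id T) (y i))"
      by (rule finsum_cong'[OF refl cl[OF id_N]]) (use xy in simp)
    then have "(\<Oplus>\<^bsub>A\<^esub> i \<in> {..<m}. x i \<otimes>\<^bsub>A\<^esub> y i) = \<one>\<^bsub>A\<^esub>" using sum[OF id_N] fin[OF id_N] by simp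
    moreover have "(\<Oplus>\<^bsub>A\<^esub> i \<in> {..<m}. x i \<otimes>\<^bsub>A\<^esub> fs.\<theta> \<gamma> (y i)) = (\<Oplus>\<^bsub>A\<^esub> i \<in> {..<m}. x i \<otimes>\<^bsub>A\<^esub> snd \<gamma> (y i))"
      by (rule finsum_cong'[OF refl cl[OF n]]) (use xy \<theta>_T[OF \<gamma>(1)] in simp)
    then have "(\<Oplus>\<^bsub>A\<^esub> i \<in> {..<m}. x i \<otimes>\<^bsub>A\<^esub> fs.\<theta> \<gamma> (y i)) = \<zero>\<^bsub>A\<^esub>" using sum[OF n] fin[OF n] nid by simp
    ultimately show "\<exists>(n::nat) x y. (\<forall>i<n. x i \<in> T \<and> y i \<in> T) \<and> (\<Oplus>\<^bsub>A\<^esub> i \<in> {..<n}. x i \<otimes>\<^bsub>A\<^esub> y i) = \<one>\<^bsub>A\<^esub>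
        \<and> (\<Oplus>\<^bsub>A\<^esub> i \<in> {..<n}. x i \<otimes>\<^bsub>A\<^esub> fs.\<theta> \<gamma> (y i)) = \<zero>\<^bsub>A\<^esub>"
      using xy by blast
  qed

  have p_hom: "snd \<in> hom fs.\<Gamma> NN" by (rule homI) (auto simp: fs.\<Gamma>_def)
  have p_surj: "snd ` carrier fs.\<Gamma> = N" unfolding \<Gamma>_carrier using Units_one_closed by force
  have \<Theta>_S: "fs.\<Theta> E s = \<kappa>Q (snd (snd E)) s" if E: "E \<in> fs.M" and s: "s \<in> S" for E s
  proof -
    have "snd E \<in> carrier G" using E by (auto simp: fs.M_def)
    then show ?thesis using \<Theta>_T[OF E] S_T s G_D(3)[of "snd E" s] by auto
  qed
  have sQ_normal: "\<gamma> (fs.emb s) = fs.emb (\<kappa>Q r s)" if r: "r \<in> carrier Q" and \<gamma>: "\<gamma> \<in> fs.nuc.sQ r" and s: "s \<in> S" for r \<gamma> s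
  proof -
    note m = fs.nuc.sec[OF r]
    obtain w where w: "w \<in> Units fs.C" "\<gamma> = compose (carrier fs.C) (conj_by fs.C w) (fs.nuc.\<beta> (fs.nuc.sec r))"
      using fs.nuc.sQ_elem[OF m(1)] \<gamma> m(2) by auto
    have sc: "s \<in> carrier A" using s S_c by blast
    \<comment> \<open>Members of the coset differ from \<beta> of the section value by conjugation
      with \<open>w\<close>, which fixes central elements of \<open>C\<close>.\<close>
    have z: "fs.emb (\<kappa>Q r s) \<in> ring_center fs.C" unfolding center using \<kappa>_closed[OF r s] by blast
    note zc = fs.C.ring_centerD(1)[OF z]
    have "\<gamma> (fs.emb s) = conj_by fs.C w (fs.emb (\<kappa>Q r s))"
      unfolding w(2) compose_eq[OF fs.emb_closed[OF sc]] fs.nuc.\<beta>_emb[OF m(1) sc] \<Theta>_S[OF m(1) s] m(2) ..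
    also have "\<dots> = w \<otimes>\<^bsub>fs.C\<^esub> fs.emb (\<kappa>Q r s) \<otimes>\<^bsub>fs.C\<^esub> inv\<^bsub>fs.C\<^esub> w" by (rule fs.C.conj_by_app[OF zc])
    also have "\<dots> = fs.emb (\<kappa>Q r s) \<otimes>\<^bsub>fs.C\<^esub> w \<otimes>\<^bsub>fs.C\<^esub> inv\<^bsub>fs.C\<^esub> w"
      using fs.C.ring_centerD(2)[OF z fs.C.Units_closed[OF w(1)]] by simp
    also have "\<dots> = fs.emb (\<kappa>Q r s)" using w(1) zc by (simp add: fs.C.m_assoc fs.C.Units_closed)
    finally show ?thesis .
  qed
  have teich: "teich_class fs.C Q fs.nuc.sQ = (\<lambda>f. restrict (fs.emb \<circ> f) (triples Q)) ` k"
    unfolding kf SR_def by (rule fs.nuc.teich_class_C[OF S_c center \<Theta>_S \<kappa>_closed fU(2)])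
  have chi_T: "\<gamma> (fs.emb t) = fs.emb (fst g t)" if g: "g \<in> carrier G" and \<gamma>: "\<gamma> \<in> fs.nuc.chi g" and t: "t \<in> T" for g \<gamma> t
  proof -
    note m = fs.nuc.lift[OF g]
    obtain w where w: "w \<in> Units A" "\<And>a. a \<in> carrier A \<Longrightarrow> \<gamma> (fs.emb a) = fs.emb (w \<otimes>\<^bsub>A\<^esub> fs.\<Theta> (fs.nuc.lift g) a \<otimes>\<^bsub>A\<^esub> inv\<^bsub>A\<^esub> w)"
      using fs.nuc.chi_elem_emb[OF m(1), unfolded m(2), OF \<gamma>] by blast
    have "fst g t \<in> T" by (rule TR_aut_closed[OF G_D(1)[OF g] t])
    then show ?thesis using w(2)[of t] t T_sub \<Theta>_T[OF m(1) t] m(2) conj_T[OF _ w(1)] by (simp add: subset_iff)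
  qed
  \<comment> \<open>The pair of 1 and n belongs to \<Gamma>, so this is a coset over a nuclear
    element.\<close>
  have chi_N: "fs.nuc.chi (n, \<one>\<^bsub>Q\<^esub>) \<subseteq> conj_by fs.C ` unit_normalizer fs.C (fs.emb ` carrier A)" if n: "n \<in> N" for n
    using fs.nuc.chi_\<iota>_subset[of "(\<one>\<^bsub>A\<^esub>, n)"] n by (simp add: \<Gamma>_carrier fs.\<iota>_def e_def)
  have res: "restrict (\<lambda>a. the_inv_into (carrier A) fs.emb (\<gamma> (fs.emb a))) (carrier A) \<in> \<sigma>G g"
    if g: "g \<in> carrier G" and \<gamma>: "\<gamma> \<in> fs.nuc.chi g" for g \<gamma>
  proof -
    \<comment> \<open>Since \<open>chi g\<close> may be computed from any element over g, the one
      with unit 1 is taken; for it \<Theta> is \<open>\<alpha> g\<close> itself.\<close>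
    let ?E = "(\<one>\<^bsub>A\<^esub>, g)"
    have m: "?E \<in> fs.M" "snd ?E = g" using g by (simp_all add: fs.M_def)
    have aut: "\<alpha> g \<in> ring_aut A" using \<sigma>_coset[OF g] by simp
    obtain w where w: "w \<in> Units A" "\<And>a. a \<in> carrier A \<Longrightarrow> \<gamma> (fs.emb a) = fs.emb (w \<otimes>\<^bsub>A\<^esub> fs.\<Theta> ?E a \<otimes>\<^bsub>A\<^esub> inv\<^bsub>A\<^esub> w)"
      using fs.nuc.chi_elem_emb[OF m(1), unfolded m(2), OF \<gamma>] by blast
    have "restrict (\<lambda>a. the_inv_into (carrier A) fs.emb (\<gamma> (fs.emb a))) (carrier A) = compose (carrier A) (conj_by A w) (\<alpha> g)"
    proof (rule ext)
      fix a
      show "restrict (\<lambda>a. the_inv_into (carrier A) fs.emb (\<gamma> (fs.emb a))) (carrier A) a = compose (carrier A) (conj_by A w) (\<alpha> g) a"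
      proof (cases "a \<in> carrier A")
        case True
        have ac: "\<alpha> g a \<in> carrier A" by (rule ring_autD(4)[OF aut True])
        have "fs.\<Theta> ?E a = \<alpha> g a" using fs.\<Theta>_app[OF m(1) True] ac by simp
        then have "\<gamma> (fs.emb a) = fs.emb (w \<otimes>\<^bsub>A\<^esub> \<alpha> g a \<otimes>\<^bsub>A\<^esub> inv\<^bsub>A\<^esub> w)" using w(2)[OF True] by simp
        then show ?thesis using the_inv_into_f_f[OF fs.emb_inj, of "w \<otimes>\<^bsub>A\<^esub> \<alpha> g a \<otimes>\<^bsub>A\<^esub> inv\<^bsub>A\<^esub> w"] True ac w(1)
          by (simp add: compose_eq conj_by_app Units_closed)
      qed (simp add: compose_def)
    qed
    then show ?thesis using \<sigma>_coset[OF g] w(1) by (auto simp: r_coset_def aut_group_def)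
  qed
  have N_chi: "\<gamma> (fs.emb t) = fs.emb (n t)" if "n \<in> N" "\<gamma> \<in> fs.nuc.chi (n, \<one>\<^bsub>Q\<^esub>)" "t \<in> T" for n \<gamma> t
    using chi_T[of "(n, \<one>\<^bsub>Q\<^esub>)" \<gamma> t] that N_G by simp
  show ?thesis
  proof (rule exI[of _ fs.\<Gamma>], rule exI[of _ fs.j], rule exI[of _ snd], rule exI[of _ fs.\<theta>],
      rule exI[of _ fs.nuc.sQ], rule exI[of _ fs.nuc.chi],
      unfold Let_def, intro conjI)
    show "group fs.\<Gamma>" by (rule fs.\<Gamma>_group)
    show "fs.j \<in> hom (units_of A) fs.\<Gamma>" by (rule fs.j_hom)
    show "inj_on fs.j (Units A)" by (rule fs.j_inj)
    show "snd \<in> hom fs.\<Gamma> ((aut_group TR)\<lparr>carrier := N\<rparr>)" using p_hom by (simp add: NN_def)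
    show "snd ` carrier fs.\<Gamma> = N" by (rule p_surj)
    show "{x \<in> carrier fs.\<Gamma>. snd x = restrict id T} = fs.j ` Units A" by (rule ker)
    show "fs.\<theta> \<in> hom fs.\<Gamma> (aut_group A)" by (rule fs.\<theta>_hom)
    show "ring_center fs.C = fs.emb ` S" by (rule center)
    show "fs.nuc.sQ \<in> hom Q (out_group fs.C)" by (rule fs.nuc.sQ_hom)
    show "teich_class fs.C Q fs.nuc.sQ = (\<lambda>f. restrict (fs.emb \<circ> f) (triples Q)) ` k" by (rule teich)
    show "fs.nuc.chi \<in> hom G (out_rel_group fs.C (fs.emb ` carrier A) (fs.emb ` Units A))" by (rule fs.nuc.chi_hom)
    show "\<forall>u\<in>Units A. fs.\<theta> (fs.j u) = conj_by A u" using fs.\<theta>_j by blast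
    show "\<forall>x\<in>carrier fs.\<Gamma>. \<forall>u\<in>Units A. fs.j (fs.\<theta> x u) = x \<otimes>\<^bsub>fs.\<Gamma>\<^esub> fs.j u \<otimes>\<^bsub>fs.\<Gamma>\<^esub> inv\<^bsub>fs.\<Gamma>\<^esub> x"
      using fs.j_\<theta> by blast
    show "\<forall>q\<in>carrier Q. \<forall>\<gamma>\<in>fs.nuc.sQ q. \<forall>s\<in>S. \<gamma> (fs.emb s) = fs.emb (\<kappa>Q q s)" using sQ_normal by blast
    show "\<forall>n\<in>N. fs.nuc.chi (n, \<one>\<^bsub>Q\<^esub>) \<subseteq> conj_by fs.C ` unit_normalizer fs.C (fs.emb ` carrier A) \<and>
        (\<forall>\<gamma>\<in>fs.nuc.chi (n, \<one>\<^bsub>Q\<^esub>). \<forall>t\<in>T. \<gamma> (fs.emb t) = fs.emb (n t))" using chi_N N_chi by blast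
    show "\<forall>g\<in>carrier G. fs.nuc.chi g \<subseteq> fs.nuc.sQ (snd g)" using fs.nuc.chi_subset_sQ by blast
    show "\<forall>g\<in>carrier G. \<forall>\<gamma>\<in>fs.nuc.chi g. \<forall>t\<in>T. \<gamma> (fs.emb t) = fs.emb (fst g t)" using chi_T by blast
    show "\<forall>g\<in>carrier G. \<forall>\<gamma>\<in>fs.nuc.chi g.
        restrict (\<lambda>a. the_inv_into (carrier A) fs.emb (\<gamma> (fs.emb a))) (carrier A) \<in> \<sigma>G g" using res by blast
  qed
qed

end
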